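(* Let $\rho$ be a compactly supported Borel probability measure on $\mathbb R$ that is not a single Dirac mass, let $E\in\mathbb R$, and let $\mu_E:=\int_{\mathbb R}\delta_{S_E(\omega)}\,d\rho(\omega)$, a Borel probability measure on $\mathrm{SL}(2,\mathbb R)$. Let $K\subset\mathrm{SL}(2,\mathbb R)$ be a compact set containing $\mathrm{supp}(\mu_E)$. Then the first Lyapunov exponent is Hölder continuous with respect to the measure in the Wasserstein distance near $\mu_E$: there are $\delta>0$, $C<\infty$ and $\theta>0$ such that for all Borel probability measures $\nu_1,\nu_2$ supported in $K$ with $W_1(\nu_i,\mu_E)<\delta$ ($i=1,2$), $$|L_1(\nu_1)-L_1(\nu_2)|\le C\,W_1(\nu_1,\nu_2)^{\theta}.$$
   Context: $S_E(\omega)=\begin{pmatrix}\omega-E&-1\\1&0\end{pmatrix}$ is the transfer matrix at energy $E$ of the one-dimensional random Schrödinger operator $(H\psi)_n=-\psi_{n+1}-\psi_{n-1}+\omega_n\psi_n$ on $\ell^2(\mathbb Z)$ with i.i.d. potential $(\omega_n)_{n\in\mathbb Z}$ of law $\rho$. For a compactly supported Borel probability measure $\nu$ on $\mathrm{SL}(2,\mathbb R)$, $L_1(\nu)=\lim_n\frac1n\log\|g_{n-1}\cdots g_1g_0\|$ for $\nu^{\mathbb Z}$-a.e. $(g_n)_{n\in\mathbb Z}$. In particular $L_1(\mu_E)=\lim_n\frac1n\log\|S_E(\omega_{n-1})\cdots S_E(\omega_1)S_E(\omega_0)\|$ almost surely. $W_1(\mu,\nu)=\inf_\pi\int \|g-h\|\,d\pi(g,h)$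 over all couplings $\pi$ of $\mu$ and $\nu$. *)

theory Defs
  imports "HOL-Probability.Probability"
begin

definition SL2 :: "(real^2^2) set" where
  "SL2 = {A. det A = 1}"

text \<open>Borel \<open>\<sigma>\<close>-algebra of the subspace \<open>SL2\<close> of the space of real 2x2 matrices.\<close>

abbreviation SL2_borel :: "(real^2^2) measure" where
  "SL2_borel \<equiv> restrict_space borel SL2"

definition borel_prob_SL2 :: "(real^2^2) measure \<Rightarrow> bool" where
  "borel_prob_SL2 \<nu> \<longleftrightarrow> prob_space \<nu> \<and> sets \<nu> = sets SL2_borel"

text \<open>The operator norm for the Euclidean norm on the plane; the instance \<open>norm\<close> on
  the type of matrices is the Frobenius norm.\<close>

definition opnorm :: "real^2^2 \<Rightarrow> real" where
  "opnorm A = onorm (\<lambda>x. A *v x)"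

text \<open>The topological support, relative to the space of the measure: the points all of
  whose neighbourhoods have positive measure. Intersecting with \<open>space M\<close> covers measures on
  a subspace such as \<open>SL2\<close>.\<close>

definition msupport :: "'a::topological_space measure \<Rightarrow> 'a set" where
  "msupport M = {x \<in> space M. \<forall>U. open U \<longrightarrow> x \<in> U \<longrightarrow> emeasure M (U \<inter> space M) > 0}"

definition transfer_matrix :: "real \<Rightarrow> real \<Rightarrow> real^2^2" where
  "transfer_matrix E \<omega> = vector [vector [\<omega> - E, -1], vector [1, 0]]"

text \<open>The law of the transfer matrix: the mixture of the Dirac masses at
  \<open>transfer_matrix E \<omega>\<close> with respect to \<open>\<rho>\<close> is the image measure.\<close>

definition transfer_law :: "real measure \<Rightarrow> real \<Rightarrow> (real^2^2) measure" where
  "transfer_law \<rho> E = distr \<rho> SL2_borel (transfer_matrix E)"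

primrec cocycle :: "(int \<Rightarrow> real^2^2) \<Rightarrow> nat \<Rightarrow> real^2^2" where
  "cocycle g 0 = mat 1"
| "cocycle g (Suc n) = g (int n) ** cocycle g n"

definition lyapunov1 :: "(real^2^2) measure \<Rightarrow> real" where
  "lyapunov1 \<nu> = (THE L. AE g in PiM (UNIV :: int set) (\<lambda>_. \<nu>).
      (\<lambda>n. ln (opnorm (cocycle g n)) / real n) \<longlonglongrightarrow> L)"

definition couplings :: "'a measure \<Rightarrow> 'b measure \<Rightarrow> ('a \<times> 'b) measure set" where
  "couplings M N = {\<pi>. prob_space \<pi> \<and> sets \<pi> = sets (M \<Otimes>\<^sub>M N) \<and>
      distr \<pi> M fst = M \<and> distr \<pi> N snd = N}"

text \<open>Extended-real valued, so that a divergent transport cost is infinite instead of 0; it is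
  finite for compactly supported measures.\<close>

definition wasserstein1 :: "(real^2^2) measure \<Rightarrow> (real^2^2) measure \<Rightarrow> ennreal" where
  "wasserstein1 \<mu> \<nu> = (INF \<pi>\<in>couplings \<mu> \<nu>. \<integral>\<^sup>+ (g, h). ennreal (opnorm (g - h)) \<partial>\<pi>)"

text \<open>Since \<open>distr\<close> is meaningful only for measurable maps, we record that the transfer
  matrix is one.\<close>

lemma transfer_matrix_in_SL2: "transfer_matrix E \<omega> \<in> SL2"
  by (simp add: SL2_def transfer_matrix_def det_2)

lemma transfer_matrix_measurable: "transfer_matrix E \<in> borel \<rightarrow>\<^sub>M SL2_borel"
proof (rule measurable_restrict_space2)
  have "transfer_matrix E \<omega> $ i $ j =
      (if i = 1 then if j = 1 then \<omega> - E else -1 else if j = 1 then 1 else 0)" for \<omega> i j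
    using exhaust_2[of i] exhaust_2[of j] by (auto simp: transfer_matrix_def)
  hence "continuous_on UNIV (\<lambda>\<omega>. transfer_matrix E \<omega> $ i $ j)" for i j
    by (cases "i = 1"; cases "j = 1") (auto intro!: continuous_intros)
  hence "continuous_on UNIV (\<lambda>\<omega>. \<chi> i j. transfer_matrix E \<omega> $ i $ j)"
    by (intro continuous_on_vec_lambda)
  thus "transfer_matrix E \<in> borel_measurable borel"
    by (simp add: borel_measurable_continuous_onI)
qed (auto simp: transfer_matrix_in_SL2)

lemma borel_prob_transfer_law:
  assumes "prob_space \<rho>" "sets \<rho> = sets borel"
  shows "borel_prob_SL2 (transfer_law \<rho> E)"
proof -
  have "transfer_matrix E \<in> \<rho> \<rightarrow>\<^sub>M SL2_borel"
    using transfer_matrix_measurable assms(2) measurable_cong_sets by blast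
  thus ?thesis
    by (simp add: borel_prob_SL2_def transfer_law_def prob_space.prob_space_distr[OF assms(1)])
qed

end

theory Submission
  imports Defs
begin

text \<open>
  Write \<open>\<mu>\<close> for the law of the transfer matrix and \<open>g\<^sup>n\<close> for the product of \<open>n\<close> independent matrices.
  The heart of the matter is to find \<open>n\<close> such that \<open>E ln (|g\<^sup>n x| / |x|)\<close> is bounded below by a positive constant
  for all \<open>x \<noteq> 0\<close>. First, \<open>E ln \<parallel>g\<^sup>n\<parallel>\<close> is unbounded: otherwise its lower limit, as a
  function of the starting matrix, is proper and superharmonic, and the set where it is minimal is compact and
  invariant under two transfer matrices, hence under an unbounded unipotent group.
  Secondly, words of length three move every line to three transversal lines, at most one of
  which is contracted by a given large matrix, so the expansion at the worst vector is about a third of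
  \<open>E ln \<parallel>g\<^sup>n\<parallel>\<close>.

  The lower bound is stable under perturbations of the law. Expanding an exponential, it makes the expectation of
  \<open>(|g\<^sup>n x| / |x|) powr (-2\<theta>)\<close> at most some \<open>\<kappa> < 1\<close> for all \<open>x\<close>, so that the \<open>\<theta>\<close>-th power of the angle
  between two directions contracts on average. Running two walks along an almost optimal coupling of their laws,
  the angle cost stays of the order of the \<open>\<theta>\<close>-th power of the transport distance, and so does
  the difference of the averaged logarithmic increments. The same contraction makes the expected growth almost
  additive and uniform in the direction; exponential moments and the Borel-Cantelli lemma then identify the
  almost sure limit.
\<close>

section \<open>Markov operators driven by i.i.d. random maps\<close>

text \<open>No stationary measure on the projective line is used: every estimate compares iterates
  of an averaging operator pointwise. The constants depend only on \<open>M\<close>, one block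
  length and the lower bound for that block, hence are uniform over the nearby laws.

  The obstacle is that comparing two products of \<open>n\<close> matrices letter by letter loses a
  factor \<open>M ^ (2 * n)\<close>, which is affordable only for a fixed block length. The area
  form overcomes it. Unimodular maps preserve it, so the sine of the angle between two images is a
  constant divided by the product of their norms, and the inequality between arithmetic and
  geometric mean reduces its \<theta>-th power to moments of order -2\<theta> of single vectors.
  Errors of order \<open>w powr \<theta>\<close> are then damped from block to block, and their sum
  grows only linearly in \<open>n\<close>.

  The unipotent element arises because two transfer matrices share their second row, so the quotient
  of two of them is a shear. That the minimal set is invariant under inverses, not only under the
  matrices themselves, is a recurrence argument: if the powers of a matrix stay bounded, some of
  them come close to the identity.\<close>

definition trans_op :: "'w measure \<Rightarrow> ('w \<Rightarrow> 'x \<Rightarrow> 'x) \<Rightarrow> ('x \<Rightarrow> real) \<Rightarrow> 'x \<Rightarrow> real" where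
  "trans_op N T f x = (\<integral>\<omega>. f (T \<omega> x) \<partial>N)"

primrec orbit :: "('w \<Rightarrow> 'x \<Rightarrow> 'x) \<Rightarrow> (int \<Rightarrow> 'w) \<Rightarrow> nat \<Rightarrow> 'x \<Rightarrow> 'x" where
  "orbit T w 0 x = x"
| "orbit T w (Suc n) x = T (w (int n)) (orbit T w n x)"

lemma orbit_cong: "(\<And>i. i < int n \<Longrightarrow> w i = w' i) \<Longrightarrow> orbit T w n x = orbit T w' n x"
  by (induction n) auto

lemma funpow_trans_op_Suc:
  "(trans_op N T ^^ Suc n) f x = (\<integral>\<omega>. (trans_op N T ^^ n) f (T \<omega> x) \<partial>N)"
  by (simp add: trans_op_def[of N T "(trans_op N T ^^ n) f"])

text \<open>The two iterated integrals have pointwise equal integrands. This serves to pass from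
  pairs to components, from matrices to vectors, and from a vector to its multiples.\<close>

lemma trans_op_semiconj_on:
  assumes "\<And>\<omega> x. x \<in> S \<Longrightarrow> T \<omega> x \<in> S" and "\<And>\<omega> x. x \<in> S \<Longrightarrow> \<phi> (T \<omega> x) = T' \<omega> (\<phi> x)"
    and "\<And>x. x \<in> S \<Longrightarrow> g x = f (\<phi> x)" and "x \<in> S"
  shows "(trans_op N T ^^ n) g x = (trans_op N T' ^^ n) f (\<phi> x)"
  using \<open>x \<in> S\<close>
proof (induction n arbitrary: x)
  case (Suc n)
  then show ?case unfolding funpow_trans_op_Suc by (simp add: assms)
qed (simp add: assms)

lemma trans_op_semiconj:
  assumes "\<And>\<omega> x. \<phi> (T \<omega> x) = T' \<omega> (\<phi> x)"
  shows "(trans_op N T ^^ n) (\<lambda>x. f (\<phi> x)) x = (trans_op N T' ^^ n) f (\<phi> x)"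
  by (rule trans_op_semiconj_on[where S = UNIV]) (simp_all add: assms)

text \<open>The function \<open>V\<close> gauges the points: test functions need only be bounded on its sublevel sets.\<close>

locale markov_chain = prob_space N
  for N :: "'w measure" and T :: "'w \<Rightarrow> 'x::topological_space \<Rightarrow> 'x" and V :: "'x \<Rightarrow> real" and c :: real +
  assumes T_measurable: "(\<lambda>(\<omega>, x). T \<omega> x) \<in> N \<Otimes>\<^sub>M borel \<rightarrow>\<^sub>M borel"
    and V_step: "\<And>\<omega> x. V (T \<omega> x) \<le> V x + c"
begin

abbreviation "P \<equiv> trans_op N T"

definition admissible :: "('x \<Rightarrow> real) \<Rightarrow> bool" where
  "admissible f \<longleftrightarrow> f \<in> borel_measurable borel \<and> (\<forall>r. \<exists>B. \<forall>x. V x \<le> r \<longrightarrow> \<bar>f x\<bar> \<le> B)"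

lemma T_measurable2: "(\<lambda>\<omega>. T \<omega> x) \<in> N \<rightarrow>\<^sub>M borel"
  using measurable_compose[OF measurable_Pair2' T_measurable, of x] by simp

lemma T_measurable_comp:
  "g \<in> R \<rightarrow>\<^sub>M N \<Longrightarrow> h \<in> R \<rightarrow>\<^sub>M borel \<Longrightarrow> (\<lambda>r. T (g r) (h r)) \<in> R \<rightarrow>\<^sub>M borel"
  using measurable_compose[OF measurable_Pair T_measurable, of g R h] by simp

lemma admissibleI:
  assumes "f \<in> borel_measurable borel" and "\<And>r. \<exists>B. \<forall>x. V x \<le> r \<longrightarrow> \<bar>f x\<bar> \<le> B"
  shows "admissible f"
  using assms by (auto simp: admissible_def)

lemma admissible_measurable: "admissible f \<Longrightarrow> f \<in> borel_measurable borel"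
  by (simp add: admissible_def)

lemma admissible_bound: "admissible f \<Longrightarrow> \<exists>B\<ge>0. \<forall>x. V x \<le> r \<longrightarrow> \<bar>f x\<bar> \<le> B"
  unfolding admissible_def by (metis abs_ge_zero le_cases order_trans)

lemma admissible_const [simp, intro]: "admissible (\<lambda>x. k)"
  by (rule admissibleI) auto

lemma admissible_add [intro]:
  assumes "admissible f" "admissible g"
  shows "admissible (\<lambda>x. f x + g x)"
proof (rule admissibleI)
  show "(\<lambda>x. f x + g x) \<in> borel_measurable borel"
    using assms[THEN admissible_measurable] by measurable
  fix r
  obtain A where "\<forall>x. V x \<le> r \<longrightarrow> \<bar>f x\<bar> \<le> A"
    using admissible_bound[OF assms(1)] by blast
  moreover obtain B where "\<forall>x. V x \<le> r \<longrightarrow> \<bar>g x\<bar> \<le> B"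
    using admissible_bound[OF assms(2)] by blast
  ultimately show "\<exists>B. \<forall>x. V x \<le> r \<longrightarrow> \<bar>f x + g x\<bar> \<le> B"
    by (intro exI[of _ "A + B"]) (smt (verit))
qed

lemma admissible_cmult [intro]:
  assumes "admissible f"
  shows "admissible (\<lambda>x. k * f x)"
proof (rule admissibleI)
  show "(\<lambda>x. k * f x) \<in> borel_measurable borel"
    using assms[THEN admissible_measurable] by measurable
  fix r
  obtain A where "\<forall>x. V x \<le> r \<longrightarrow> \<bar>f x\<bar> \<le> A"
    using admissible_bound[OF assms] by blast
  then show "\<exists>B. \<forall>x. V x \<le> r \<longrightarrow> \<bar>k * f x\<bar> \<le> B"
    by (intro exI[of _ "\<bar>k\<bar> * A"]) (auto simp: abs_mult mult_left_mono)
qed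

lemma admissible_diff [intro]:
  assumes "admissible f" "admissible g"
  shows "admissible (\<lambda>x. f x - g x)"
  using admissible_add[OF assms(1) admissible_cmult[OF assms(2), of "-1"]] by simp

lemma integrable_step:
  assumes "admissible f"
  shows "integrable N (\<lambda>\<omega>. f (T \<omega> x))"
proof -
  obtain B where "\<forall>y. V y \<le> V x + c \<longrightarrow> \<bar>f y\<bar> \<le> B"
    using admissible_bound[OF assms] by blast
  then have "AE \<omega> in N. norm (f (T \<omega> x)) \<le> B"
    using V_step by simp
  then show ?thesis
    using measurable_compose[OF T_measurable2 admissible_measurable[OF assms]]
    by (intro integrable_const_bound)
qed

lemma admissible_trans_op [intro]:
  assumes "admissible f"
  shows "admissible (P f)"
proof (rule admissibleI)
  show "P f \<in> borel_measurable borel"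
    unfolding trans_op_def
    by (intro borel_measurable_lebesgue_integral)
      (simp add: case_prod_unfold T_measurable_comp measurable_compose[OF _ admissible_measurable[OF assms]])
  fix r
  obtain B where B: "B \<ge> 0" "\<forall>y. V y \<le> r + c \<longrightarrow> \<bar>f y\<bar> \<le> B"
    using admissible_bound[OF assms] by blast
  show "\<exists>B. \<forall>x. V x \<le> r \<longrightarrow> \<bar>P f x\<bar> \<le> B"
  proof (intro exI[of _ B] allI impI)
    fix x assume "V x \<le> r"
    then have "\<bar>f (T \<omega> x)\<bar> \<le> B" for \<omega>
      using B(2) V_step[of \<omega> x] by simp
    then have "\<bar>\<integral>\<omega>. f (T \<omega> x) \<partial>N\<bar> \<le> (\<integral>\<omega>. B \<partial>N)"
      using integrable_step[OF assms]
      by (intro order_trans[OF integral_abs_bound] integral_mono) auto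
    then show "\<bar>P f x\<bar> \<le> B"
      by (simp add: trans_op_def prob_space)
  qed
qed

lemma admissible_funpow [intro]: "admissible f \<Longrightarrow> admissible ((P ^^ n) f)"
  by (induction n) auto

lemma trans_op_mono:
  assumes "admissible f" "admissible g" "\<And>\<omega>. f (T \<omega> x) \<le> g (T \<omega> x)"
  shows "P f x \<le> P g x"
  unfolding trans_op_def using assms by (intro integral_mono integrable_step)

text \<open>The index of \<open>S\<close> counts the steps still to be made: \<open>n\<close> steps
  from \<open>S n\<close> end in \<open>S 0\<close>, the only place where \<open>f\<close> and
  \<open>g\<close> are compared. A time-dependent \<open>S\<close> can record how far the orbit may
  have moved.\<close>

lemma funpow_mono_on:
  assumes "admissible f" "admissible g"
    and step: "\<And>n x \<omega>. x \<in> S (Suc n) \<Longrightarrow> T \<omega> x \<in> S n"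
    and le: "\<And>x. x \<in> S 0 \<Longrightarrow> f x \<le> g x" and "x \<in> S n"
  shows "(P ^^ n) f x \<le> (P ^^ n) g x"
  using \<open>x \<in> S n\<close>
proof (induction n arbitrary: x)
  case (Suc n)
  then have "P ((P ^^ n) f) x \<le> P ((P ^^ n) g) x"
    using assms(1,2) step by (intro trans_op_mono) auto
  then show ?case by simp
qed (use le in simp)

lemma funpow_mono_inv:
  assumes "admissible f" "admissible g"
    and "\<And>x \<omega>. x \<in> S \<Longrightarrow> T \<omega> x \<in> S" and "\<And>x. x \<in> S \<Longrightarrow> f x \<le> g x" and "x \<in> S"
  shows "(P ^^ n) f x \<le> (P ^^ n) g x"
  by (rule funpow_mono_on[where S = "\<lambda>_. S"]) (use assms in auto)

lemma trans_op_lincomb: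
  assumes "admissible f" "admissible g"
  shows "P (\<lambda>x. a * f x + b * g x + k) x = a * P f x + b * P g x + k"
  unfolding trans_op_def
  using integrable_step[OF assms(1), of x] integrable_step[OF assms(2), of x]
  by (simp add: prob_space)

lemma funpow_lincomb:
  assumes "admissible f" "admissible g"
  shows "(P ^^ n) (\<lambda>x. a * f x + b * g x + k) x = a * (P ^^ n) f x + b * (P ^^ n) g x + k"
proof (induction n arbitrary: x)
  case (Suc n)
  have "(P ^^ Suc n) (\<lambda>x. a * f x + b * g x + k) x = P (\<lambda>x. a * (P ^^ n) f x + b * (P ^^ n) g x + k) x"
    by (simp add: ext[OF Suc])
  also have "\<dots> = a * P ((P ^^ n) f) x + b * P ((P ^^ n) g) x + k"
    using assms by (intro trans_op_lincomb) auto
  finally show ?case by simp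
qed simp

lemma funpow_affine:
  assumes "admissible f"
  shows "(P ^^ n) (\<lambda>x. a * f x + k) x = a * (P ^^ n) f x + k"
  using funpow_lincomb[OF assms admissible_const[of 0], of n a 0 k x] by simp

lemma funpow_const: "(P ^^ n) (\<lambda>x. k) x = k"
  using funpow_affine[OF admissible_const[of 0], of n 0 k x] by simp

lemma orbit_measurable:
  "(\<lambda>w. orbit T w n x) \<in> PiM UNIV (\<lambda>_. N) \<rightarrow>\<^sub>M borel"
  by (induction n) (simp_all add: T_measurable_comp)

lemma V_orbit: "V (orbit T w n x) \<le> V x + real n * c"
proof (induction n)
  case (Suc n)
  then show ?case
    using V_step[of "w (int n)" "orbit T w n x"] by (simp add: algebra_simps)
qed simp

lemma integrable_orbit:
  assumes "admissible f"
  shows "integrable (PiM UNIV (\<lambda>_. N)) (\<lambda>w. f (orbit T w n x))"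
proof -
  interpret prod: prob_space "PiM (UNIV :: int set) (\<lambda>_. N)"
    by (intro prob_space_PiM prob_space_axioms)
  obtain B where "\<forall>y. V y \<le> V x + real n * c \<longrightarrow> \<bar>f y\<bar> \<le> B"
    using admissible_bound[OF assms] by blast
  then have "AE w in PiM UNIV (\<lambda>_. N). norm (f (orbit T w n x)) \<le> B"
    using V_orbit by simp
  then show ?thesis
    using measurable_compose[OF orbit_measurable admissible_measurable[OF assms]]
    by (intro prod.integrable_const_bound)
qed

text \<open>Powers of \<open>P\<close> split off the first letter, whereas \<open>orbit\<close> adds
  the last one. Separating coordinate \<open>int n\<close> from the product measure and using
  Fubini's theorem averages over the last letter and turns \<open>f\<close> into \<open>P f\<close>;
  therefore the induction runs over all \<open>f\<close>.\<close>

lemma integral_orbit: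
  assumes "admissible f"
  shows "(\<integral>w. f (orbit T w n x) \<partial>PiM UNIV (\<lambda>_. N)) = (P ^^ n) f x"
  using assms
proof (induction n arbitrary: f)
  case 0
  interpret prod: prob_space "PiM (UNIV :: int set) (\<lambda>_. N)"
    by (intro prob_space_PiM prob_space_axioms)
  show ?case by (simp add: prod.prob_space)
next
  case (Suc n)
  let ?i = "int n"
  let ?I = "UNIV - {?i}"
  let ?R = "PiM ?I (\<lambda>_. N)"
  let ?U = "PiM UNIV (\<lambda>_::int. N)"
  interpret R: prob_space ?R
    by (intro prob_space_PiM prob_space_axioms)
  interpret NR: pair_prob_space N ?R ..
  have ins: "insert ?i ?I = UNIV" by auto
  have U: "distr (N \<Otimes>\<^sub>M ?R) ?U (\<lambda>(y, X). X(?i := y)) = ?U"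
    using distr_pair_PiM_eq_PiM[of ?I "\<lambda>_. N" ?i] prob_space_axioms by (simp add: ins)
  have m: "(\<lambda>(y, X). X(?i := y)) \<in> N \<Otimes>\<^sub>M ?R \<rightarrow>\<^sub>M ?U"
    unfolding case_prod_unfold
    by (rule measurable_fun_upd[where J = ?I]) (use ins in auto)
  \<comment> \<open>The orbit up to time \<open>n\<close> reads only coordinates below
    \<open>n\<close>; overwriting coordinate \<open>n\<close> by a dummy makes \<open>Y\<close> a
    function of the remaining coordinates.\<close>
  define Y where "Y X = orbit T (X(?i := undefined)) n x" for X
  have Y: "orbit T (X(?i := y)) n x = Y X" for X y
    unfolding Y_def by (rule orbit_cong) auto
  have meas: "(\<lambda>w. g (orbit T w k x)) \<in> borel_measurable ?U" if "admissible g" for g k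
    using measurable_compose[OF orbit_measurable admissible_measurable[OF that]] .
  have int: "integrable (N \<Otimes>\<^sub>M ?R) (\<lambda>(y, X). g (orbit T (X(?i := y)) k x))"
    if "admissible g" for g k
  proof -
    have "integrable (distr (N \<Otimes>\<^sub>M ?R) ?U (\<lambda>(y, X). X(?i := y))) (\<lambda>w. g (orbit T w k x))"
      using integrable_orbit[OF that, of k x] by (simp only: U)
    then show ?thesis
      unfolding integrable_distr_eq[OF m meas[OF that]] by (simp only: case_prod_unfold)
  qed
  have push: "(\<integral>w. g (orbit T w k x) \<partial>?U) = (\<integral>y. \<integral>X. g (orbit T (X(?i := y)) k x) \<partial>?R \<partial>N)"
    if "admissible g" for g k
  proof -
    have "(\<integral>w. g (orbit T w k x) \<partial>?U)
        = (\<integral>w. g (orbit T w k x) \<partial>distr (N \<Otimes>\<^sub>M ?R) ?U (\<lambda>(y, X). X(?i := y)))"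
      by (simp only: U)
    also have "\<dots> = (\<integral>(y, X). g (orbit T (X(?i := y)) k x) \<partial>(N \<Otimes>\<^sub>M ?R))"
      unfolding integral_distr[OF m meas[OF that]] by (simp only: case_prod_unfold)
    also have "\<dots> = (\<integral>y. \<integral>X. g (orbit T (X(?i := y)) k x) \<partial>?R \<partial>N)"
      using NR.integral_fst'[OF int[OF that, of k]] by (simp only: case_prod_unfold fst_conv snd_conv)
    finally show ?thesis .
  qed
  have "(\<integral>w. f (orbit T w (Suc n) x) \<partial>?U) = (\<integral>y. \<integral>X. f (T y (Y X)) \<partial>?R \<partial>N)"
    using push[OF Suc.prems, of "Suc n"] by (simp add: Y)
  also have "\<dots> = (\<integral>X. \<integral>y. f (T y (Y X)) \<partial>N \<partial>?R)"
    using int[OF Suc.prems, of "Suc n"] by (intro NR.Fubini_integral[symmetric]) (simp add: Y)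
  also have "\<dots> = (\<integral>X. P f (Y X) \<partial>?R)"
    unfolding trans_op_def ..
  \<comment> \<open>An idle average over coordinate \<open>n\<close> restores the full product
    measure.\<close>
  also have "\<dots> = (\<integral>y. (\<integral>X. P f (Y X) \<partial>?R) \<partial>N)"
    by (simp add: prob_space)
  also have "\<dots> = (\<integral>w. P f (orbit T w n x) \<partial>?U)"
    unfolding push[OF admissible_trans_op[OF Suc.prems]] Y ..
  also have "\<dots> = (P ^^ n) (P f) x"
    by (rule Suc.IH[OF admissible_trans_op[OF Suc.prems]])
  finally show ?case
    by (simp only: funpow_Suc_right o_apply)
qed

end

section \<open>Unimodular matrices and the projective line\<close>

text \<open>The area form. A unimodular map preserves it, so such a map changes the angle between
  two directions only through the norms of the images.\<close>

definition wedge :: "real^2 \<Rightarrow> real^2 \<Rightarrow> real" where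
  "wedge x y = x $ 1 * y $ 2 - x $ 2 * y $ 1"

lemma matrix_vector_2: "((A :: real^2^2) *v x) $ i = A $ i $ 1 * x $ 1 + A $ i $ 2 * x $ 2"
  by (simp add: matrix_vector_mult_def sum_2)

lemma inner_2: "x \<bullet> (y :: real^2) = x $ 1 * y $ 1 + x $ 2 * y $ 2"
  by (simp add: inner_vec_def sum_2)

lemma wedge_matrix: "wedge (A *v x) (A *v y) = det A * wedge x y"
  by (simp add: wedge_def matrix_vector_2 det_2 algebra_simps)

lemma wedge_zero [simp]: "wedge 0 x = 0" "wedge x 0 = 0"
  by (simp_all add: wedge_def)

lemma wedge_scale: "wedge (a *\<^sub>R x) y = a * wedge x y" "wedge x (a *\<^sub>R y) = a * wedge x y"
  by (simp_all add: wedge_def algebra_simps)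

lemma wedge_diff: "wedge (x - y) y = wedge x y" "wedge x (y - x) = wedge x y"
  by (simp_all add: wedge_def algebra_simps)

lemma wedge_commute: "wedge x y = - wedge y x"
  by (simp add: wedge_def)

lemma Lagrange_identity: "(wedge x y)\<^sup>2 + (x \<bullet> y)\<^sup>2 = (norm x)\<^sup>2 * (norm y)\<^sup>2"
  unfolding power2_norm_eq_inner wedge_def inner_2 by algebra

lemma abs_wedge_le: "\<bar>wedge x y\<bar> \<le> norm x * norm y"
proof -
  have "(wedge x y)\<^sup>2 \<le> (norm x * norm y)\<^sup>2"
    using Lagrange_identity[of x y] by (simp add: power_mult_distrib) (smt (verit) zero_le_power2)
  then show ?thesis
    using abs_le_square_iff[of "wedge x y" "norm x * norm y"] by simp
qed

text \<open>This is the addition formula for the sine, with the cosines bounded by 1.\<close>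

lemma wedge_triangle: "\<bar>wedge x z\<bar> * norm y \<le> \<bar>wedge x y\<bar> * norm z + \<bar>wedge y z\<bar> * norm x"
proof (cases "y = 0")
  case False
  have "wedge x z * (y \<bullet> y) = wedge x y * (z \<bullet> y) + wedge y z * (x \<bullet> y)"
    unfolding wedge_def inner_2 by algebra
  then have "\<bar>wedge x z\<bar> * (norm y)\<^sup>2 \<le> \<bar>wedge x y\<bar> * \<bar>z \<bullet> y\<bar> + \<bar>wedge y z\<bar> * \<bar>x \<bullet> y\<bar>"
    unfolding power2_norm_eq_inner by (metis abs_mult abs_triangle_ineq abs_of_nonneg inner_ge_zero)
  also have "\<dots> \<le> \<bar>wedge x y\<bar> * (norm z * norm y) + \<bar>wedge y z\<bar> * (norm x * norm y)"
    by (intro add_mono mult_left_mono Cauchy_Schwarz_ineq2) auto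
  finally have "(\<bar>wedge x z\<bar> * norm y) * norm y \<le> (\<bar>wedge x y\<bar> * norm z + \<bar>wedge y z\<bar> * norm x) * norm y"
    by (simp add: power2_eq_square algebra_simps)
  then show ?thesis
    using False by simp
qed simp

lemma exists_wedge_norm: "\<exists>y. norm y = norm x \<and> wedge x y = (norm x)\<^sup>2"
proof -
  let ?y = "vector [- (x $ 2), x $ 1] :: real^2"
  have "wedge x ?y = (norm x)\<^sup>2"
    unfolding power2_norm_eq_inner by (simp add: wedge_def inner_2)
  moreover have "norm ?y = norm x"
    by (simp add: norm_eq_sqrt_inner inner_2)
  ultimately show ?thesis by blast
qed

section \<open>The operator norm and unimodular matrices\<close>

lemma norm_le_opnorm: "norm (A *v x) \<le> opnorm A * norm x"
  unfolding opnorm_def by (rule onorm) simp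

lemma opnorm_le: "(\<And>x. norm (A *v x) \<le> b * norm x) \<Longrightarrow> opnorm A \<le> b"
  unfolding opnorm_def by (rule onorm_le)

lemma opnorm_nonneg: "0 \<le> opnorm A"
  unfolding opnorm_def by (rule onorm_pos_le) simp

lemma opnorm_mult: "opnorm (A ** B) \<le> opnorm A * opnorm B"
proof (rule opnorm_le)
  fix x
  have "norm (A *v (B *v x)) \<le> opnorm A * (opnorm B * norm x)"
    by (intro order_trans[OF norm_le_opnorm] mult_left_mono norm_le_opnorm opnorm_nonneg)
  then show "norm (A ** B *v x) \<le> opnorm A * opnorm B * norm x"
    by (simp add: matrix_vector_mul_assoc mult.assoc)
qed

lemma opnorm_add: "opnorm (A + B) \<le> opnorm A + opnorm B"
proof (rule opnorm_le)
  fix x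
  have "norm (A *v x + B *v x) \<le> opnorm A * norm x + opnorm B * norm x"
    by (intro norm_triangle_le add_mono norm_le_opnorm)
  then show "norm ((A + B) *v x) \<le> (opnorm A + opnorm B) * norm x"
    by (simp add: matrix_vector_mult_add_rdistrib algebra_simps)
qed

lemma opnorm_minus: "opnorm (A - B) = opnorm (B - A)"
proof -
  have "opnorm (A - B) \<le> opnorm (B - A)" for A B
    using norm_le_opnorm[of "B - A"]
    by (intro opnorm_le) (simp add: matrix_vector_mult_diff_rdistrib norm_minus_commute)
  then show ?thesis by (simp add: antisym)
qed

lemma opnorm_le_norm: "opnorm A \<le> 4 * norm A"
proof -
  have "opnorm A \<le> (\<Sum>i\<in>UNIV. \<Sum>j\<in>UNIV. \<bar>A $ i $ j\<bar>)"
    unfolding opnorm_def by (rule onorm_le_matrix_component_sum)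
  also have "\<dots> \<le> (\<Sum>i\<in>(UNIV::2 set). \<Sum>j\<in>(UNIV::2 set). norm A)"
    by (intro sum_mono order_trans[OF component_le_norm_cart] Finite_Cartesian_Product.norm_nth_le)
  finally show ?thesis by simp
qed

lemma opnorm_diff_le: "\<bar>opnorm A - opnorm B\<bar> \<le> opnorm (A - B)"
  using opnorm_add[of "A - B" B] opnorm_add[of "B - A" A] opnorm_minus[of A B] by simp

lemma continuous_on_opnorm: "continuous_on S opnorm"
proof (rule continuous_on_subset[OF _ subset_UNIV], rule continuous_onI)
  fix A :: "real^2^2" and e :: real assume "e > 0"
  have bound: "dist (opnorm B) (opnorm A) \<le> 4 * dist B A" for B
    using opnorm_diff_le[of B A] opnorm_le_norm[of "B - A"] by (simp add: dist_norm)
  show "\<exists>d>0. \<forall>B\<in>UNIV. dist B A < d \<longrightarrow> dist (opnorm B) (opnorm A) \<le> e"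
  proof (intro exI[of _ "e / 4"] conjI ballI impI)
    fix B assume "dist B A < e / 4"
    then show "dist (opnorm B) (opnorm A) \<le> e"
      using bound[of B] by linarith
  qed (use \<open>e > 0\<close> in simp)
qed

lemma opnorm_measurable [measurable]: "opnorm \<in> borel_measurable borel"
  by (intro borel_measurable_continuous_onI continuous_on_opnorm)

text \<open>Take \<open>y\<close> orthogonal to \<open>x\<close> and of the same length: the square
  they span has area \<open>(norm x)\<^sup>2\<close>, and its image has the same area, which is at
  most the product of the norms of the two images.\<close>

lemma norm_le_opnorm_inverse:
  assumes "det A = 1"
  shows "norm x \<le> opnorm A * norm (A *v x)"
proof (cases "x = 0")
  case False
  obtain y where y: "norm y = norm x" "wedge x y = (norm x)\<^sup>2"
    using exists_wedge_norm by blast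
  have "(norm x)\<^sup>2 = wedge (A *v x) (A *v y)"
    using assms y by (simp add: wedge_matrix)
  also have "\<dots> \<le> norm (A *v x) * norm (A *v y)"
    using abs_wedge_le[of "A *v x" "A *v y"] by simp
  also have "\<dots> \<le> norm (A *v x) * (opnorm A * norm x)"
    using y norm_le_opnorm[of A y] by (intro mult_left_mono) auto
  finally have "norm x * norm x \<le> (opnorm A * norm (A *v x)) * norm x"
    by (simp add: power2_eq_square algebra_simps)
  then show ?thesis
    using False by simp
qed (simp add: opnorm_nonneg)

lemma norm_diff_quotient_le:
  assumes "det B = 1" "opnorm B \<le> M" "x \<noteq> 0"
  shows "norm (A *v x - B *v x) / norm (B *v x) \<le> M * opnorm (A - B)"
proof -
  have low: "norm x \<le> M * norm (B *v x)"
    by (rule order_trans[OF norm_le_opnorm_inverse[OF assms(1)]]) (intro mult_right_mono assms, simp)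
  then have "0 < norm (B *v x)" using assms(3) by (cases "B *v x = 0") auto
  moreover have "norm (A *v x - B *v x) \<le> opnorm (A - B) * norm x"
    using norm_le_opnorm[of "A - B" x] by (simp add: matrix_vector_mult_diff_rdistrib)
  moreover have "opnorm (A - B) * norm x \<le> opnorm (A - B) * (M * norm (B *v x))"
    by (intro mult_left_mono low opnorm_nonneg)
  ultimately show ?thesis by (simp add: divide_le_eq ac_simps)
qed

lemma matrix_vector_nonzero: "det (A :: real^2^2) = 1 \<Longrightarrow> x \<noteq> 0 \<Longrightarrow> A *v x \<noteq> 0"
  using norm_le_opnorm_inverse[of A x] by auto

lemma opnorm_le_mult:
  assumes "det B = 1"
  shows "opnorm A \<le> opnorm B * opnorm (B ** A)"
proof (rule opnorm_le)
  fix x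
  have "norm (A *v x) \<le> opnorm B * norm (B *v (A *v x))"
    by (rule norm_le_opnorm_inverse[OF assms])
  also have "\<dots> \<le> opnorm B * (opnorm (B ** A) * norm x)"
    using norm_le_opnorm[of "B ** A" x]
    by (intro mult_left_mono) (auto simp: matrix_vector_mul_assoc opnorm_nonneg)
  finally show "norm (A *v x) \<le> opnorm B * opnorm (B ** A) * norm x"
    by (simp add: mult.assoc)
qed

lemma opnorm_mat_1 [simp]: "opnorm (mat 1) = 1"
  by (simp add: opnorm_def onorm_id)

lemma opnorm_ge_1:
  assumes "det A = 1"
  shows "1 \<le> opnorm A"
proof -
  have "1 \<le> opnorm A * opnorm A"
    using opnorm_le_mult[OF assms, of "mat 1"] by simp
  then have "1\<^sup>2 \<le> (opnorm A)\<^sup>2"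
    by (simp add: power2_eq_square)
  then show ?thesis
    by (rule power2_le_imp_le) (rule opnorm_nonneg)
qed

lemma opnorm_eq_0: "opnorm A = 0 \<Longrightarrow> A = 0"
  using norm_le_opnorm[of A] by (simp add: matrix_eq)

lemma continuous_on_matrix_vector [continuous_intros]:
  fixes A :: "'a::topological_space \<Rightarrow> real^2^2"
  assumes "continuous_on S A" "continuous_on S x"
  shows "continuous_on S (\<lambda>t. A t *v x t)"
  unfolding matrix_vector_mult_def
  by (intro continuous_on_vec_lambda continuous_intros continuous_on_component assms)

lemma continuous_on_matrix_matrix [continuous_intros]:
  fixes A :: "'a::topological_space \<Rightarrow> real^2^2" and B :: "'a \<Rightarrow> real^2^2"
  assumes "continuous_on S A" "continuous_on S B"
  shows "continuous_on S (\<lambda>t. A t ** B t)"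
  unfolding matrix_matrix_mult_def
  by (intro continuous_on_vec_lambda continuous_intros continuous_on_component assms)

lemma det_measurable: "(\<lambda>A :: real^2^2. det A) \<in> borel_measurable borel"
proof -
  have "continuous_on UNIV (\<lambda>A :: real^2^2. det A)"
    unfolding det_2 by (intro continuous_intros continuous_on_component)
  then show ?thesis
    by (rule borel_measurable_continuous_onI)
qed

lemma matrix_vector_measurable:
  assumes "A \<in> M \<rightarrow>\<^sub>M borel" "x \<in> M \<rightarrow>\<^sub>M borel"
  shows "(\<lambda>t. (A t :: real^2^2) *v x t) \<in> M \<rightarrow>\<^sub>M borel"
  by (rule borel_measurable_continuous_Pair[OF assms]) (auto intro!: continuous_intros)

lemma matrix_matrix_measurable:
  assumes "A \<in> M \<rightarrow>\<^sub>M borel" "B \<in> M \<rightarrow>\<^sub>M borel"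
  shows "(\<lambda>t. (A t :: real^2^2) ** (B t :: real^2^2)) \<in> M \<rightarrow>\<^sub>M borel"
  by (rule borel_measurable_continuous_Pair[OF assms]) (auto intro!: continuous_intros)

text \<open>This is 0 if one of the vectors vanishes.\<close>

definition sin_dist :: "real^2 \<Rightarrow> real^2 \<Rightarrow> real" where
  "sin_dist x y = \<bar>wedge x y\<bar> / (norm x * norm y)"

lemma sin_dist_nonneg: "0 \<le> sin_dist x y"
  by (simp add: sin_dist_def)

lemma sin_dist_le_1: "sin_dist x y \<le> 1"
  using abs_wedge_le[of x y] by (auto simp: sin_dist_def divide_le_eq_1)

lemma sin_dist_commute: "sin_dist x y = sin_dist y x"
  using wedge_commute[of x y] by (simp add: sin_dist_def mult.commute)

lemma sin_dist_triangle: 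
  assumes "y \<noteq> 0"
  shows "sin_dist x z \<le> sin_dist x y + sin_dist y z"
proof (cases "x = 0 \<or> z = 0")
  case False
  then have "sin_dist x z = (\<bar>wedge x z\<bar> * norm y) / (norm x * norm y * norm z)"
    using assms by (simp add: sin_dist_def)
  also have "\<dots> \<le> (\<bar>wedge x y\<bar> * norm z + \<bar>wedge y z\<bar> * norm x) / (norm x * norm y * norm z)"
    by (intro divide_right_mono wedge_triangle) auto
  also have "\<dots> = sin_dist x y + sin_dist y z"
    using False assms by (simp add: sin_dist_def field_simps)
  finally show ?thesis .
qed (use sin_dist_nonneg[of x y] sin_dist_nonneg[of y z] in \<open>auto simp: sin_dist_def\<close>)

lemma sin_dist_le_norm:
  assumes "x \<noteq> 0"
  shows "sin_dist x y \<le> norm (x - y) / norm x"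
proof (cases "y = 0")
  case False
  have "\<bar>wedge x y\<bar> \<le> norm (x - y) * norm y"
    using abs_wedge_le[of "x - y" y] by (simp add: wedge_diff)
  then show ?thesis
    using False assms by (simp add: sin_dist_def field_simps)
qed (simp add: sin_dist_def)

lemma sin_dist_measurable:
  assumes "f \<in> M \<rightarrow>\<^sub>M borel" "g \<in> M \<rightarrow>\<^sub>M borel"
  shows "(\<lambda>t. sin_dist (f t) (g t)) \<in> borel_measurable M"
proof -
  have "continuous_on UNIV (\<lambda>x. x $ i)" for i :: 2 and S :: "(real^2) set"
    by (intro continuous_on_component continuous_intros)
  then have [measurable]: "(\<lambda>x::real^2. x $ i) \<in> borel_measurable borel" for i
    by (simp add: borel_measurable_continuous_onI)
  note [measurable] = assms
  show ?thesis
    unfolding sin_dist_def wedge_def by measurable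
qed

lemma ln_norm_diff_le:
  assumes "x \<noteq> 0" "y \<noteq> 0"
  shows "ln (norm x) - ln (norm y) \<le> norm (x - y) / norm y"
proof -
  have "ln (norm x) - ln (norm y) = ln (norm x / norm y)"
    using assms by (simp add: ln_div)
  also have "\<dots> \<le> norm x / norm y - 1"
    using assms by (intro ln_le_minus_one) simp
  also have "\<dots> = (norm x - norm y) / norm y"
    using assms by (simp add: field_simps)
  also have "\<dots> \<le> norm (x - y) / norm y"
    by (intro divide_right_mono norm_triangle_ineq2) auto
  finally show ?thesis .
qed

text \<open>With \<open>c = x \<bullet> y\<close> in the unit interval, \<open>1 - c\<close> is at
  most \<open>1 - c\<^sup>2\<close>, the squared sine. The sign condition excludes nearly opposite
  vectors, whose \<open>sin_dist\<close> is small although they are far apart.\<close>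

lemma unit_diff_le_sin_dist:
  assumes "norm x = 1" "norm y = 1" "0 \<le> x \<bullet> y"
  shows "norm (x - y) \<le> 2 * sin_dist x y"
proof -
  let ?c = "x \<bullet> y"
  have le1: "?c \<le> 1"
    using norm_cauchy_schwarz[of x y] assms by simp
  have "(norm (x - y))\<^sup>2 = 2 - 2 * ?c"
    using assms unfolding power2_norm_eq_inner norm_eq_1
    by (simp add: inner_diff_left inner_diff_right inner_commute)
  also have "\<dots> \<le> 2 * (1 - ?c\<^sup>2)"
    using le1 assms(3) by (simp add: power2_eq_square mult_left_le)
  also have "\<dots> = 2 * (wedge x y)\<^sup>2"
    using Lagrange_identity[of x y] assms(1,2) by simp
  also have "\<dots> \<le> (2 * \<bar>wedge x y\<bar>)\<^sup>2"
    by (simp only: power_mult_distrib power2_abs) simp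
  finally have "norm (x - y) \<le> 2 * \<bar>wedge x y\<bar>"
    by (rule power2_le_imp_le) simp
  then show ?thesis
    unfolding sin_dist_def assms(1,2) by simp
qed

lemma log_expansion_diff_unit:
  assumes "det A = 1" "norm x = 1" "norm y = 1" "0 \<le> x \<bullet> y"
  shows "ln (norm (A *v x)) - ln (norm (A *v y)) \<le> 2 * (opnorm A)\<^sup>2 * sin_dist x y"
proof -
  have nz: "A *v x \<noteq> 0" "A *v y \<noteq> 0"
    using assms(2,3) by (intro matrix_vector_nonzero assms(1); force)+
  have pos: "0 < opnorm A" using opnorm_ge_1[OF assms(1)] by simp
  have low: "1 / opnorm A \<le> norm (A *v y)"
    using norm_le_opnorm_inverse[OF assms(1), of y] pos assms by (simp add: field_simps)
  have "ln (norm (A *v x)) - ln (norm (A *v y)) \<le> norm (A *v (x - y)) / norm (A *v y)"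
    using ln_norm_diff_le[OF nz] by (simp add: matrix_vector_mult_diff_distrib)
  also have "\<dots> \<le> (opnorm A * norm (x - y)) / (1 / opnorm A)"
    using low pos by (intro frac_le norm_le_opnorm) (auto simp: opnorm_nonneg)
  also have "\<dots> = (opnorm A)\<^sup>2 * norm (x - y)"
    by (simp add: power2_eq_square)
  also have "\<dots> \<le> (opnorm A)\<^sup>2 * (2 * sin_dist x y)"
    by (intro mult_left_mono unit_diff_le_sin_dist assms) auto
  finally show ?thesis by (simp add: algebra_simps)
qed

lemma log_expansion_diff:
  assumes "det A = 1" "x \<noteq> 0" "y \<noteq> 0"
  shows "(ln (norm (A *v x)) - ln (norm x)) - (ln (norm (A *v y)) - ln (norm y))
    \<le> 2 * (opnorm A)\<^sup>2 * sin_dist x y"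
proof -
  \<comment> \<open>Neither \<open>sin_dist\<close> nor the norms notice the sign of
    \<open>y\<close>, so it is chosen to make the angle acute.\<close>
  define s where "s = (if 0 \<le> x \<bullet> y then 1 else -1 :: real)"
  define u where "u = x /\<^sub>R norm x"
  define v where "v = (s / norm y) *\<^sub>R y"
  have s: "\<bar>s\<bar> = 1" by (simp add: s_def)
  have "0 \<le> u \<bullet> v"
    by (auto simp: u_def v_def s_def intro!: divide_nonpos_nonneg mult_nonneg_nonpos)
  moreover have "norm u = 1" "norm v = 1"
    using assms s by (simp_all add: u_def v_def)
  ultimately have "ln (norm (A *v u)) - ln (norm (A *v v)) \<le> 2 * (opnorm A)\<^sup>2 * sin_dist u v"
    by (intro log_expansion_diff_unit assms)
  moreover have "sin_dist u v = sin_dist x y"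
    using assms s by (simp add: sin_dist_def u_def v_def wedge_scale abs_mult divide_inverse_commute)
  moreover have "norm (A *v u) = norm (A *v x) / norm x" "norm (A *v v) = norm (A *v y) / norm y"
    using s by (simp_all add: u_def v_def matrix_vector_mult_scaleR field_simps)
  moreover have "A *v x \<noteq> 0" "A *v y \<noteq> 0"
    using assms matrix_vector_nonzero by blast+
  ultimately show ?thesis
    using assms by (simp add: ln_div)
qed

lemma (in markov_chain) trans_op_diff_le:
  assumes "admissible f" "admissible g" "\<And>\<omega>. f (T \<omega> x) - g (T \<omega> y) \<le> k"
  shows "P f x - P g y \<le> k"
proof -
  have "P f x - P g y = (\<integral>\<omega>. f (T \<omega> x) - g (T \<omega> y) \<partial>N)"
    unfolding trans_op_def using assms by (simp add: integrable_step)
  also have "\<dots> \<le> (\<integral>\<omega>. k \<partial>N)"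
    using assms by (intro integral_mono Bochner_Integration.integrable_diff integrable_step) auto
  finally show ?thesis by (simp add: prob_space)
qed

section \<open>Random products of unimodular matrices\<close>

text \<open>The expectation of \<open>ln (norm x)\<close> after \<open>n\<close> steps, written as
  an operator power so that inductions on \<open>n\<close> need no product space.\<close>

definition exp_log :: "'w measure \<Rightarrow> ('w \<Rightarrow> real^2^2) \<Rightarrow> nat \<Rightarrow> real^2 \<Rightarrow> real" where
  "exp_log N G n = (trans_op N (\<lambda>\<omega> x. G \<omega> *v x) ^^ n) (\<lambda>x. ln (norm x))"

definition expansion :: "'w measure \<Rightarrow> ('w \<Rightarrow> real^2^2) \<Rightarrow> nat \<Rightarrow> real^2 \<Rightarrow> real" where
  "expansion N G n x = exp_log N G n x - ln (norm x)"

lemma exp_log_0 [simp]: "exp_log N G 0 x = ln (norm x)"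
  by (simp add: exp_log_def)

lemma exp_log_Suc: "exp_log N G (Suc n) = trans_op N (\<lambda>\<omega> x. G \<omega> *v x) (exp_log N G n)"
  by (simp add: exp_log_def)

lemma exp_log_add: "exp_log N G (n + m) = (trans_op N (\<lambda>\<omega> x. G \<omega> *v x) ^^ n) (exp_log N G m)"
  by (simp add: exp_log_def funpow_add)

lemma expansion_0 [simp]: "expansion N G 0 x = 0"
  by (simp add: expansion_def)

text \<open>Determinant and norm bound are required for every letter rather than almost every one,
  so that pointwise inductions carry no null sets. Laws supported in a compact set are brought into
  this form by \<open>retract\<close>.\<close>

locale sl2_walk = prob_space N for N :: "'w measure" +
  fixes G :: "'w \<Rightarrow> real^2^2" and M :: real
  assumes G_measurable: "G \<in> N \<rightarrow>\<^sub>M borel"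
    and G_det: "det (G \<omega>) = 1"
    and G_bound: "opnorm (G \<omega>) \<le> M"
begin

lemma M_ge_1: "1 \<le> M"
  using G_bound[of undefined] opnorm_ge_1[OF G_det, of undefined] by linarith

lemma norm_step_le: "norm (G \<omega> *v x) \<le> M * norm x"
  by (rule order_trans[OF norm_le_opnorm]) (intro mult_right_mono G_bound, simp)

lemma norm_step_ge: "norm x \<le> M * norm (G \<omega> *v x)"
  by (rule order_trans[OF norm_le_opnorm_inverse[OF G_det[of \<omega>]]]) (intro mult_right_mono G_bound, simp)

lemma step_nonzero: "x \<noteq> 0 \<Longrightarrow> G \<omega> *v x \<noteq> 0"
  by (rule matrix_vector_nonzero[OF G_det])

lemma abs_ln_diff_le:
  assumes "0 < a" "0 < b" "a \<le> M * b" "b \<le> M * a"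
  shows "\<bar>ln a - ln b\<bar> \<le> ln M"
proof -
  have "ln a \<le> ln (M * b)" "ln b \<le> ln (M * a)"
    using assms by auto
  then show ?thesis
    using assms M_ge_1 by (simp add: ln_mult)
qed

text \<open>Because of \<open>ln 0 = 0\<close> the bound includes the zero vector, and
  \<open>\<bar>ln (norm x)\<bar>\<close> can serve as gauge on the whole plane.\<close>

lemma ln_norm_step: "\<bar>ln (norm (G \<omega> *v x)) - ln (norm x)\<bar> \<le> ln M"
proof (cases "x = 0")
  case False
  then show ?thesis
    using step_nonzero[OF False, of \<omega>] norm_step_le norm_step_ge by (intro abs_ln_diff_le) auto
qed (use M_ge_1 in simp)

lemma ln_opnorm_step: "\<bar>ln (opnorm (G \<omega> ** A)) - ln (opnorm A)\<bar> \<le> ln M"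
proof (cases "A = 0")
  case False
  have "opnorm (G \<omega> ** A) \<le> M * opnorm A"
    by (rule order_trans[OF opnorm_mult]) (intro mult_right_mono G_bound opnorm_nonneg)
  moreover have le: "opnorm A \<le> M * opnorm (G \<omega> ** A)"
    by (rule order_trans[OF opnorm_le_mult[OF G_det[of \<omega>]]]) (intro mult_right_mono G_bound opnorm_nonneg)
  moreover have "0 < opnorm A"
    using False opnorm_eq_0[of A] opnorm_nonneg[of A] by force
  moreover from this le have "0 < opnorm (G \<omega> ** A)"
    using opnorm_nonneg[of "G \<omega> ** A"] by (cases "opnorm (G \<omega> ** A) = 0") auto
  ultimately show ?thesis
    by (intro abs_ln_diff_le)
qed (use M_ge_1 in simp)

lemma vec_markov_chain: "markov_chain N (\<lambda>\<omega> x. G \<omega> *v x) (\<lambda>x. \<bar>ln (norm x)\<bar>) (ln M)"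
proof
  have "(\<lambda>p. G (fst p) *v snd p) \<in> N \<Otimes>\<^sub>M borel \<rightarrow>\<^sub>M borel"
    by (intro matrix_vector_measurable measurable_compose[OF measurable_fst G_measurable] measurable_snd)
  then show "(\<lambda>(\<omega>, x). G \<omega> *v x) \<in> N \<Otimes>\<^sub>M borel \<rightarrow>\<^sub>M borel"
    by (simp only: case_prod_unfold)
  show "\<bar>ln (norm (G \<omega> *v x))\<bar> \<le> \<bar>ln (norm x)\<bar> + ln M" for \<omega> x
    using ln_norm_step[of \<omega> x] by linarith
qed

lemma mat_markov_chain: "markov_chain N (\<lambda>\<omega> A. G \<omega> ** A) (\<lambda>A. \<bar>ln (opnorm A)\<bar>) (ln M)"
proof
  have "(\<lambda>p. G (fst p) ** (snd p :: real^2^2)) \<in> N \<Otimes>\<^sub>M borel \<rightarrow>\<^sub>M borel"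
    by (intro matrix_matrix_measurable measurable_compose[OF measurable_fst G_measurable] measurable_snd)
  then show "(\<lambda>(\<omega>, x :: real^2^2). G \<omega> ** x) \<in> N \<Otimes>\<^sub>M borel \<rightarrow>\<^sub>M borel"
    by (simp only: case_prod_unfold)
  show "\<bar>ln (opnorm (G \<omega> ** A))\<bar> \<le> \<bar>ln (opnorm A)\<bar> + ln M" for \<omega> A
    using ln_opnorm_step[of \<omega> A] by linarith
qed

sublocale vec: markov_chain N "\<lambda>\<omega> x. G \<omega> *v x" "\<lambda>x. \<bar>ln (norm x)\<bar>" "ln M"
  by (rule vec_markov_chain)

sublocale mat: markov_chain N "\<lambda>\<omega> A. G \<omega> ** A" "\<lambda>A. \<bar>ln (opnorm A)\<bar>" "ln M"
  by (rule mat_markov_chain)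

lemma admissible_ln_norm: "vec.admissible (\<lambda>x. ln (norm x))"
  by (rule vec.admissibleI) auto

lemma admissible_ln_opnorm: "mat.admissible (\<lambda>x. ln (opnorm x))"
  by (rule mat.admissibleI) auto

lemma admissible_exp_log: "vec.admissible (exp_log N G n)"
  unfolding exp_log_def using admissible_ln_norm by (rule vec.admissible_funpow)

lemma admissible_expansion: "vec.admissible (expansion N G n)"
proof -
  have "vec.admissible (\<lambda>x. exp_log N G n x - ln (norm x))"
    by (intro vec.admissible_diff admissible_exp_log admissible_ln_norm)
  then show ?thesis
    by (simp add: expansion_def[abs_def])
qed

lemma exp_log_step_le:
  assumes "\<And>\<omega> \<omega>'. exp_log N G n (G \<omega> *v x) - exp_log N G m (G \<omega> *v y) \<le> k"
  shows "exp_log N G (Suc n) x - exp_log N G (Suc m) y \<le> k"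
  unfolding exp_log_Suc using assms by (intro vec.trans_op_diff_le admissible_exp_log)

lemma exp_log_time_le: "\<bar>exp_log N G (n + k) x - exp_log N G n x\<bar> \<le> real k * ln M"
proof (induction k)
  case (Suc k)
  have "\<bar>exp_log N G (Suc m) x - exp_log N G m x\<bar> \<le> ln M" for m
  proof (induction m arbitrary: x)
    case 0
    have "exp_log N G (Suc 0) x - ln (norm x) \<le> ln M"
      using vec.trans_op_diff_le[OF admissible_ln_norm vec.admissible_const[of "ln (norm x)"], where x = x and y = x and k = "ln M"]
        ln_norm_step[of _ x] by (simp add: exp_log_def trans_op_def prob_space abs_le_iff)
    moreover have "ln (norm x) - exp_log N G (Suc 0) x \<le> ln M"
      using vec.trans_op_diff_le[OF vec.admissible_const[of "ln (norm x)"] admissible_ln_norm, where x = x and y = x and k = "ln M"]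
        ln_norm_step[of _ x] by (simp add: exp_log_def trans_op_def prob_space abs_le_iff)
    ultimately show ?case by simp
  next
    case (Suc m)
    have "exp_log N G (Suc (Suc m)) x - exp_log N G (Suc m) x \<le> ln M"
      by (rule exp_log_step_le) (use Suc.IH in \<open>simp add: abs_le_iff\<close>)
    moreover have "exp_log N G (Suc m) x - exp_log N G (Suc (Suc m)) x \<le> ln M"
      by (rule exp_log_step_le) (use Suc.IH in \<open>simp add: abs_le_iff\<close>)
    ultimately show ?case by simp
  qed
  from this[of "n + k"] Suc.IH show ?case
    by (simp add: algebra_simps)
qed simp

lemma abs_expansion_le: "\<bar>expansion N G n x\<bar> \<le> real n * ln M"
  using exp_log_time_le[of 0 n x] by (simp add: expansion_def)

text \<open>One step multiplies the relative distance of two vectors by at most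
  \<open>M\<^sup>2\<close>. The bound grows exponentially in \<open>n\<close> and is applied only to
  a fixed block length.\<close>

lemma exp_log_space_le:
  assumes "x \<noteq> 0" "y \<noteq> 0"
  shows "exp_log N G n x - exp_log N G n y \<le> M ^ (2 * n) * (norm (x - y) / norm y)"
  using assms
proof (induction n arbitrary: x y)
  case 0
  then show ?case using ln_norm_diff_le[of x y] by simp
next
  case (Suc n)
  have M0: "0 < M" using M_ge_1 by simp
  show ?case
  proof (rule exp_log_step_le)
    fix \<omega>
    have "norm (G \<omega> *v x - G \<omega> *v y) / norm (G \<omega> *v y) \<le> (M * norm (x - y)) / (norm y / M)"
    proof (rule frac_le)
      show "norm (G \<omega> *v x - G \<omega> *v y) \<le> M * norm (x - y)"
        using norm_step_le[of \<omega> "x - y"] by (simp add: matrix_vector_mult_diff_distrib)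
      show "norm y / M \<le> norm (G \<omega> *v y)"
        using norm_step_ge[of y \<omega>] M0 by (simp add: field_simps)
    qed (use Suc.prems M0 in auto)
    then have "M ^ (2 * n) * (norm (G \<omega> *v x - G \<omega> *v y) / norm (G \<omega> *v y))
        \<le> M ^ (2 * n) * ((M * norm (x - y)) / (norm y / M))"
      using M0 by (intro mult_left_mono) auto
    also have "\<dots> = M ^ (2 * Suc n) * (norm (x - y) / norm y)"
      by (simp add: power2_eq_square)
    finally show "exp_log N G n (G \<omega> *v x) - exp_log N G n (G \<omega> *v y)
        \<le> M ^ (2 * Suc n) * (norm (x - y) / norm y)"
      using Suc.IH[of "G \<omega> *v x" "G \<omega> *v y"] Suc.prems step_nonzero by fastforce
  qed
qed

lemma expansion_add:
  "expansion N G (n + m) x = (vec.P ^^ n) (expansion N G m) x + expansion N G n x"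
proof -
  have "(vec.P ^^ n) (exp_log N G m) x = (vec.P ^^ n) (\<lambda>x. 1 * expansion N G m x + 1 * ln (norm x) + 0) x"
    by (simp add: expansion_def)
  also have "\<dots> = 1 * (vec.P ^^ n) (expansion N G m) x + 1 * (vec.P ^^ n) (\<lambda>x. ln (norm x)) x + 0"
    by (rule vec.funpow_lincomb[OF admissible_expansion admissible_ln_norm])
  finally show ?thesis
    unfolding expansion_def exp_log_add by (simp add: exp_log_def)
qed

end

section \<open>Elementary inequalities and moments of the norm\<close>

lemma self_le_powr:
  fixes t \<theta> :: real
  assumes "0 \<le> t" "t \<le> 1" "0 < \<theta>" "\<theta> \<le> 1"
  shows "t \<le> t powr \<theta>"
  using powr_mono'[of \<theta> 1 t] assms by simp

text \<open>After division by \<open>a + b\<close> both terms lie in the unit interval, where taking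
  the \<theta>-th power increases them. Hence the \<theta>-th power of a distance still satisfies
  the triangle inequality.\<close>

lemma powr_add_le_real:
  fixes a b \<theta> :: real
  assumes "0 \<le> a" "0 \<le> b" "0 < \<theta>" "\<theta> \<le> 1"
  shows "(a + b) powr \<theta> \<le> a powr \<theta> + b powr \<theta>"
proof (cases "a + b = 0")
  case False
  then have pos: "0 < a + b" using assms by simp
  have "1 = a / (a + b) + b / (a + b)"
    using pos by (simp add: add_divide_distrib[symmetric])
  also have "\<dots> \<le> (a / (a + b)) powr \<theta> + (b / (a + b)) powr \<theta>"
    using pos assms by (intro add_mono self_le_powr) auto
  also have "\<dots> = (a powr \<theta> + b powr \<theta>) / (a + b) powr \<theta>"
    using pos assms by (simp add: powr_divide add_divide_distrib)
  finally show ?thesis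
    using pos by (simp add: field_simps)
qed (use assms in simp)

text \<open>For negative \<open>u = -t\<close>, the Taylor lower bound for \<open>exp t\<close> is
  inverted: its product with \<open>1 - t + t\<^sup>2\<close> is at least 1.\<close>

lemma exp_le_quadratic:
  fixes u :: real
  assumes "\<bar>u\<bar> \<le> 1"
  shows "exp u \<le> 1 + u + u\<^sup>2"
proof (cases "0 \<le> u")
  case True
  then show ?thesis using exp_bound assms by simp
next
  case False
  let ?t = "- u"
  have "1 + ?t + ?t\<^sup>2 / 2 \<le> exp ?t"
    using False exp_lower_Taylor_quadratic[of ?t] by simp
  moreover have "1 \<le> (1 - t + t\<^sup>2) * (1 + t + t\<^sup>2 / 2)" if "0 \<le> t" for t :: real
  proof -
    have "(1 - t + t\<^sup>2) * (1 + t + t\<^sup>2 / 2) = 1 + t\<^sup>2 / 2 + t ^ 3 / 2 + t ^ 4 / 2"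
      by (simp add: field_simps power2_eq_square power3_eq_cube power4_eq_xxxx)
    then show ?thesis using that by simp
  qed
  from this[of ?t] have "1 \<le> (1 - ?t + ?t\<^sup>2) * (1 + ?t + ?t\<^sup>2 / 2)"
    using False by linarith
  moreover have "0 \<le> 1 - ?t + ?t\<^sup>2"
    using assms by (simp add: abs_le_iff add_nonneg_nonneg)
  ultimately have "1 \<le> (1 - ?t + ?t\<^sup>2) * exp ?t"
    by (meson mult_left_mono order_trans)
  then show ?thesis
    by (simp add: exp_minus field_simps)
qed

text \<open>A two-sided Fekete argument. Additivity up to \<open>C\<close> makes
  \<open>a (k * n)\<close> differ from \<open>k * a n\<close> by at most \<open>k * C\<close>, so
  the averages form a Cauchy sequence; the error \<open>C\<close> in the conclusion is uniform in
  \<open>n\<close>.\<close>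

lemma almost_additive_limit:
  fixes a :: "nat \<Rightarrow> real"
  assumes "\<And>n m. \<bar>a (n + m) - a n - a m\<bar> \<le> C"
  shows "\<exists>L. \<forall>n. \<bar>a n - real n * L\<bar> \<le> C"
proof -
  have C: "0 \<le> C" using assms[of 0 0] by simp
  have mult: "\<bar>a (k * n) - real k * a n\<bar> \<le> real k * C" if "k \<ge> 1" for k n
    using that
  proof (induction k rule: nat_induct_at_least)
    case base
    then show ?case using C by simp
  next
    case (Suc k)
    then show ?case using assms[of n "k * n"] by (simp add: algebra_simps abs_le_iff)
  qed
  have mult': "\<bar>a (k * n) / real (k * n) - a n / real n\<bar> \<le> C / real n" if "k \<ge> 1" "n \<ge> 1" for k n
  proof -
    have "a (k * n) / real (k * n) - a n / real n = (a (k * n) - real k * a n) / real (k * n)"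
      using that by (simp add: field_simps)
    then have "\<bar>a (k * n) / real (k * n) - a n / real n\<bar> = \<bar>a (k * n) - real k * a n\<bar> / real (k * n)"
      by simp
    also have "\<dots> \<le> (real k * C) / real (k * n)"
      by (intro divide_right_mono mult that) simp
    also have "\<dots> = C / real n"
      using that by simp
    finally show ?thesis .
  qed
  \<comment> \<open>Both averages are compared with the one at time \<open>k * n\<close>.\<close>
  have close: "\<bar>a k / real k - a n / real n\<bar> \<le> C / real k + C / real n" if "k \<ge> 1" "n \<ge> 1" for k n
    using mult'[of k n] mult'[of n k] that by (simp add: mult.commute)
  have "Cauchy (\<lambda>n. a n / real n)"
  proof (rule metric_CauchyI)
    fix e :: real assume e: "e > 0"
    obtain K :: nat where "2 * C / e < real K"
      using reals_Archimedean2 by blast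
    moreover have "0 \<le> 2 * C / e"
      using C e by simp
    ultimately have K0: "2 * C / e < real K" "0 < real K"
      by linarith+
    then have K: "K \<ge> 1" "C / real K < e / 2"
      using e by (simp_all add: field_simps)
    have le: "C / real k < e / 2" if "k \<ge> K" for k
      using K C that by (intro le_less_trans[OF _ K(2)] divide_left_mono) auto
    show "\<exists>K. \<forall>m\<ge>K. \<forall>n\<ge>K. dist (a m / real m) (a n / real n) < e"
    proof (intro exI[of _ K] allI impI)
      fix m n assume "m \<ge> K" "n \<ge> K"
      then show "dist (a m / real m) (a n / real n) < e"
        using close[of m n] le[of m] le[of n] K(1) unfolding dist_real_def by linarith
    qed
  qed
  then obtain L where L: "(\<lambda>n. a n / real n) \<longlonglongrightarrow> L"
    using Cauchy_convergent_iff convergent_def by blast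
  have "\<bar>a n - real n * L\<bar> \<le> C" for n
  proof (cases "n = 0")
    case False
    have 1: "(\<lambda>k. C / real k + C / real n) \<longlonglongrightarrow> 0 + C / real n"
      by (intro tendsto_add lim_const_over_n tendsto_const)
    have 2: "(\<lambda>k. \<bar>a k / real k - a n / real n\<bar>) \<longlonglongrightarrow> \<bar>L - a n / real n\<bar>"
      by (intro tendsto_intros L)
    have "\<bar>L - a n / real n\<bar> \<le> 0 + C / real n"
      by (rule LIMSEQ_le[OF 2 1]) (use close False in \<open>auto intro!: exI[of _ 1]\<close>)
    then have "\<bar>L - a n / real n\<bar> * real n \<le> C"
      using False by (simp add: field_simps)
    also have "\<bar>L - a n / real n\<bar> * real n = \<bar>(L - a n / real n) * real n\<bar>"
      by (simp add: abs_mult)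
    also have "(L - a n / real n) * real n = real n * L - a n"
      using False by (simp add: algebra_simps)
    finally show ?thesis by (simp add: abs_minus_commute)
  qed (use assms[of 0 0] in simp)
  then show ?thesis by blast
qed

lemma (in sl2_walk) admissible_norm_powr: "vec.admissible (\<lambda>x. norm x powr \<tau>)"
proof (rule vec.admissibleI)
  fix r
  have "norm x powr \<tau> \<le> exp (\<bar>\<tau>\<bar> * r)" if "\<bar>ln (norm x)\<bar> \<le> r" for x :: "real^2"
  proof (cases "x = 0")
    case False
    have "\<tau> * ln (norm x) \<le> \<bar>\<tau>\<bar> * \<bar>ln (norm x)\<bar>"
      by (metis abs_ge_self abs_mult)
    also have "\<dots> \<le> \<bar>\<tau>\<bar> * r"
      using that by (intro mult_left_mono) auto
    finally show ?thesis
      using False by (simp add: powr_def)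
  qed simp
  then show "\<exists>B. \<forall>x::real^2. \<bar>ln (norm x)\<bar> \<le> r \<longrightarrow> \<bar>norm x powr \<tau>\<bar> \<le> B"
    by auto
qed measurable

text \<open>Write the power as an exponential of \<tau> times the increment of the log-norm and
  expand to second order: the linear term averages to the expansion, and the quadratic one is
  bounded since each step changes the log-norm by at most \<open>ln M\<close>.\<close>

lemma (in sl2_walk) funpow_norm_powr_le:
  assumes "x \<noteq> 0" "\<bar>\<tau>\<bar> * (real n * ln M) \<le> 1"
  shows "(vec.P ^^ n) (\<lambda>y. norm y powr \<tau>) x
    \<le> norm x powr \<tau> * (1 + \<tau> * expansion N G n x + (\<tau> * (real n * ln M))\<^sup>2)"
proof -
  let ?l = "ln (norm x)" and ?X = "norm x powr \<tau>" and ?q = "(\<tau> * (real n * ln M))\<^sup>2"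
  \<comment> \<open>With \<open>j\<close> of the \<open>n\<close> steps still to come, the log-norm
    has moved by at most \<open>(n - j) * ln M\<close>.\<close>
  define S where "S j = {y :: real^2. y \<noteq> 0 \<and> \<bar>ln (norm y) - ?l\<bar> \<le> (real n - real j) * ln M}" for j
  have "(vec.P ^^ n) (\<lambda>y. norm y powr \<tau>) x
      \<le> (vec.P ^^ n) (\<lambda>y. (?X * \<tau>) * ln (norm y) + ?X * (1 - \<tau> * ?l + ?q)) x"
  proof (rule vec.funpow_mono_on[where S = S])
    show "vec.admissible (\<lambda>y. norm y powr \<tau>)" by (rule admissible_norm_powr)
    show "vec.admissible (\<lambda>y. (?X * \<tau>) * ln (norm y) + ?X * (1 - \<tau> * ?l + ?q))"
      by (intro vec.admissible_add vec.admissible_cmult admissible_ln_norm vec.admissible_const)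
    show "x \<in> S n" using assms by (simp add: S_def)
    show "G \<omega> *v y \<in> S j" if "y \<in> S (Suc j)" for j y \<omega>
      using that ln_norm_step[of \<omega> y] step_nonzero[of y \<omega>] by (auto simp: S_def algebra_simps)
    fix y assume y: "y \<in> S 0"
    let ?t = "ln (norm y) - ?l"
    have t: "\<bar>?t\<bar> \<le> real n * ln M" using y by (simp add: S_def)
    have le: "\<bar>\<tau> * ?t\<bar> \<le> \<bar>\<tau>\<bar> * (real n * ln M)"
      unfolding abs_mult by (intro mult_left_mono t) simp
    have "norm y powr \<tau> = ?X * exp (\<tau> * ?t)"
      using y assms by (simp add: S_def powr_def exp_add[symmetric] algebra_simps)
    also have "\<dots> \<le> ?X * (1 + \<tau> * ?t + (\<tau> * ?t)\<^sup>2)"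
      using le assms by (intro mult_left_mono exp_le_quadratic) auto
    also have "\<dots> \<le> ?X * (1 + \<tau> * ?t + ?q)"
    proof -
      have "\<bar>\<tau> * ?t\<bar> \<le> \<bar>\<tau> * (real n * ln M)\<bar>"
        using le M_ge_1 by (simp add: abs_mult)
      then show ?thesis
        unfolding abs_le_square_iff by (intro mult_left_mono add_left_mono) auto
    qed
    finally show "norm y powr \<tau> \<le> (?X * \<tau>) * ln (norm y) + ?X * (1 - \<tau> * ?l + ?q)"
      by (simp add: algebra_simps)
  qed
  also have "\<dots> = (?X * \<tau>) * exp_log N G n x + ?X * (1 - \<tau> * ?l + ?q)"
    unfolding exp_log_def by (rule vec.funpow_affine[OF admissible_ln_norm])
  finally show ?thesis
    by (simp add: expansion_def algebra_simps)
qed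

section \<open>Pairs of vectors and contraction of angles\<close>

definition pair_map :: "('w \<Rightarrow> real^2^2) \<Rightarrow> ('w \<Rightarrow> real^2^2) \<Rightarrow> 'w \<Rightarrow> (real^2) \<times> (real^2) \<Rightarrow> (real^2) \<times> (real^2)" where
  "pair_map G H \<omega> p = (G \<omega> *v fst p, H \<omega> *v snd p)"

lemma pair_map_Pair [simp]: "pair_map G H \<omega> (x, y) = (G \<omega> *v x, H \<omega> *v y)"
  by (simp add: pair_map_def)

definition angle_cost :: "real \<Rightarrow> (real^2) \<times> (real^2) \<Rightarrow> real" where
  "angle_cost \<theta> p = sin_dist (fst p) (snd p) powr \<theta>"

lemma angle_cost_nonneg: "0 \<le> angle_cost \<theta> p"
  by (simp add: angle_cost_def)

lemma angle_cost_le_1: "0 \<le> \<theta> \<Longrightarrow> angle_cost \<theta> p \<le> 1"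
  using sin_dist_nonneg sin_dist_le_1 by (simp add: angle_cost_def powr_le1)

lemma angle_cost_triangle:
  assumes "y \<noteq> 0" "0 < \<theta>" "\<theta> \<le> 1"
  shows "angle_cost \<theta> (x, z) \<le> angle_cost \<theta> (x, y) + angle_cost \<theta> (y, z)"
proof -
  have "angle_cost \<theta> (x, z) \<le> (sin_dist x y + sin_dist y z) powr \<theta>"
    unfolding angle_cost_def fst_conv snd_conv
    using assms by (intro powr_mono2 sin_dist_triangle sin_dist_nonneg) auto
  also have "\<dots> \<le> angle_cost \<theta> (x, y) + angle_cost \<theta> (y, z)"
    unfolding angle_cost_def fst_conv snd_conv
    by (intro powr_add_le_real sin_dist_nonneg assms)
  finally show ?thesis .
qed

text \<open>Both walks read the same letter, so \<open>N\<close> carries a coupling of the law of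
  \<open>G\<close> with the law of \<open>H\<close>.\<close>

locale sl2_pair = G: sl2_walk N G M + H: sl2_walk N H M
  for N :: "'w measure" and G H :: "'w \<Rightarrow> real^2^2" and M :: real
begin

lemma pair_markov_chain:
  "markov_chain N (pair_map G H) (\<lambda>p. \<bar>ln (norm (fst p))\<bar> + \<bar>ln (norm (snd p))\<bar>) (2 * ln M)"
proof
  have m: "fst \<in> (borel :: ((real^2) \<times> (real^2)) measure) \<rightarrow>\<^sub>M borel" "snd \<in> (borel :: ((real^2) \<times> (real^2)) measure) \<rightarrow>\<^sub>M borel"
    by (auto intro!: borel_measurable_continuous_onI continuous_intros)
  have "(\<lambda>q. (G (fst q) *v fst (snd q), H (fst q) *v snd (snd q))) \<in> N \<Otimes>\<^sub>M borel \<rightarrow>\<^sub>M borel \<Otimes>\<^sub>M borel"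
    by (intro measurable_Pair matrix_vector_measurable
        measurable_compose[OF measurable_fst G.G_measurable] measurable_compose[OF measurable_fst H.G_measurable]
        measurable_compose[OF measurable_snd m(1)] measurable_compose[OF measurable_snd m(2)])
  then show "(\<lambda>(\<omega>, p). pair_map G H \<omega> p) \<in> N \<Otimes>\<^sub>M borel \<rightarrow>\<^sub>M borel"
    by (simp only: pair_map_def case_prod_unfold borel_prod)
  show "\<bar>ln (norm (fst (pair_map G H \<omega> p)))\<bar> + \<bar>ln (norm (snd (pair_map G H \<omega> p)))\<bar>
      \<le> \<bar>ln (norm (fst p))\<bar> + \<bar>ln (norm (snd p))\<bar> + 2 * ln M" for \<omega> p
    using G.ln_norm_step[of \<omega> "fst p"] H.ln_norm_step[of \<omega> "snd p"] by (simp add: pair_map_def)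
qed

sublocale pair: markov_chain N "pair_map G H" "\<lambda>p. \<bar>ln (norm (fst p))\<bar> + \<bar>ln (norm (snd p))\<bar>" "2 * ln M"
  by (rule pair_markov_chain)

lemma admissible_fst:
  assumes "G.vec.admissible f"
  shows "pair.admissible (\<lambda>p. f (fst p))"
proof (rule pair.admissibleI)
  have "fst \<in> (borel :: ((real^2) \<times> (real^2)) measure) \<rightarrow>\<^sub>M borel"
    by (auto intro!: borel_measurable_continuous_onI continuous_intros)
  then show "(\<lambda>p. f (fst p)) \<in> borel_measurable (borel :: ((real^2) \<times> (real^2)) measure)"
    using G.vec.admissible_measurable[OF assms] by (rule measurable_compose)
  fix r
  obtain B where "\<forall>x. \<bar>ln (norm x)\<bar> \<le> r \<longrightarrow> \<bar>f x\<bar> \<le> B"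
    using G.vec.admissible_bound[OF assms] by blast
  then show "\<exists>B. \<forall>p. \<bar>ln (norm (fst p))\<bar> + \<bar>ln (norm (snd p))\<bar> \<le> r \<longrightarrow> \<bar>f (fst p)\<bar> \<le> B"
    by (intro exI[of _ B]) auto
qed

lemma admissible_snd:
  assumes "H.vec.admissible f"
  shows "pair.admissible (\<lambda>p. f (snd p))"
proof (rule pair.admissibleI)
  have "snd \<in> (borel :: ((real^2) \<times> (real^2)) measure) \<rightarrow>\<^sub>M borel"
    by (auto intro!: borel_measurable_continuous_onI continuous_intros)
  then show "(\<lambda>p. f (snd p)) \<in> borel_measurable (borel :: ((real^2) \<times> (real^2)) measure)"
    using H.vec.admissible_measurable[OF assms] by (rule measurable_compose)
  fix r
  obtain B where "\<forall>x. \<bar>ln (norm x)\<bar> \<le> r \<longrightarrow> \<bar>f x\<bar> \<le> B"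
    using H.vec.admissible_bound[OF assms] by blast
  then show "\<exists>B. \<forall>p. \<bar>ln (norm (fst p))\<bar> + \<bar>ln (norm (snd p))\<bar> \<le> r \<longrightarrow> \<bar>f (snd p)\<bar> \<le> B"
    by (intro exI[of _ B]) auto
qed

lemma admissible_angle_cost: "0 \<le> \<theta> \<Longrightarrow> pair.admissible (angle_cost \<theta>)"
proof (rule pair.admissibleI)
  have [measurable]: "fst \<in> (borel :: ((real^2) \<times> (real^2)) measure) \<rightarrow>\<^sub>M borel" "snd \<in> (borel :: ((real^2) \<times> (real^2)) measure) \<rightarrow>\<^sub>M borel"
    by (auto intro!: borel_measurable_continuous_onI continuous_intros)
  have [measurable]: "(\<lambda>p. sin_dist (fst p) (snd p)) \<in> borel_measurable borel"
    by (intro sin_dist_measurable) auto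
  show "angle_cost \<theta> \<in> borel_measurable borel"
    unfolding angle_cost_def[abs_def] by measurable
  show "\<exists>B. \<forall>p. \<bar>ln (norm (fst p))\<bar> + \<bar>ln (norm (snd p))\<bar> \<le> r \<longrightarrow> \<bar>angle_cost \<theta> p\<bar> \<le> B" if "0 \<le> \<theta>" for r
    using angle_cost_le_1[OF that] angle_cost_nonneg by (intro exI[of _ 1]) simp
qed

lemma funpow_angle_cost_le_1: "0 \<le> \<theta> \<Longrightarrow> (pair.P ^^ n) (angle_cost \<theta>) p \<le> 1"
  using pair.funpow_mono_inv[OF admissible_angle_cost pair.admissible_const[of 1], of \<theta> UNIV p n] angle_cost_le_1
  by (simp add: pair.funpow_const)

end

context sl2_walk
begin

lemma sl2_pair_self: "sl2_pair N G G M"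
  by unfold_locales

abbreviation "sync \<equiv> trans_op N (pair_map G G)"

lemma sin_dist_step:
  assumes "x \<noteq> 0" "y \<noteq> 0"
  shows "sin_dist (G \<omega> *v x) (G \<omega> *v y) \<le> M\<^sup>2 * sin_dist x y"
proof -
  have M: "0 < M" using M_ge_1 by simp
  have "\<bar>wedge x y\<bar> / (norm (G \<omega> *v x) * norm (G \<omega> *v y)) \<le> \<bar>wedge x y\<bar> / ((norm x / M) * (norm y / M))"
    using norm_step_ge[of x \<omega>] norm_step_ge[of y \<omega>] M assms
    by (intro divide_left_mono mult_mono) (auto simp: field_simps step_nonzero)
  then show ?thesis
    using M by (simp add: sin_dist_def wedge_matrix G_det power2_eq_square ac_simps)
qed

lemma angle_cost_step:
  assumes "x \<noteq> 0" "y \<noteq> 0" "0 \<le> \<theta>" "\<theta> \<le> 1"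
  shows "angle_cost \<theta> (G \<omega> *v x, G \<omega> *v y) \<le> M\<^sup>2 * angle_cost \<theta> (x, y)"
proof -
  have "angle_cost \<theta> (G \<omega> *v x, G \<omega> *v y) \<le> (M\<^sup>2 * sin_dist x y) powr \<theta>"
    unfolding angle_cost_def fst_conv snd_conv
    using assms by (intro powr_mono2 sin_dist_step sin_dist_nonneg) auto
  also have "\<dots> = (M\<^sup>2) powr \<theta> * angle_cost \<theta> (x, y)"
    using sin_dist_nonneg[of x y] by (simp add: angle_cost_def powr_mult)
  also have "\<dots> \<le> (M\<^sup>2) powr 1 * angle_cost \<theta> (x, y)"
    using assms M_ge_1 by (intro mult_right_mono powr_mono angle_cost_nonneg) auto
  finally show ?thesis using M_ge_1 by simp
qed

lemma sync_le:
  assumes "x \<noteq> 0" "y \<noteq> 0" "0 \<le> \<theta>" "\<theta> \<le> 1"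
  shows "(sync ^^ n) (angle_cost \<theta>) (x, y) \<le> M ^ (2 * n) * angle_cost \<theta> (x, y)"
  using assms(1,2)
proof (induction n arbitrary: x y)
  case (Suc n)
  interpret GG: sl2_pair N G G M by (rule sl2_pair_self)
  have step: "(sync ^^ n) (angle_cost \<theta>) (pair_map G G \<omega> (x, y)) \<le> M ^ (2 * Suc n) * angle_cost \<theta> (x, y)" for \<omega>
  proof -
    have "(sync ^^ n) (angle_cost \<theta>) (pair_map G G \<omega> (x, y))
        \<le> M ^ (2 * n) * angle_cost \<theta> (G \<omega> *v x, G \<omega> *v y)"
      unfolding pair_map_Pair using Suc.prems by (intro Suc.IH step_nonzero)
    also have "\<dots> \<le> M ^ (2 * n) * (M\<^sup>2 * angle_cost \<theta> (x, y))"
      using Suc.prems assms M_ge_1 by (intro mult_left_mono angle_cost_step) auto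
    finally show ?thesis by (simp add: power_add power2_eq_square algebra_simps)
  qed
  have "(sync ^^ Suc n) (angle_cost \<theta>) (x, y) = sync ((sync ^^ n) (angle_cost \<theta>)) (x, y)"
    by simp
  also have "\<dots> \<le> sync (\<lambda>_. M ^ (2 * Suc n) * angle_cost \<theta> (x, y)) (x, y)"
    by (rule GG.pair.trans_op_mono)
      (intro GG.pair.admissible_funpow GG.admissible_angle_cost assms GG.pair.admissible_const step)+
  also have "\<dots> = M ^ (2 * Suc n) * angle_cost \<theta> (x, y)"
    by (simp add: trans_op_def prob_space)
  finally show ?case .
qed simp

text \<open>All three vectors are moved by the same matrices, so the triangle inequality for the
  cost holds along every path and is then integrated.\<close>

lemma sync_triangle:
  assumes "y \<noteq> 0" "0 < \<theta>" "\<theta> \<le> 1"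
  shows "(sync ^^ n) (angle_cost \<theta>) (x, z)
    \<le> (sync ^^ n) (angle_cost \<theta>) (x, y) + (sync ^^ n) (angle_cost \<theta>) (y, z)"
  using assms(1)
proof (induction n arbitrary: x y z)
  case 0
  then show ?case using angle_cost_triangle[OF _ assms(2,3)] by simp
next
  case (Suc n)
  interpret GG: sl2_pair N G G M by (rule sl2_pair_self)
  let ?F = "(sync ^^ n) (angle_cost \<theta>)"
  have adm: "GG.pair.admissible ?F"
    using assms by (intro GG.pair.admissible_funpow GG.admissible_angle_cost) simp
  note int = GG.pair.integrable_step[OF adm]
  have "(\<integral>\<omega>. ?F (pair_map G G \<omega> (x, z)) \<partial>N)
      \<le> (\<integral>\<omega>. ?F (pair_map G G \<omega> (x, y)) + ?F (pair_map G G \<omega> (y, z)) \<partial>N)"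
    using Suc.IH[OF step_nonzero[OF Suc.prems]]
    by (intro integral_mono Bochner_Integration.integrable_add int) simp
  also have "\<dots> = (\<integral>\<omega>. ?F (pair_map G G \<omega> (x, y)) \<partial>N) + (\<integral>\<omega>. ?F (pair_map G G \<omega> (y, z)) \<partial>N)"
    by (intro Bochner_Integration.integral_add int)
  finally show ?case by (simp only: funpow_trans_op_Suc)
qed

text \<open>The area spanned by the pair is conserved, so the cost after \<open>n\<close> steps is a
  constant times the product of the \<theta>-th inverse powers of two norms. The weighted inequality
  between arithmetic and geometric mean separates the two factors, leaving moments of order
  -2\<theta> of single vectors, to which the hypothesis applies.\<close>

lemma sync_contraction:
  assumes "0 < \<theta>" and "x \<noteq> 0" "y \<noteq> 0"
    and \<kappa>: "\<And>x. x \<noteq> 0 \<Longrightarrow> (vec.P ^^ n) (\<lambda>y. norm y powr (- (2 * \<theta>))) x \<le> \<kappa> * norm x powr (- (2 * \<theta>))"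
  shows "(sync ^^ n) (angle_cost \<theta>) (x, y) \<le> \<kappa> * angle_cost \<theta> (x, y)"
proof -
  interpret GG: sl2_pair N G G M by (rule sl2_pair_self)
  let ?f = "\<lambda>y :: real^2. norm y powr (- (2 * \<theta>))"
  define W where "W = \<bar>wedge x y\<bar> powr \<theta>"
  \<comment> \<open>The weight for which the two summands are equal at the starting pair, so that
    separating the factors loses nothing there.\<close>
  define \<alpha> where "\<alpha> = norm x powr \<theta> / norm y powr \<theta>"
  have \<alpha>: "0 < \<alpha>" using assms by (simp add: \<alpha>_def)
  have W: "0 \<le> W" by (simp add: W_def)
  \<comment> \<open>An invariant set on which the area is frozen.\<close>
  define S where "S = {p :: (real^2) \<times> (real^2). fst p \<noteq> 0 \<and> snd p \<noteq> 0 \<and> \<bar>wedge (fst p) (snd p)\<bar> = \<bar>wedge x y\<bar>}"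
  have adm1: "GG.pair.admissible (\<lambda>p. ?f (fst p))"
    by (rule GG.admissible_fst[OF admissible_norm_powr])
  have adm2: "GG.pair.admissible (\<lambda>p. ?f (snd p))"
    by (rule GG.admissible_snd[OF admissible_norm_powr])
  have cost: "angle_cost \<theta> p = W * (norm (fst p) powr (- \<theta>) * norm (snd p) powr (- \<theta>))" if "p \<in> S" for p
    using that by (simp add: S_def angle_cost_def sin_dist_def W_def powr_divide powr_mult powr_minus_divide)
  have "(sync ^^ n) (angle_cost \<theta>) (x, y)
      \<le> (sync ^^ n) (\<lambda>p. (W * \<alpha> / 2) * ?f (fst p) + (W / \<alpha> / 2) * ?f (snd p) + 0) (x, y)"
  proof (rule GG.pair.funpow_mono_inv[where S = S])
    show "GG.pair.admissible (angle_cost \<theta>)" using assms by (intro GG.admissible_angle_cost) simp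
    show "GG.pair.admissible (\<lambda>p. (W * \<alpha> / 2) * ?f (fst p) + (W / \<alpha> / 2) * ?f (snd p) + 0)"
      by (intro GG.pair.admissible_add GG.pair.admissible_cmult GG.pair.admissible_const adm1 adm2)
    show "pair_map G G \<omega> p \<in> S" if "p \<in> S" for p \<omega>
      using that by (simp add: S_def pair_map_def wedge_matrix G_det step_nonzero)
    show "(x, y) \<in> S" using assms by (simp add: S_def)
    fix p assume p: "p \<in> S"
    let ?a = "norm (fst p) powr (- \<theta>)" and ?b = "norm (snd p) powr (- \<theta>)"
    have "0 \<le> (\<alpha> * ?a - ?b)\<^sup>2" by simp
    then have "2 * \<alpha> * (?a * ?b) \<le> \<alpha>\<^sup>2 * ?a\<^sup>2 + ?b\<^sup>2"
      by (simp add: power2_diff power_mult_distrib algebra_simps)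
    then have "?a * ?b \<le> \<alpha> / 2 * ?a\<^sup>2 + ?b\<^sup>2 / \<alpha> / 2"
      using \<alpha> by (simp add: field_simps power2_eq_square)
    then have "W * (?a * ?b) \<le> W * (\<alpha> / 2 * ?a\<^sup>2 + ?b\<^sup>2 / \<alpha> / 2)"
      by (intro mult_left_mono W)
    moreover have "?a\<^sup>2 = ?f (fst p)" "?b\<^sup>2 = ?f (snd p)"
      by (simp_all add: power2_eq_square powr_add[symmetric])
    ultimately show "angle_cost \<theta> p \<le> (W * \<alpha> / 2) * ?f (fst p) + (W / \<alpha> / 2) * ?f (snd p) + 0"
      unfolding cost[OF p] by (simp add: algebra_simps)
  qed
  also have "\<dots> = (W * \<alpha> / 2) * (sync ^^ n) (\<lambda>p. ?f (fst p)) (x, y)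
      + (W / \<alpha> / 2) * (sync ^^ n) (\<lambda>p. ?f (snd p)) (x, y) + 0"
    by (rule GG.pair.funpow_lincomb[OF adm1 adm2])
  also have "(sync ^^ n) (\<lambda>p. ?f (fst p)) (x, y) = (vec.P ^^ n) ?f x"
    by (subst trans_op_semiconj[where T' = "\<lambda>\<omega> x. G \<omega> *v x"]) (simp_all add: pair_map_def)
  also have "(sync ^^ n) (\<lambda>p. ?f (snd p)) (x, y) = (vec.P ^^ n) ?f y"
    by (subst trans_op_semiconj[where T' = "\<lambda>\<omega> x. G \<omega> *v x"]) (simp_all add: pair_map_def)
  also have "(W * \<alpha> / 2) * (vec.P ^^ n) ?f x + (W / \<alpha> / 2) * (vec.P ^^ n) ?f y + 0
      \<le> (W * \<alpha> / 2) * (\<kappa> * ?f x) + (W / \<alpha> / 2) * (\<kappa> * ?f y) + 0"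
    using W \<alpha> assms(2,3) by (intro add_mono mult_left_mono \<kappa>) auto
  also have "\<dots> = \<kappa> * angle_cost \<theta> (x, y)"
  proof -
    have f: "?f z = norm z powr (- \<theta>) * norm z powr (- \<theta>)" for z
      by (simp add: powr_add[symmetric])
    have "\<alpha> * ?f x = norm x powr (- \<theta>) * norm y powr (- \<theta>)" "?f y / \<alpha> = norm x powr (- \<theta>) * norm y powr (- \<theta>)"
      using assms unfolding f by (simp_all add: \<alpha>_def powr_minus field_simps)
    moreover have "(W * \<alpha> / 2) * (\<kappa> * ?f x) + (W / \<alpha> / 2) * (\<kappa> * ?f y) + 0
        = (W * \<kappa> / 2) * (\<alpha> * ?f x) + (W * \<kappa> / 2) * (?f y / \<alpha>)"
      by (simp add: ac_simps)
    ultimately have "(W * \<alpha> / 2) * (\<kappa> * ?f x) + (W / \<alpha> / 2) * (\<kappa> * ?f y) + 0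
      = \<kappa> * (W * (norm x powr (- \<theta>) * norm y powr (- \<theta>)))"
      by (simp add: algebra_simps)
    then show ?thesis
      using cost[of "(x, y)"] assms by (simp add: S_def)
  qed
  finally show ?thesis .
qed

end

lemma powr_le_one_add:
  fixes t \<theta> :: real
  assumes "0 \<le> t" "0 < \<theta>" "\<theta> \<le> 1"
  shows "t powr \<theta> \<le> 1 + t"
proof (cases "t \<le> 1")
  case True
  then show ?thesis using assms powr_le1[of \<theta> t] by simp
next
  case False
  then show ?thesis using assms powr_mono[of \<theta> 1 t] by simp
qed

section \<open>Comparison of two walks through a coupling\<close>

lemma (in sl2_walk) expansion_Suc:
  "expansion N G (Suc n) x = (\<integral>\<omega>. ln (norm (G \<omega> *v x)) - ln (norm x) + expansion N G n (G \<omega> *v x) \<partial>N)"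
  using vec.integrable_step[OF admissible_exp_log, of n x]
  by (simp add: expansion_def exp_log_Suc trans_op_def prob_space)

text \<open>\<open>w\<close> is a positive upper bound for the transport cost, not the cost itself:
  \<open>cost_powr\<close> divides by \<open>w\<close>, and the coupling of a walk with itself has
  cost 0.\<close>

locale sl2_coupling = sl2_pair N G H M
  for N :: "'w measure" and G H :: "'w \<Rightarrow> real^2^2" and M :: real +
  fixes w :: real
  assumes w_pos: "0 < w"
    and cost_le: "(\<integral>\<omega>. opnorm (G \<omega> - H \<omega>) \<partial>N) \<le> w"
begin

lemma opnorm_diff_bound: "opnorm (G \<omega> - H \<omega>) \<le> 2 * M"
  using opnorm_add[of "G \<omega>" "- H \<omega>"] opnorm_minus[of "0" "H \<omega>"] G.G_bound[of \<omega>] H.G_bound[of \<omega>]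
  by simp

lemma opnorm_diff_measurable: "(\<lambda>\<omega>. opnorm (G \<omega> - H \<omega>)) \<in> borel_measurable N"
  using G.G_measurable H.G_measurable by measurable

lemma integrable_cost: "integrable N (\<lambda>\<omega>. opnorm (G \<omega> - H \<omega>))"
  using opnorm_diff_bound opnorm_nonneg
  by (intro G.integrable_const_bound[where B = "2 * M"] opnorm_diff_measurable) simp

text \<open>The first letters are exchanged at the price given by \<open>exp_log_space_le\<close>;
  afterwards both walks continue from the common vector \<open>H \<omega> *v x\<close>, where the
  induction hypothesis applies. At fixed \<open>n\<close> this makes the lower bound for the
  expansion stable under perturbations of the law.\<close>

lemma exp_log_coupling_le:
  assumes "x \<noteq> 0"
  shows "exp_log N G n x - exp_log N H n x \<le> real n * M ^ (2 * n) * w"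
  using assms
proof (induction n arbitrary: x)
  case (Suc n)
  have M: "1 \<le> M" by (rule G.M_ge_1)
  let ?K = "M ^ Suc (2 * n)"
  have step: "exp_log N G n (G \<omega> *v x) - exp_log N H n (H \<omega> *v x)
      \<le> ?K * opnorm (G \<omega> - H \<omega>) + real n * M ^ (2 * n) * w" for \<omega>
  proof -
    have "norm (G \<omega> *v x - H \<omega> *v x) / norm (H \<omega> *v x) \<le> M * opnorm (G \<omega> - H \<omega>)"
      by (rule norm_diff_quotient_le[OF H.G_det H.G_bound Suc.prems])
    then have "M ^ (2 * n) * (norm (G \<omega> *v x - H \<omega> *v x) / norm (H \<omega> *v x)) \<le> M ^ (2 * n) * (M * opnorm (G \<omega> - H \<omega>))"
      using M by (intro mult_left_mono) auto
    moreover have "exp_log N G n (G \<omega> *v x) - exp_log N G n (H \<omega> *v x)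
        \<le> M ^ (2 * n) * (norm (G \<omega> *v x - H \<omega> *v x) / norm (H \<omega> *v x))"
      by (intro G.exp_log_space_le G.step_nonzero H.step_nonzero Suc.prems)
    moreover have "exp_log N G n (H \<omega> *v x) - exp_log N H n (H \<omega> *v x) \<le> real n * M ^ (2 * n) * w"
      by (intro Suc.IH H.step_nonzero Suc.prems)
    ultimately show ?thesis by (simp add: ac_simps)
  qed
  note intG = G.vec.integrable_step[OF G.admissible_exp_log, of n x]
  note intH = H.vec.integrable_step[OF H.admissible_exp_log, of n x]
  have "exp_log N G (Suc n) x - exp_log N H (Suc n) x
      = (\<integral>\<omega>. exp_log N G n (G \<omega> *v x) - exp_log N H n (H \<omega> *v x) \<partial>N)"
    unfolding exp_log_Suc trans_op_def using intG intH by simp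
  also have "\<dots> \<le> (\<integral>\<omega>. ?K * opnorm (G \<omega> - H \<omega>) + real n * M ^ (2 * n) * w \<partial>N)"
    using integrable_cost by (intro integral_mono step Bochner_Integration.integrable_diff intG intH) auto
  also have "\<dots> = ?K * (\<integral>\<omega>. opnorm (G \<omega> - H \<omega>) \<partial>N) + real n * M ^ (2 * n) * w"
    using integrable_cost by (simp add: G.prob_space)
  also have "\<dots> \<le> M ^ (2 * Suc n) * w + real n * M ^ (2 * Suc n) * w"
    using M w_pos cost_le
    by (intro add_mono mult_mono mult_left_mono mult_right_mono power_increasing
        integral_nonneg_AE) (auto simp: opnorm_nonneg)
  also have "\<dots> = real (Suc n) * M ^ (2 * Suc n) * w"
    by (simp add: algebra_simps)
  finally show ?case .
qed simp

text \<open>A replacement for Jensen's inequality: measured in units of \<open>w\<close> the cost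
  has mean at most 1, and \<open>t powr \<theta> \<le> 1 + t\<close> gives the factor 2.\<close>

lemma cost_powr:
  assumes "0 < \<theta>" "\<theta> \<le> 1"
  shows "integrable N (\<lambda>\<omega>. opnorm (G \<omega> - H \<omega>) powr \<theta>)"
    and "(\<integral>\<omega>. opnorm (G \<omega> - H \<omega>) powr \<theta> \<partial>N) \<le> 2 * w powr \<theta>"
proof -
  have le: "opnorm (G \<omega> - H \<omega>) powr \<theta> \<le> w powr \<theta> * (1 + opnorm (G \<omega> - H \<omega>) / w)" for \<omega>
  proof -
    let ?u = "opnorm (G \<omega> - H \<omega>) / w"
    have u: "0 \<le> ?u" using w_pos opnorm_nonneg by simp
    from u have "?u powr \<theta> \<le> 1 + ?u"
      by (rule powr_le_one_add[OF _ assms])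
    then have "w powr \<theta> * ?u powr \<theta> \<le> w powr \<theta> * (1 + ?u)"
      by (intro mult_left_mono) auto
    then show ?thesis
      using w_pos opnorm_nonneg by (simp add: powr_divide)
  qed
  show int: "integrable N (\<lambda>\<omega>. opnorm (G \<omega> - H \<omega>) powr \<theta>)"
  proof (rule G.integrable_const_bound)
    show "(\<lambda>\<omega>. opnorm (G \<omega> - H \<omega>) powr \<theta>) \<in> borel_measurable N"
      using opnorm_diff_measurable by measurable
    show "AE \<omega> in N. norm (opnorm (G \<omega> - H \<omega>) powr \<theta>) \<le> (2 * M) powr \<theta>"
      using opnorm_diff_bound opnorm_nonneg assms by (intro AE_I2) (simp add: powr_mono2)
  qed
  have "(\<integral>\<omega>. opnorm (G \<omega> - H \<omega>) powr \<theta> \<partial>N) \<le> (\<integral>\<omega>. w powr \<theta> * (1 + opnorm (G \<omega> - H \<omega>) / w) \<partial>N)"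
    using integrable_cost by (intro integral_mono int le) auto
  also have "\<dots> = w powr \<theta> * (1 + (\<integral>\<omega>. opnorm (G \<omega> - H \<omega>) \<partial>N) / w)"
    using integrable_cost by (simp add: G.prob_space)
  also have "\<dots> \<le> w powr \<theta> * (1 + 1)"
    using cost_le w_pos by (intro mult_left_mono add_left_mono) auto
  finally show "(\<integral>\<omega>. opnorm (G \<omega> - H \<omega>) powr \<theta> \<partial>N) \<le> 2 * w powr \<theta>" by simp
qed

lemma angle_cost_coupling:
  assumes "x \<noteq> 0" "0 < \<theta>" "\<theta> \<le> 1"
  shows "angle_cost \<theta> (G \<omega> *v x, H \<omega> *v x) \<le> M * opnorm (G \<omega> - H \<omega>) powr \<theta>"
proof -
  have M: "1 \<le> M" by (rule G.M_ge_1)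
  have "sin_dist (G \<omega> *v x) (H \<omega> *v x) \<le> norm (G \<omega> *v x - H \<omega> *v x) / norm (G \<omega> *v x)"
    by (rule sin_dist_le_norm) (rule G.step_nonzero[OF assms(1)])
  also have "\<dots> \<le> M * opnorm (G \<omega> - H \<omega>)"
    using norm_diff_quotient_le[OF G.G_det G.G_bound assms(1), of "H \<omega>" \<omega>] opnorm_minus[of "G \<omega>" "H \<omega>"]
    by (simp add: norm_minus_commute)
  finally have "angle_cost \<theta> (G \<omega> *v x, H \<omega> *v x) \<le> (M * opnorm (G \<omega> - H \<omega>)) powr \<theta>"
    unfolding angle_cost_def fst_conv snd_conv using assms by (intro powr_mono2 sin_dist_nonneg) auto
  also have "\<dots> = M powr \<theta> * opnorm (G \<omega> - H \<omega>) powr \<theta>"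
    using M opnorm_nonneg by (simp add: powr_mult)
  also have "\<dots> \<le> M powr 1 * opnorm (G \<omega> - H \<omega>) powr \<theta>"
    using M assms by (intro mult_right_mono powr_mono) auto
  finally show ?thesis using M by simp
qed

text \<open>In the second walk the matrices \<open>H\<close> are exchanged for \<open>G\<close> one
  letter at a time. The triangle inequality through \<open>G \<omega> *v y\<close> isolates the
  error of a letter, which later steps amplify by at most \<open>M ^ (2 * n)\<close>.\<close>

lemma funpow_angle_cost_le_sync:
  assumes "x \<noteq> 0" "y \<noteq> 0" "0 < \<theta>" "\<theta> \<le> 1"
  shows "(pair.P ^^ n) (angle_cost \<theta>) (x, y)
    \<le> (G.sync ^^ n) (angle_cost \<theta>) (x, y) + 2 * real n * M ^ (2 * n) * w powr \<theta>"
  using assms(1,2)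
proof (induction n arbitrary: x y)
  case (Suc n)
  interpret GG: sl2_pair N G G M by (rule G.sl2_pair_self)
  have M: "1 \<le> M" by (rule G.M_ge_1)
  let ?Q = "(pair.P ^^ n) (angle_cost \<theta>)" and ?R = "(G.sync ^^ n) (angle_cost \<theta>)"
  let ?K = "M ^ Suc (2 * n)" and ?k = "2 * real n * M ^ (2 * n) * w powr \<theta>"
  let ?u = "\<lambda>\<omega>. opnorm (G \<omega> - H \<omega>) powr \<theta>"
  have step: "?Q (pair_map G H \<omega> (x, y)) \<le> ?R (pair_map G G \<omega> (x, y)) + ?K * ?u \<omega> + ?k" for \<omega>
  proof -
    have "?Q (pair_map G H \<omega> (x, y)) \<le> ?R (G \<omega> *v x, H \<omega> *v y) + ?k"
      unfolding pair_map_Pair by (intro Suc.IH G.step_nonzero H.step_nonzero Suc.prems)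
    moreover have "?R (G \<omega> *v x, H \<omega> *v y) \<le> ?R (G \<omega> *v x, G \<omega> *v y) + ?R (G \<omega> *v y, H \<omega> *v y)"
      using assms by (intro G.sync_triangle G.step_nonzero Suc.prems) auto
    moreover have "?R (G \<omega> *v y, H \<omega> *v y) \<le> M ^ (2 * n) * angle_cost \<theta> (G \<omega> *v y, H \<omega> *v y)"
      using assms by (intro G.sync_le G.step_nonzero H.step_nonzero Suc.prems) auto
    moreover have "M ^ (2 * n) * angle_cost \<theta> (G \<omega> *v y, H \<omega> *v y) \<le> M ^ (2 * n) * (M * ?u \<omega>)"
      using assms M by (intro mult_left_mono angle_cost_coupling Suc.prems) auto
    ultimately show ?thesis by (simp add: algebra_simps)
  qed
  have admQ: "pair.admissible ?Q" and admR: "GG.pair.admissible ?R"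
    using assms by (auto intro!: pair.admissible_funpow GG.pair.admissible_funpow admissible_angle_cost GG.admissible_angle_cost)
  note int = pair.integrable_step[OF admQ, of "(x, y)"] GG.pair.integrable_step[OF admR, of "(x, y)"] cost_powr(1)[OF assms(3,4)]
  have "(pair.P ^^ Suc n) (angle_cost \<theta>) (x, y) = (\<integral>\<omega>. ?Q (pair_map G H \<omega> (x, y)) \<partial>N)"
    by (rule funpow_trans_op_Suc)
  also have "\<dots> \<le> (\<integral>\<omega>. ?R (pair_map G G \<omega> (x, y)) + ?K * ?u \<omega> + ?k \<partial>N)"
    by (intro integral_mono step Bochner_Integration.integrable_add integrable_mult_right int) simp
  also have "\<dots> = (\<integral>\<omega>. ?R (pair_map G G \<omega> (x, y)) \<partial>N) + ?K * (\<integral>\<omega>. ?u \<omega> \<partial>N) + ?k"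
    using int(2,3) by (simp add: G.prob_space)
  also have "(\<integral>\<omega>. ?R (pair_map G G \<omega> (x, y)) \<partial>N) = (G.sync ^^ Suc n) (angle_cost \<theta>) (x, y)"
    by (rule funpow_trans_op_Suc[symmetric])
  also have "(G.sync ^^ Suc n) (angle_cost \<theta>) (x, y) + ?K * (\<integral>\<omega>. ?u \<omega> \<partial>N) + ?k
      \<le> (G.sync ^^ Suc n) (angle_cost \<theta>) (x, y) + M ^ (2 * Suc n) * (2 * w powr \<theta>)
        + 2 * real n * M ^ (2 * Suc n) * w powr \<theta>"
    using M cost_powr(2)[OF assms(3,4)]
    by (intro add_mono order_refl mult_mono mult_left_mono mult_right_mono power_increasing
        integral_nonneg_AE) auto
  also have "\<dots> = (G.sync ^^ Suc n) (angle_cost \<theta>) (x, y) + 2 * real (Suc n) * M ^ (2 * Suc n) * w powr \<theta>"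
    by (simp add: algebra_simps)
  finally show ?case .
qed simp

lemma log_step_coupling:
  assumes "x \<noteq> 0" "y \<noteq> 0" "0 < \<theta>" "\<theta> \<le> 1"
  shows "\<bar>(ln (norm (G \<omega> *v x)) - ln (norm x)) - (ln (norm (H \<omega> *v y)) - ln (norm y))\<bar>
    \<le> M * (2 * M + 1) * opnorm (G \<omega> - H \<omega>) powr \<theta> + 2 * M\<^sup>2 * angle_cost \<theta> (x, y)"
proof -
  have M: "1 \<le> M" by (rule G.M_ge_1)
  let ?u = "opnorm (G \<omega> - H \<omega>)"
  have 1: "\<bar>ln (norm (G \<omega> *v x)) - ln (norm (H \<omega> *v x))\<bar> \<le> M * ?u"
  proof -
    show ?thesis
      using ln_norm_diff_le[of "G \<omega> *v x" "H \<omega> *v x"] ln_norm_diff_le[of "H \<omega> *v x" "G \<omega> *v x"]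
        norm_diff_quotient_le[OF H.G_det H.G_bound assms(1), of "G \<omega>" \<omega>]
        norm_diff_quotient_le[OF G.G_det G.G_bound assms(1), of "H \<omega>" \<omega>] G.step_nonzero[OF assms(1)] H.step_nonzero[OF assms(1)]
        opnorm_minus[of "G \<omega>" "H \<omega>"]
      by (fastforce simp: abs_le_iff)
  qed
  have 2: "M * ?u \<le> M * ((2 * M + 1) * ?u powr \<theta>)"
  proof -
    \<comment> \<open>The divisor exceeds both 1 and the bound \<open>2 * M\<close> for the cost: so
      \<open>?v\<close> lies in the unit interval, where it is below its \<theta>-th power, and it
      does not exceed the cost.\<close>
    let ?v = "?u / (2 * M + 1)"
    have v: "0 \<le> ?v" "?v \<le> 1"
      using opnorm_diff_bound[of \<omega>] opnorm_nonneg[of "G \<omega> - H \<omega>"] M by (auto simp: field_simps)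
    have "?v \<le> ?v powr \<theta>"
      using v assms by (intro self_le_powr)
    also have "\<dots> \<le> ?u powr \<theta>"
      using v M assms opnorm_nonneg[of "G \<omega> - H \<omega>"] by (intro powr_mono2) (auto simp: field_simps)
    finally show ?thesis
      using M by (intro mult_left_mono) (auto simp: field_simps)
  qed
  have 3: "\<bar>(ln (norm (H \<omega> *v x)) - ln (norm x)) - (ln (norm (H \<omega> *v y)) - ln (norm y))\<bar> \<le> 2 * M\<^sup>2 * angle_cost \<theta> (x, y)"
  proof -
    have "\<bar>(ln (norm (H \<omega> *v x)) - ln (norm x)) - (ln (norm (H \<omega> *v y)) - ln (norm y))\<bar> \<le> 2 * (opnorm (H \<omega>))\<^sup>2 * sin_dist x y"
      using log_expansion_diff[OF H.G_det assms(1,2), of \<omega>] log_expansion_diff[OF H.G_det assms(2,1), of \<omega>]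
        sin_dist_commute[of x y] by (simp add: abs_le_iff)
    also have "\<dots> \<le> 2 * M\<^sup>2 * angle_cost \<theta> (x, y)"
    proof (intro mult_mono power_mono H.G_bound opnorm_nonneg)
      show "sin_dist x y \<le> angle_cost \<theta> (x, y)"
        unfolding angle_cost_def fst_conv snd_conv
        by (intro self_le_powr sin_dist_nonneg sin_dist_le_1 assms)
    qed (use sin_dist_nonneg in auto)
    finally show ?thesis .
  qed
  have "M * ((2 * M + 1) * ?u powr \<theta>) = M * (2 * M + 1) * ?u powr \<theta>"
    by simp
  then show ?thesis using 1 2 3 by linarith
qed

text \<open>The cost \<open>m\<close> steps later is at most \<kappa> times the present cost plus an
  error of order \<open>w powr \<theta>\<close>. Summing this over time and moving the contracted
  sum to the left leaves the first \<open>m\<close> terms, each at most 1, and \<open>n\<close>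
  times the error.\<close>

lemma sum_angle_cost_le:
  assumes "x \<noteq> 0" "y \<noteq> 0" "0 < \<theta>" "\<theta> \<le> 1"
    and \<kappa>: "\<And>x. x \<noteq> 0 \<Longrightarrow> (G.vec.P ^^ m) (\<lambda>y. norm y powr (- (2 * \<theta>))) x \<le> \<kappa> * norm x powr (- (2 * \<theta>))"
  shows "(1 - \<kappa>) * (\<Sum>k<n. (pair.P ^^ k) (angle_cost \<theta>) (x, y))
    \<le> real m + real n * (2 * real m * M ^ (2 * m) * w powr \<theta>)"
proof -
  let ?s = "\<lambda>k. (pair.P ^^ k) (angle_cost \<theta>) (x, y)" and ?c = "2 * real m * M ^ (2 * m) * w powr \<theta>"
  have adm: "pair.admissible (angle_cost \<theta>)"
    using assms by (intro admissible_angle_cost) simp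
  have step: "?s (k + m) \<le> \<kappa> * ?s k + ?c" for k
  proof -
    have "(pair.P ^^ k) ((pair.P ^^ m) (angle_cost \<theta>)) (x, y) \<le> (pair.P ^^ k) (\<lambda>p. \<kappa> * angle_cost \<theta> p + ?c) (x, y)"
    proof (rule pair.funpow_mono_inv[where S = "{p. fst p \<noteq> 0 \<and> snd p \<noteq> 0}"])
      show "pair.admissible ((pair.P ^^ m) (angle_cost \<theta>))"
        by (intro pair.admissible_funpow adm)
      show "pair.admissible (\<lambda>p. \<kappa> * angle_cost \<theta> p + ?c)"
        by (intro pair.admissible_add pair.admissible_cmult pair.admissible_const adm)
      show "(pair.P ^^ m) (angle_cost \<theta>) p \<le> \<kappa> * angle_cost \<theta> p + ?c" if "p \<in> {p. fst p \<noteq> 0 \<and> snd p \<noteq> 0}" for p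
        using that funpow_angle_cost_le_sync[OF _ _ assms(3,4), of "fst p" "snd p" m]
          G.sync_contraction[OF assms(3) _ _ \<kappa>, of "fst p" "snd p"]
        by simp
    qed (use assms in \<open>auto simp: pair_map_def G.step_nonzero H.step_nonzero\<close>)
    also have "\<dots> = \<kappa> * ?s k + ?c"
      by (rule pair.funpow_affine[OF adm])
    finally show ?thesis by (simp add: funpow_add)
  qed
  have nonneg: "0 \<le> ?s k" for k
    using pair.funpow_mono_inv[OF pair.admissible_const[of 0] adm, of UNIV "(x, y)" k]
    by (simp add: pair.funpow_const angle_cost_nonneg)
  \<comment> \<open>Prolonging the sum by \<open>m\<close> nonnegative terms makes it the initial
    \<open>m\<close> terms plus the shifted sum.\<close>
  have "(\<Sum>k<n. ?s k) \<le> (\<Sum>k<m + n. ?s k)"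
    by (intro sum_mono2 nonneg) auto
  also have "\<dots> = (\<Sum>k<m. ?s k) + (\<Sum>k<n. ?s (k + m))"
    by (induction n) (simp_all add: add.commute)
  also have "\<dots> \<le> (\<Sum>k<m. 1) + (\<Sum>k<n. \<kappa> * ?s k + ?c)"
    using assms by (intro add_mono sum_mono step funpow_angle_cost_le_1) auto
  also have "\<dots> = real m + \<kappa> * (\<Sum>k<n. ?s k) + real n * ?c"
    by (simp add: sum.distrib sum_distrib_left)
  finally show ?thesis by (simp add: algebra_simps)
qed

text \<open>The expansion is a sum of averaged logarithmic increments, and
  \<open>log_step_coupling\<close> bounds the difference of the increments at time \<open>k\<close>
  by the cost of the letter and the angle cost at that time.\<close>

lemma expansion_coupling_sum:
  assumes "x \<noteq> 0" "y \<noteq> 0" "0 < \<theta>" "\<theta> \<le> 1"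
  shows "\<bar>expansion N G n x - expansion N H n y\<bar>
    \<le> real n * (2 * M * (2 * M + 1) * w powr \<theta>) + 2 * M\<^sup>2 * (\<Sum>k<n. (pair.P ^^ k) (angle_cost \<theta>) (x, y))"
  using assms(1,2)
proof (induction n arbitrary: x y)
  case (Suc n)
  let ?A = "\<lambda>k. (pair.P ^^ k) (angle_cost \<theta>)" and ?c = "2 * M * (2 * M + 1) * w powr \<theta>"
  let ?u = "\<lambda>\<omega>. opnorm (G \<omega> - H \<omega>) powr \<theta>"
  let ?g = "\<lambda>\<omega>. ln (norm (G \<omega> *v x)) - ln (norm x) + expansion N G n (G \<omega> *v x)"
  let ?h = "\<lambda>\<omega>. ln (norm (H \<omega> *v y)) - ln (norm y) + expansion N H n (H \<omega> *v y)"
  let ?B = "\<lambda>\<omega>. M * (2 * M + 1) * ?u \<omega> + 2 * M\<^sup>2 * angle_cost \<theta> (x, y)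
    + (real n * ?c + 2 * M\<^sup>2 * (\<Sum>k<n. ?A k (pair_map G H \<omega> (x, y))))"
  have M: "1 \<le> M" by (rule G.M_ge_1)
  have adm: "pair.admissible (angle_cost \<theta>)"
    using assms by (intro admissible_angle_cost) simp
  have int: "integrable N ?g" "integrable N ?h" "\<And>k. integrable N (\<lambda>\<omega>. ?A k (pair_map G H \<omega> (x, y)))"
    using G.vec.integrable_step[OF G.admissible_ln_norm, of x] H.vec.integrable_step[OF H.admissible_ln_norm, of y]
      G.vec.integrable_step[OF G.admissible_expansion, of n x] H.vec.integrable_step[OF H.admissible_expansion, of n y]
      pair.integrable_step[OF pair.admissible_funpow[OF adm]]
    by auto
  \<comment> \<open>This fact and the next one do the arithmetic in abstract variables, so that the
    integrands below stay folded.\<close>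
  have expand: "(\<integral>\<omega>. a * u \<omega> + b + (c + d * v \<omega>) \<partial>N) = a * (\<integral>\<omega>. u \<omega> \<partial>N) + b + (c + d * (\<integral>\<omega>. v \<omega> \<partial>N))"
    if "integrable N u" "integrable N v" for a b c d :: real and u v
    using that by (simp add: G.prob_space)
  have combine: "\<bar>D\<bar> \<le> sc + d * S"
    if "\<bar>I\<bar> \<le> B" "D = I" "B = U + A + (nc + d * V')" "V' = V" "U \<le> c" "d * S = A + d * V" "sc = c + nc"
    for D I B U A V V' S c d nc sc :: real
    using that by simp
  have integrable_B: "integrable N ?B"
    by (intro Bochner_Integration.integrable_add integrable_mult_right Bochner_Integration.integrable_sum
        int cost_powr(1) assms) simp_all
  have "\<bar>\<integral>\<omega>. ?g \<omega> - ?h \<omega> \<partial>N\<bar> \<le> (\<integral>\<omega>. ?B \<omega> \<partial>N)"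
  proof (rule order_trans[OF integral_abs_bound integral_mono])
    fix \<omega>
    have "\<bar>?g \<omega> - ?h \<omega>\<bar> \<le> \<bar>(ln (norm (G \<omega> *v x)) - ln (norm x)) - (ln (norm (H \<omega> *v y)) - ln (norm y))\<bar>
        + \<bar>expansion N G n (G \<omega> *v x) - expansion N H n (H \<omega> *v y)\<bar>"
      by linarith
    also have "\<dots> \<le> ?B \<omega>"
      unfolding pair_map_Pair
      using Suc.prems assms by (intro add_mono log_step_coupling Suc.IH G.step_nonzero H.step_nonzero)
    finally show "\<bar>?g \<omega> - ?h \<omega>\<bar> \<le> ?B \<omega>" .
  qed (intro integrable_abs integrable_B Bochner_Integration.integrable_diff int)+
  moreover have "expansion N G (Suc n) x - expansion N H (Suc n) y = (\<integral>\<omega>. ?g \<omega> - ?h \<omega> \<partial>N)"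
    unfolding G.expansion_Suc H.expansion_Suc by (rule Bochner_Integration.integral_diff[OF int(1,2), symmetric])
  moreover have "(\<integral>\<omega>. ?B \<omega> \<partial>N) = M * (2 * M + 1) * (\<integral>\<omega>. ?u \<omega> \<partial>N) + 2 * M\<^sup>2 * angle_cost \<theta> (x, y)
      + (real n * ?c + 2 * M\<^sup>2 * (\<integral>\<omega>. (\<Sum>k<n. ?A k (pair_map G H \<omega> (x, y))) \<partial>N))"
    by (rule expand[OF cost_powr(1)[OF assms(3,4)] Bochner_Integration.integrable_sum[OF int(3)]])
  moreover have "(\<integral>\<omega>. (\<Sum>k<n. ?A k (pair_map G H \<omega> (x, y))) \<partial>N) = (\<Sum>k<n. ?A (Suc k) (x, y))"
    unfolding funpow_trans_op_Suc by (rule Bochner_Integration.integral_sum[OF int(3)])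
  moreover have "M * (2 * M + 1) * (\<integral>\<omega>. ?u \<omega> \<partial>N) \<le> ?c"
    using mult_left_mono[OF cost_powr(2)[OF assms(3,4)], of "M * (2 * M + 1)"] M by simp
  moreover have "2 * M\<^sup>2 * (\<Sum>k<Suc n. ?A k (x, y)) = 2 * M\<^sup>2 * angle_cost \<theta> (x, y) + 2 * M\<^sup>2 * (\<Sum>k<n. ?A (Suc k) (x, y))"
    unfolding sum.lessThan_Suc_shift by (simp only: distrib_left funpow_0)
  moreover have "real (Suc n) * ?c = ?c + real n * ?c"
    by (simp only: of_nat_Suc distrib_right mult_1_left)
  ultimately show ?case by (rule combine)
qed simp

end

text \<open>The first summand pays for the mismatch of the letters, the second for the accumulated
  angle cost; the denominator stems from the contraction factor. The law enters only through
  \<open>M\<close>, \<kappa> and \<open>m\<close>.\<close>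

definition coupling_const :: "real \<Rightarrow> real \<Rightarrow> nat \<Rightarrow> real" where
  "coupling_const M \<kappa> m = 2 * M * (2 * M + 1) + 2 * M\<^sup>2 * ((real m + 2 * real m * M ^ (2 * m)) / (1 - \<kappa>))"

lemma (in sl2_coupling) expansion_coupling:
  assumes "x \<noteq> 0" "y \<noteq> 0" "0 < \<theta>" "\<theta> \<le> 1" "\<kappa> < 1"
    and \<kappa>: "\<And>x. x \<noteq> 0 \<Longrightarrow> (G.vec.P ^^ m) (\<lambda>y. norm y powr (- (2 * \<theta>))) x \<le> \<kappa> * norm x powr (- (2 * \<theta>))"
  shows "\<bar>expansion N G n x - expansion N H n y\<bar> \<le> coupling_const M \<kappa> m * (1 + real n * w powr \<theta>)"
proof -
  let ?S = "\<Sum>k<n. (pair.P ^^ k) (angle_cost \<theta>) (x, y)" and ?t = "real n * w powr \<theta>"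
  let ?a = "real m" and ?b = "2 * real m * M ^ (2 * m)" and ?d = "2 * M * (2 * M + 1)"
  have M: "1 \<le> M" by (rule G.M_ge_1)
  have t: "0 \<le> ?t" by simp
  have "(1 - \<kappa>) * ?S \<le> ?a + ?b * ?t"
    using sum_angle_cost_le[OF assms(1-4) \<kappa>, of n] by (simp add: ac_simps)
  also have "\<dots> \<le> (?a + ?b) * (1 + ?t)"
    using M t by (simp add: algebra_simps)
  finally have "?S \<le> (?a + ?b) / (1 - \<kappa>) * (1 + ?t)"
    using assms(5) by (simp add: pos_le_divide_eq mult.commute)
  then have "2 * M\<^sup>2 * ?S \<le> 2 * M\<^sup>2 * ((?a + ?b) / (1 - \<kappa>) * (1 + ?t))"
    by (intro mult_left_mono) auto
  moreover have "real n * (?d * w powr \<theta>) \<le> ?d * (1 + ?t)"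
    using M by (simp add: distrib_left ac_simps)
  ultimately have "\<bar>expansion N G n x - expansion N H n y\<bar> \<le> ?d * (1 + ?t) + 2 * M\<^sup>2 * ((?a + ?b) / (1 - \<kappa>) * (1 + ?t))"
    using expansion_coupling_sum[OF assms(1-4), of n] by linarith
  also have "\<dots> = coupling_const M \<kappa> m * (1 + ?t)"
    unfolding coupling_const_def by (simp only: distrib_right mult.assoc)
  finally show ?thesis .
qed

section \<open>Almost additivity of the expansion of a single walk\<close>

context sl2_walk
begin

lemma coupling_const_nonneg:
  assumes "\<kappa> < 1"
  shows "0 \<le> coupling_const M \<kappa> m"
  using assms M_ge_1 unfolding coupling_const_def by (intro add_nonneg_nonneg mult_nonneg_nonneg divide_nonneg_nonneg) auto

text \<open>The walk is coupled with itself and started in two directions: the letters agree, and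
  only the summable initial discrepancy of the angles remains.\<close>

lemma expansion_almost_constant:
  assumes "x \<noteq> 0" "y \<noteq> 0" "0 < \<theta>" "\<theta> \<le> 1" "\<kappa> < 1"
    and \<kappa>: "\<And>x. x \<noteq> 0 \<Longrightarrow> (vec.P ^^ m) (\<lambda>y. norm y powr (- (2 * \<theta>))) x \<le> \<kappa> * norm x powr (- (2 * \<theta>))"
  shows "\<bar>expansion N G n x - expansion N G n y\<bar> \<le> 2 * coupling_const M \<kappa> m"
proof -
  \<comment> \<open>The actual cost is 0, but a positive bound is required; this one makes
    \<open>n * w powr \<theta>\<close> at most 1.\<close>
  define w where "w = (1 / (real n + 1)) powr (1 / \<theta>)"
  interpret GG: sl2_pair N G G M by (rule sl2_pair_self)
  interpret C: sl2_coupling N G G M w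
    by unfold_locales (auto simp: w_def opnorm_def onorm_zero)
  have "w powr \<theta> = 1 / (real n + 1)"
    using assms by (simp add: w_def powr_powr)
  then have "real n * w powr \<theta> \<le> 1" by simp
  then have "coupling_const M \<kappa> m * (1 + real n * w powr \<theta>) \<le> coupling_const M \<kappa> m * 2"
    by (intro mult_left_mono coupling_const_nonneg assms) simp
  then show ?thesis
    using C.expansion_coupling[OF assms, of n] by simp
qed

text \<open>Since the expansion hardly depends on the direction, the position reached after
  \<open>k\<close> steps is irrelevant up to a constant in \<open>expansion_add\<close>. So the
  expansion at one vector is almost additive in time; another vector costs a further twice the
  constant.\<close>

lemma expansion_limit:
  assumes "0 < \<theta>" "\<theta> \<le> 1" "\<kappa> < 1"
    and \<kappa>: "\<And>x. x \<noteq> 0 \<Longrightarrow> (vec.P ^^ m) (\<lambda>y. norm y powr (- (2 * \<theta>))) x \<le> \<kappa> * norm x powr (- (2 * \<theta>))"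
  shows "\<exists>L. \<forall>n x. x \<noteq> 0 \<longrightarrow> \<bar>expansion N G n x - real n * L\<bar> \<le> 4 * coupling_const M \<kappa> m"
proof -
  let ?C = "2 * coupling_const M \<kappa> m"
  let ?e = "axis 1 1 :: real^2"
  have e: "?e \<noteq> 0" by (simp add: axis_eq_0_iff)
  note const = expansion_almost_constant[OF _ _ assms]
  have "\<bar>expansion N G (k + n) ?e - expansion N G k ?e - expansion N G n ?e\<bar> \<le> ?C" for k n
  proof -
    let ?E = "expansion N G n"
    have "(vec.P ^^ k) ?E ?e \<le> (vec.P ^^ k) (\<lambda>_. ?E ?e + ?C) ?e"
      using e const[of _ ?e n]
      by (intro vec.funpow_mono_inv[where S = "{x. x \<noteq> 0}"] admissible_expansion vec.admissible_const)
        (auto simp: step_nonzero abs_le_iff algebra_simps)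
    moreover have "(vec.P ^^ k) (\<lambda>_. ?E ?e - ?C) ?e \<le> (vec.P ^^ k) ?E ?e"
      using e const[of _ ?e n]
      by (intro vec.funpow_mono_inv[where S = "{x. x \<noteq> 0}"] admissible_expansion vec.admissible_const)
        (auto simp: step_nonzero abs_le_iff algebra_simps)
    ultimately show ?thesis
      unfolding expansion_add vec.funpow_const by linarith
  qed
  then obtain L where L: "\<bar>expansion N G n ?e - real n * L\<bar> \<le> ?C" for n
    using almost_additive_limit[of "\<lambda>n. expansion N G n ?e" ?C] by blast
  have "\<bar>expansion N G n x - real n * L\<bar> \<le> 4 * coupling_const M \<kappa> m" if "x \<noteq> 0" for n x
    using L[of n] const[OF that e, of n] by linarith
  then show ?thesis by blast
qed

end

text \<open>Small enough for the quadratic error in \<open>exp u \<le> 1 + u + u\<^sup>2\<close> to be dominated by the linear term.\<close>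

definition small_exponent :: "real \<Rightarrow> nat \<Rightarrow> real \<Rightarrow> real" where
  "small_exponent M n c = min 1 (min (1 / (2 * (real n * ln M + 1))) (c / (4 * ((real n * ln M)\<^sup>2 + 1))))"

lemma small_exponent:
  fixes M c :: real and n :: nat
  assumes "1 \<le> M" "0 < c"
  defines "\<theta> \<equiv> small_exponent M n c" and "T \<equiv> real n * ln M"
  shows "0 < \<theta>" "\<theta> \<le> 1" "2 * \<theta> * T \<le> 1" "4 * \<theta> * T\<^sup>2 \<le> c"
proof -
  have T: "0 \<le> T" using assms by simp
  have T2: "0 < T\<^sup>2 + 1" by (simp add: add_nonneg_pos)
  have \<theta>: "\<theta> = min 1 (min (1 / (2 * (T + 1))) (c / (4 * (T\<^sup>2 + 1))))"
    by (simp add: \<theta>_def T_def small_exponent_def)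
  show pos: "0 < \<theta>" unfolding \<theta> using T T2 assms(2) by simp
  show "\<theta> \<le> 1" by (simp add: \<theta>)
  have "2 * \<theta> * T \<le> 2 * \<theta> * (T + 1)" using pos by simp
  also have "\<dots> \<le> 2 * (1 / (2 * (T + 1))) * (T + 1)"
    using T by (intro mult_right_mono mult_left_mono) (auto simp: \<theta>)
  also have "\<dots> = 1" using T by simp
  finally show "2 * \<theta> * T \<le> 1" .
  have "4 * \<theta> * T\<^sup>2 \<le> 4 * \<theta> * (T\<^sup>2 + 1)" using pos by simp
  also have "\<dots> \<le> 4 * (c / (4 * (T\<^sup>2 + 1))) * (T\<^sup>2 + 1)"
    using T2 by (intro mult_right_mono mult_left_mono) (auto simp: \<theta>)
  also have "\<dots> = c" using T2 by (simp add: divide_simps)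
  finally show "4 * \<theta> * T\<^sup>2 \<le> c" .
qed

section \<open>Almost sure growth of the random products\<close>

context sl2_walk
begin

abbreviation "vorbit \<equiv> orbit (\<lambda>\<omega> x. G \<omega> *v x)"

lemma vorbit_nonzero: "x \<noteq> 0 \<Longrightarrow> vorbit w n x \<noteq> 0"
  by (induction n) (auto simp: step_nonzero)

lemma vorbit_eq_cocycle: "vorbit w n x = cocycle (\<lambda>i. G (w i)) n *v x"
  by (induction n) (simp_all add: matrix_vector_mul_assoc)

lemma moment_step:
  assumes "\<And>x. x \<noteq> 0 \<Longrightarrow> (vec.P ^^ m) (\<lambda>y. norm y powr \<tau>) x \<le> b * norm x powr \<tau>" and "x \<noteq> 0"
  shows "(vec.P ^^ (n + m)) (\<lambda>y. norm y powr \<tau>) x \<le> b * (vec.P ^^ n) (\<lambda>y. norm y powr \<tau>) x"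
proof -
  let ?f = "\<lambda>y :: real^2. norm y powr \<tau>"
  have "(vec.P ^^ n) ((vec.P ^^ m) ?f) x \<le> (vec.P ^^ n) (\<lambda>y. b * ?f y + 0) x"
    using assms
    by (intro vec.funpow_mono_inv[where S = "{x. x \<noteq> 0}"] vec.admissible_funpow vec.admissible_add
        vec.admissible_cmult vec.admissible_const admissible_norm_powr)
      (auto simp: step_nonzero)
  also have "\<dots> = b * (vec.P ^^ n) ?f x + 0"
    by (rule vec.funpow_affine[OF admissible_norm_powr])
  finally show ?thesis by (simp add: funpow_add)
qed

lemma moment_crude:
  assumes "x \<noteq> 0"
  shows "(vec.P ^^ n) (\<lambda>y. norm y powr \<tau>) x \<le> exp (\<bar>\<tau>\<bar> * real n * ln M) * norm x powr \<tau>"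
  using assms
proof (induction n arbitrary: x)
  case (Suc n)
  have one: "(vec.P ^^ 1) (\<lambda>y. norm y powr \<tau>) y \<le> exp (\<bar>\<tau>\<bar> * ln M) * norm y powr \<tau>" if "y \<noteq> 0" for y
  proof -
    have "norm (G \<omega> *v y) powr \<tau> \<le> exp (\<bar>\<tau>\<bar> * ln M) * norm y powr \<tau>" for \<omega>
    proof -
      have "\<tau> * (ln (norm (G \<omega> *v y)) - ln (norm y)) \<le> \<bar>\<tau>\<bar> * \<bar>ln (norm (G \<omega> *v y)) - ln (norm y)\<bar>"
        by (metis abs_ge_self abs_mult)
      also have "\<dots> \<le> \<bar>\<tau>\<bar> * ln M"
        by (intro mult_left_mono ln_norm_step) simp
      finally have "\<tau> * ln (norm (G \<omega> *v y)) \<le> \<bar>\<tau>\<bar> * ln M + \<tau> * ln (norm y)"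
        by (simp add: algebra_simps)
      then show ?thesis
        using that step_nonzero[OF that, of \<omega>] by (simp add: powr_def exp_add[symmetric])
    qed
    then have "vec.P (\<lambda>y. norm y powr \<tau>) y \<le> vec.P (\<lambda>_. exp (\<bar>\<tau>\<bar> * ln M) * norm y powr \<tau>) y"
      by (intro vec.trans_op_mono admissible_norm_powr vec.admissible_const)
    then show ?thesis by (simp add: trans_op_def prob_space)
  qed
  have "(vec.P ^^ (n + 1)) (\<lambda>y. norm y powr \<tau>) x \<le> exp (\<bar>\<tau>\<bar> * ln M) * (vec.P ^^ n) (\<lambda>y. norm y powr \<tau>) x"
    by (rule moment_step[OF one Suc.prems])
  also have "\<dots> \<le> exp (\<bar>\<tau>\<bar> * ln M) * (exp (\<bar>\<tau>\<bar> * real n * ln M) * norm x powr \<tau>)"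
    by (intro mult_left_mono Suc.IH Suc.prems) simp
  also have "\<dots> = exp (\<bar>\<tau>\<bar> * real (Suc n) * ln M) * norm x powr \<tau>"
    by (simp add: exp_add[symmetric] algebra_simps)
  finally show ?case by simp
qed simp

text \<open>The sign \<sigma> treats upper and lower deviations together. One long block multiplies
  the moment by at most \<open>exp (t * m * (\<sigma> * L + \<epsilon>))\<close>, half of the
  \<epsilon> absorbing the error \<open>C\<close> and half the quadratic term; blocks are then
  concatenated.\<close>

lemma moment_growth:
  assumes lim: "\<And>n x. x \<noteq> 0 \<Longrightarrow> \<bar>expansion N G n x - real n * L\<bar> \<le> C"
    and "0 < \<epsilon>" "\<bar>\<sigma>\<bar> = 1"
  shows "\<exists>t>0. \<exists>K. \<forall>n x. x \<noteq> 0 \<longrightarrow>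
    (vec.P ^^ n) (\<lambda>y. norm y powr (\<sigma> * t)) x \<le> K * exp (t * real n * (\<sigma> * L + \<epsilon>)) * norm x powr (\<sigma> * t)"
proof -
  have C: "0 \<le> C" using lim[of "axis 1 1" 0] by (simp add: axis_eq_0_iff)
  \<comment> \<open>The block is so long that the error \<open>C\<close> is at most
    \<open>\<epsilon> * m / 2\<close>.\<close>
  obtain m0 :: nat where "2 * C / \<epsilon> < real m0"
    using reals_Archimedean2 by blast
  moreover have "0 \<le> 2 * C / \<epsilon>" using C assms by simp
  ultimately have "0 < real m0" "2 * C / \<epsilon> < real m0" by linarith+
  then obtain m :: nat where m: "1 \<le> m" "C \<le> \<epsilon> * real m / 2"
    using assms by (intro that[of m0]) (auto simp: field_simps)
  define T where "T = real m * ln M"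
  have T: "0 \<le> T" using M_ge_1 by (simp add: T_def)
  \<comment> \<open>The third argument is chosen such that the quadratic bound reads
    \<open>t * T\<^sup>2 \<le> \<epsilon> * m / 2\<close>.\<close>
  define t where "t = small_exponent M m (2 * \<epsilon> * real m)"
  have "0 < 2 * \<epsilon> * real m" using m assms(2) by simp
  note e = small_exponent[OF M_ge_1 this, of m, folded t_def T_def]
  moreover have "0 \<le> t * T" using e(1) T by simp
  ultimately have t: "0 < t" "t * T \<le> 1" "t * T\<^sup>2 \<le> \<epsilon> * real m / 2"
    unfolding mult.assoc by linarith+
  let ?\<tau> = "\<sigma> * t"
  let ?P = "\<lambda>n. (vec.P ^^ n) (\<lambda>y. norm y powr ?\<tau>)"
  have abs\<tau>: "\<bar>?\<tau>\<bar> = t" using t assms by (simp add: abs_mult)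
  define b where "b = exp (t * real m * (\<sigma> * L + \<epsilon>))"
  have block: "?P m x \<le> b * norm x powr ?\<tau>" if "x \<noteq> 0" for x
  proof -
    have "?P m x \<le> norm x powr ?\<tau> * (1 + ?\<tau> * expansion N G m x + (?\<tau> * T)\<^sup>2)"
      unfolding T_def by (rule funpow_norm_powr_le[OF that]) (use t abs\<tau> in \<open>simp add: T_def\<close>)
    also have "\<dots> \<le> norm x powr ?\<tau> * exp (?\<tau> * expansion N G m x + (?\<tau> * T)\<^sup>2)"
      using exp_ge_add_one_self[of "?\<tau> * expansion N G m x + (?\<tau> * T)\<^sup>2"]
      by (intro mult_left_mono) (simp_all only: add.assoc powr_ge_zero)
    also have "\<dots> \<le> norm x powr ?\<tau> * b"
      unfolding b_def
    proof (intro mult_left_mono, unfold exp_le_cancel_iff)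
      have "\<sigma> * (expansion N G m x - real m * L) \<le> C"
        using lim[OF that, of m] assms(3) abs_ge_self[of "\<sigma> * (expansion N G m x - real m * L)"] by (simp add: abs_mult)
      then have "\<sigma> * expansion N G m x \<le> \<sigma> * (real m * L) + \<epsilon> * real m / 2"
        using m by (simp add: algebra_simps)
      then have "t * (\<sigma> * expansion N G m x) \<le> t * (\<sigma> * (real m * L) + \<epsilon> * real m / 2)"
        using t by (intro mult_left_mono) auto
      moreover have "(?\<tau> * T)\<^sup>2 \<le> t * (\<epsilon> * real m / 2)"
      proof -
        have "(?\<tau> * T)\<^sup>2 = t * (t * T\<^sup>2)"
          using abs\<tau> by (metis mult.assoc power2_abs power2_eq_square power_mult_distrib)
        then show ?thesis using t by simp
      qed
      ultimately show "?\<tau> * expansion N G m x + (?\<tau> * T)\<^sup>2 \<le> t * real m * (\<sigma> * L + \<epsilon>)"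
        by (simp add: algebra_simps)
    qed simp
    finally show ?thesis by (simp add: mult.commute)
  qed
  \<comment> \<open>Large enough for an incomplete block, whose moment is only bounded crudely, even
    if the exponential rate is negative.\<close>
  define K where "K = exp (t * T + t * real m * \<bar>\<sigma> * L + \<epsilon>\<bar>)"
  have "?P n x \<le> K * exp (t * real n * (\<sigma> * L + \<epsilon>)) * norm x powr ?\<tau>" if "x \<noteq> 0" for n x
  proof (induction n rule: less_induct)
    case (less n)
    show ?case
    proof (cases "n < m")
      case True
      have "?P n x \<le> exp (\<bar>?\<tau>\<bar> * real n * ln M) * norm x powr ?\<tau>"
        by (rule moment_crude[OF that])
      also have "\<dots> \<le> exp ((t * T + t * real m * \<bar>\<sigma> * L + \<epsilon>\<bar>) + t * real n * (\<sigma> * L + \<epsilon>)) * norm x powr ?\<tau>"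
      proof (intro mult_right_mono, unfold exp_le_cancel_iff)
        have "t * real n * ln M \<le> t * T"
          unfolding T_def mult.assoc using True t M_ge_1 by (intro mult_left_mono mult_right_mono) auto
        moreover have "- (t * real n * (\<sigma> * L + \<epsilon>)) \<le> t * real n * \<bar>\<sigma> * L + \<epsilon>\<bar>"
          using mult_left_mono[OF abs_ge_minus_self[of "\<sigma> * L + \<epsilon>"], of "t * real n"] t
          by (simp only: mult_minus_right) simp
        moreover have "t * real n * \<bar>\<sigma> * L + \<epsilon>\<bar> \<le> t * real m * \<bar>\<sigma> * L + \<epsilon>\<bar>"
          using True t by (intro mult_left_mono mult_right_mono) auto
        ultimately show "\<bar>?\<tau>\<bar> * real n * ln M \<le> (t * T + t * real m * \<bar>\<sigma> * L + \<epsilon>\<bar>) + t * real n * (\<sigma> * L + \<epsilon>)"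
          unfolding abs\<tau> by linarith
      qed simp
      finally show ?thesis by (simp add: K_def exp_add)
    next
      case False
      have "?P ((n - m) + m) x \<le> b * ?P (n - m) x"
        by (rule moment_step[OF block that])
      also have "\<dots> \<le> b * (K * exp (t * real (n - m) * (\<sigma> * L + \<epsilon>)) * norm x powr ?\<tau>)"
        using m False by (intro mult_left_mono less.IH) (auto simp: b_def)
      also have "\<dots> = K * exp (t * real n * (\<sigma> * L + \<epsilon>)) * norm x powr ?\<tau>"
        using False unfolding b_def by (simp add: exp_add[symmetric] of_nat_diff algebra_simps)
      finally show ?thesis using False by simp
    qed
  qed
  then show ?thesis using t by blast
qed

text \<open>Markov's inequality for the moment of order \<open>\<sigma> * t\<close>. The moment
  grows with margin \<epsilon> while the threshold has margin \<open>2 * \<epsilon>\<close>, so the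
  probabilities decay geometrically and are summable.\<close>

lemma AE_eventually_one_sided:
  assumes lim: "\<And>n x. x \<noteq> 0 \<Longrightarrow> \<bar>expansion N G n x - real n * L\<bar> \<le> C"
    and "0 < \<epsilon>" "\<bar>\<sigma>\<bar> = 1" "x \<noteq> 0"
  shows "AE w in PiM UNIV (\<lambda>_. N). \<forall>\<^sub>F n in sequentially.
    \<sigma> * (ln (norm (vorbit w n x)) - real n * L) < 2 * \<epsilon> * real n"
proof -
  let ?U = "PiM (UNIV :: int set) (\<lambda>_. N)"
  interpret U: prob_space ?U
    by (intro prob_space_PiM prob_space_axioms)
  obtain t K where t: "0 < t" and K: "\<And>n. (vec.P ^^ n) (\<lambda>y. norm y powr (\<sigma> * t)) x
      \<le> K * exp (t * real n * (\<sigma> * L + \<epsilon>)) * norm x powr (\<sigma> * t)"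
    using moment_growth[OF lim assms(2,3)] assms(4) by blast
  note [measurable] = vec.orbit_measurable
  define A where "A n = {w \<in> space ?U. 2 * \<epsilon> * real n \<le> \<sigma> * (ln (norm (vorbit w n x)) - real n * L)}" for n
  have A: "A n \<in> sets ?U" for n
    unfolding A_def by measurable
  have bound: "measure ?U (A n) \<le> (K * norm x powr (\<sigma> * t)) * exp (- (t * \<epsilon>)) ^ n" for n
  proof -
    let ?u = "\<lambda>w. norm (vorbit w n x) powr (\<sigma> * t)" and ?c = "exp (t * (\<sigma> * (real n * L) + 2 * \<epsilon> * real n))"
    have "A n \<subseteq> {w \<in> space ?U. ?c \<le> ?u w}"
    proof
      fix w assume w: "w \<in> A n"
      then have "t * (2 * \<epsilon> * real n) \<le> t * (\<sigma> * (ln (norm (vorbit w n x)) - real n * L))"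
        using t by (intro mult_left_mono) (auto simp: A_def)
      then show "w \<in> {w \<in> space ?U. ?c \<le> ?u w}"
        using w vorbit_nonzero[OF assms(4), of w n] by (simp add: A_def powr_def algebra_simps)
    qed
    then have "measure ?U (A n) \<le> measure ?U {w \<in> space ?U. ?c \<le> ?u w}"
      by (intro U.finite_measure_mono) measurable
    also have "\<dots> \<le> (\<integral>w. ?u w \<partial>?U) / ?c"
      by (rule integral_Markov_inequality_measure[where A = "space ?U"])
        (use vec.integrable_orbit[OF admissible_norm_powr, of n x "\<sigma> * t"] in auto)
    also have "(\<integral>w. ?u w \<partial>?U) = (vec.P ^^ n) (\<lambda>y. norm y powr (\<sigma> * t)) x"
      by (rule vec.integral_orbit[OF admissible_norm_powr])
    also have "\<dots> / ?c \<le> K * exp (t * real n * (\<sigma> * L + \<epsilon>)) * norm x powr (\<sigma> * t) / ?c"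
      by (intro divide_right_mono K) simp
    also have "\<dots> = (K * norm x powr (\<sigma> * t)) * (exp (t * real n * (\<sigma> * L + \<epsilon>)) / ?c)"
      by simp
    also have "exp (t * real n * (\<sigma> * L + \<epsilon>)) / ?c = exp (- (t * \<epsilon>)) ^ n"
      unfolding exp_of_nat_mult[symmetric] exp_diff[symmetric] by (simp add: algebra_simps)
    finally show ?thesis .
  qed
  have "summable (\<lambda>n. measure ?U (A n))"
  proof (rule summable_comparison_test)
    show "summable (\<lambda>n. (K * norm x powr (\<sigma> * t)) * exp (- (t * \<epsilon>)) ^ n)"
      using t assms(2) by (intro summable_mult summable_geometric) simp
  qed (use bound in auto)
  then have "AE w in ?U. \<forall>\<^sub>F n in sequentially. w \<in> space ?U - A n"
    using A by (intro borel_cantelli_AE1) (auto simp: U.emeasure_eq_measure)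
  then show ?thesis
    by (rule AE_mp) (auto intro!: AE_I2 elim!: eventually_mono simp: A_def)
qed

lemma AE_ln_norm_limit:
  assumes lim: "\<And>n x. x \<noteq> 0 \<Longrightarrow> \<bar>expansion N G n x - real n * L\<bar> \<le> C" and "x \<noteq> 0"
  shows "AE w in PiM UNIV (\<lambda>_. N). (\<lambda>n. ln (norm (vorbit w n x)) / real n) \<longlonglongrightarrow> L"
proof -
  let ?U = "PiM (UNIV :: int set) (\<lambda>_. N)"
  let ?d = "\<lambda>w n. ln (norm (vorbit w n x)) - real n * L"
  have one_sided: "AE w in ?U. \<forall>\<^sub>F n in sequentially. \<sigma> * ?d w n < 2 * \<epsilon> * real n"
    if "0 < \<epsilon>" "\<bar>\<sigma>\<bar> = 1" for \<epsilon> \<sigma>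
    by (rule AE_eventually_one_sided[OF _ that assms(2)]) (rule lim)
  \<comment> \<open>Countably many margins suffice, so the exceptional null sets can be
    united.\<close>
  have "AE w in ?U. \<forall>j::nat. (\<forall>\<^sub>F n in sequentially. ?d w n < 2 * (1 / real (Suc j)) * real n)
      \<and> (\<forall>\<^sub>F n in sequentially. - ?d w n < 2 * (1 / real (Suc j)) * real n)"
    unfolding AE_all_countable
  proof (intro allI AE_conjI)
    fix j :: nat
    have j: "0 < 1 / real (Suc j)" by simp
    show "AE w in ?U. \<forall>\<^sub>F n in sequentially. ?d w n < 2 * (1 / real (Suc j)) * real n"
      using one_sided[OF j abs_one] by (simp only: mult_1_left)
    show "AE w in ?U. \<forall>\<^sub>F n in sequentially. - ?d w n < 2 * (1 / real (Suc j)) * real n"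
      using one_sided[OF j abs_neg_one] by (simp only: mult_minus1)
  qed
  then show ?thesis
  proof (rule AE_mp, intro AE_I2 impI)
    fix w
    assume *: "\<forall>j::nat. (\<forall>\<^sub>F n in sequentially. ?d w n < 2 * (1 / real (Suc j)) * real n)
      \<and> (\<forall>\<^sub>F n in sequentially. - ?d w n < 2 * (1 / real (Suc j)) * real n)"
    show "(\<lambda>n. ln (norm (vorbit w n x)) / real n) \<longlonglongrightarrow> L"
    proof (rule tendstoI)
      fix e :: real assume "0 < e"
      then obtain j where j: "inverse (real (Suc j)) < e / 2"
        using reals_Archimedean[of "e / 2"] by auto
      have "\<forall>\<^sub>F n in sequentially. ?d w n < 2 * (1 / real (Suc j)) * real n \<and> - ?d w n < 2 * (1 / real (Suc j)) * real n \<and> 0 < n"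
        using * eventually_gt_at_top by (intro eventually_conj) auto
      then show "\<forall>\<^sub>F n in sequentially. dist (ln (norm (vorbit w n x)) / real n) L < e"
      proof (rule eventually_mono)
        fix n :: nat
        assume n: "?d w n < 2 * (1 / real (Suc j)) * real n \<and> - ?d w n < 2 * (1 / real (Suc j)) * real n \<and> 0 < n"
        then have "\<bar>?d w n\<bar> < 2 * (1 / real (Suc j)) * real n" by linarith
        also have "\<dots> \<le> e * real n"
          using j by (intro mult_right_mono) (auto simp: inverse_eq_divide simp del: of_nat_Suc)
        finally have "\<bar>?d w n\<bar> / real n < e"
          using n by (simp add: field_simps)
        moreover have "ln (norm (vorbit w n x)) / real n - L = ?d w n / real n"
          using n by (simp add: field_simps)
        ultimately show "dist (ln (norm (vorbit w n x)) / real n) L < e"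
          by (simp add: dist_real_def)
      qed
    qed
  qed
qed

end

lemma opnorm_le_columns: "opnorm A \<le> norm (A *v axis 1 1) + norm (A *v axis 2 1)"
proof (rule opnorm_le)
  fix x :: "real^2"
  have "x = (x $ 1) *\<^sub>R axis 1 1 + (x $ 2) *\<^sub>R axis 2 1"
    by (simp add: vec_eq_iff forall_2 axis_def)
  then have "A *v x = (x $ 1) *\<^sub>R (A *v axis 1 1) + (x $ 2) *\<^sub>R (A *v axis 2 1)"
    by (metis matrix_vector_mult_scaleR matrix_vector_right_distrib)
  also have "norm \<dots> \<le> \<bar>x $ 1\<bar> * norm (A *v axis 1 1) + \<bar>x $ 2\<bar> * norm (A *v axis 2 1)"
    by (rule order_trans[OF norm_triangle_ineq]) simp
  also have "\<dots> \<le> norm x * norm (A *v axis 1 1) + norm x * norm (A *v axis 2 1)"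
    by (intro add_mono mult_right_mono component_le_norm_cart) auto
  finally show "norm (A *v x) \<le> (norm (A *v axis 1 1) + norm (A *v axis 2 1)) * norm x"
    by (simp add: algebra_simps)
qed

text \<open>The norm of the product lies between the norm of its first column and twice the larger
  column norm, and both columns grow at the rate \<open>L\<close>.\<close>

lemma (in sl2_walk) AE_ln_opnorm_limit:
  assumes lim: "\<And>n x. x \<noteq> 0 \<Longrightarrow> \<bar>expansion N G n x - real n * L\<bar> \<le> C"
  shows "AE w in PiM UNIV (\<lambda>_. N). (\<lambda>n. ln (opnorm (cocycle (\<lambda>i. G (w i)) n)) / real n) \<longlonglongrightarrow> L"
proof -
  let ?e = "\<lambda>i. axis i 1 :: real^2"
  have nz: "?e i \<noteq> 0" for i by (simp add: axis_eq_0_iff)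
  have "AE w in PiM UNIV (\<lambda>_. N). (\<lambda>n. ln (norm (vorbit w n (?e 1))) / real n) \<longlonglongrightarrow> L"
    "AE w in PiM UNIV (\<lambda>_. N). (\<lambda>n. ln (norm (vorbit w n (?e 2))) / real n) \<longlonglongrightarrow> L"
    by (rule AE_ln_norm_limit[OF lim nz]; assumption)+
  then show ?thesis
  proof eventually_elim
    case (elim w)
    let ?A = "cocycle (\<lambda>i. G (w i))"
    let ?a = "\<lambda>i n. ln (norm (vorbit w n (?e i))) / real n"
    have "(\<lambda>n. ln 2 / real n + max (?a 1 n) (?a 2 n)) \<longlonglongrightarrow> 0 + max L L"
      by (intro tendsto_add lim_const_over_n tendsto_max elim)
    then have up: "(\<lambda>n. ln 2 / real n + max (?a 1 n) (?a 2 n)) \<longlonglongrightarrow> L" by simp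
    have pos: "0 < norm (vorbit w n (?e i))" for n i
      using vorbit_nonzero[OF nz] by simp
    have low: "norm (vorbit w n (?e 1)) \<le> opnorm (?A n)" for n
      using norm_le_opnorm[of "?A n" "?e 1"] by (simp add: vorbit_eq_cocycle)
    have upp: "opnorm (?A n) \<le> 2 * max (norm (vorbit w n (?e 1))) (norm (vorbit w n (?e 2)))" for n
      using opnorm_le_columns[of "?A n"] by (simp add: vorbit_eq_cocycle)
    show ?case
    proof (rule tendsto_sandwich[OF _ _ elim(1) up]; intro always_eventually allI)
      fix n
      have "ln (norm (vorbit w n (?e 1))) \<le> ln (opnorm (?A n))"
        using low[of n] pos[of n 1] less_le_trans[OF pos[of n 1] low[of n]] by (subst ln_le_cancel_iff)
      then show "?a 1 n \<le> ln (opnorm (?A n)) / real n"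
        by (intro divide_right_mono) auto
      have "ln (opnorm (?A n)) \<le> ln (2 * max (norm (vorbit w n (?e 1))) (norm (vorbit w n (?e 2))))"
        using upp[of n] less_le_trans[OF pos[of n 1] low[of n]] less_le_trans[OF less_le_trans[OF pos[of n 1] low[of n]] upp[of n]]
        by (subst ln_le_cancel_iff)
      also have "\<dots> = ln 2 + max (ln (norm (vorbit w n (?e 1)))) (ln (norm (vorbit w n (?e 2))))"
        using pos[of n 1] pos[of n 2] by (simp add: ln_mult max_def)
      finally have "ln (opnorm (?A n)) / real n
          \<le> (ln 2 + max (ln (norm (vorbit w n (?e 1)))) (ln (norm (vorbit w n (?e 2))))) / real n"
        by (intro divide_right_mono) auto
      also have "\<dots> = ln 2 / real n + max (?a 1 n) (?a 2 n)"
        by (simp only: add_divide_distrib max_divide_distrib_right of_nat_0_le_iff if_True)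
      finally show "ln (opnorm (?A n)) / real n \<le> ln 2 / real n + max (?a 1 n) (?a 2 n)" .
    qed
  qed
qed

section \<open>Unboundedness of the expected log-norm\<close>

lemma matrix_diff_ldistrib: "(A :: real^2^2) ** (B - C) = A ** B - A ** (C :: real^2^2)"
  by (simp add: vec_eq_iff matrix_matrix_mult_def algebra_simps sum_subtractf)

lemma matrix_diff_rdistrib: "(A - B) ** (C :: real^2^2) = A ** C - (B :: real^2^2) ** C"
  by (simp add: vec_eq_iff matrix_matrix_mult_def algebra_simps sum_subtractf)

lemma norm_le_opnorm_mat: "norm A \<le> 4 * opnorm A"
proof -
  have "norm A \<le> (\<Sum>i\<in>UNIV. norm (A $ i))"
    by (simp add: norm_vec_def L2_set_le_sum)
  also have "\<dots> \<le> (\<Sum>i\<in>(UNIV :: 2 set). \<Sum>j\<in>(UNIV :: 2 set). opnorm A)"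
    unfolding opnorm_def
    by (intro sum_mono order_trans[OF norm_le_l1_cart] matrix_component_le_onorm)
  finally show ?thesis by simp
qed

lemma SL2_inverse:
  assumes "det (A :: real^2^2) = 1"
  obtains B where "A ** B = mat 1" "B ** A = mat 1" "det B = 1" "opnorm B = opnorm A"
proof -
  obtain B where B: "A ** B = mat 1" "B ** A = mat 1"
    using assms invertible_det_nz[of A] by (auto simp: invertible_def)
  then have det: "det B = 1"
    using assms by (metis det_I det_mul mult_1)
  have "opnorm B \<le> opnorm A"
    using opnorm_le_mult[OF assms, of B] by (simp add: B)
  moreover have "opnorm A \<le> opnorm B"
    using opnorm_le_mult[OF det, of A] by (simp add: B)
  ultimately show ?thesis using that B det by force
qed

text \<open>For starting matrices \<open>A\<close> and \<open>B = A ** C\<close>, the quotient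
  \<open>C\<close> differs from the identity by the inverse of \<open>A\<close> times
  \<open>B - A\<close>. This gives continuity of the growth in the starting matrix.\<close>

lemma ln_opnorm_le_dist:
  assumes "det A = 1" "det C = 1"
  shows "ln (opnorm C) \<le> opnorm A * opnorm (A ** C - A)"
proof -
  obtain A' where A': "A' ** A = mat 1" "opnorm A' = opnorm A"
    using SL2_inverse[OF assms(1)] by metis
  have "C - mat 1 = A' ** (A ** C - A)"
    by (simp add: matrix_diff_ldistrib matrix_mul_assoc A')
  then have "opnorm (C - mat 1) \<le> opnorm A * opnorm (A ** C - A)"
    using opnorm_mult[of A' "A ** C - A"] A' by simp
  moreover have "opnorm C \<le> opnorm (C - mat 1) + 1"
    using opnorm_add[of "C - mat 1" "mat 1"] by simp
  moreover have "ln (opnorm C) \<le> opnorm C - 1"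
    using opnorm_ge_1[OF assms(2)] by (intro ln_le_minus_one) simp
  ultimately show ?thesis by linarith
qed

definition exp_log_opnorm :: "'w measure \<Rightarrow> ('w \<Rightarrow> real^2^2) \<Rightarrow> nat \<Rightarrow> real^2^2 \<Rightarrow> real" where
  "exp_log_opnorm N G n = (trans_op N (\<lambda>\<omega> A. G \<omega> ** A) ^^ n) (\<lambda>A. ln (opnorm A))"

context sl2_walk
begin

lemma admissible_exp_log_opnorm: "mat.admissible (exp_log_opnorm N G n)"
  unfolding exp_log_opnorm_def by (intro mat.admissible_funpow admissible_ln_opnorm)

lemma det_step: "det A = 1 \<Longrightarrow> det (G \<omega> ** A) = 1"
  by (simp add: det_mul G_det)

lemma exp_log_opnorm_nonneg:
  assumes "det A = 1"
  shows "0 \<le> exp_log_opnorm N G n A"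
proof -
  have "(mat.P ^^ n) (\<lambda>_. 0) A \<le> exp_log_opnorm N G n A"
    unfolding exp_log_opnorm_def
    by (rule mat.funpow_mono_inv[where S = "{A. det A = 1}"])
      (use assms in \<open>auto simp: admissible_ln_opnorm det_step opnorm_ge_1\<close>)
  then show ?thesis by (simp add: mat.funpow_const)
qed

lemma exp_log_opnorm_mult_right:
  assumes "det A = 1" "det C = 1"
  shows "exp_log_opnorm N G n (A ** C) \<le> exp_log_opnorm N G n A + ln (opnorm C)"
proof -
  obtain C' where C': "C ** C' = mat 1" "det C' = 1" "opnorm C' = opnorm C"
    using SL2_inverse[OF assms(2)] by metis
  have le: "opnorm (B ** C) \<le> opnorm B * opnorm C" "opnorm B \<le> opnorm (B ** C) * opnorm C" for B
    using opnorm_mult[of B C] opnorm_mult[of "B ** C" C'] C' by (simp_all add: matrix_mul_assoc[symmetric])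
  have C1: "1 \<le> opnorm C" by (rule opnorm_ge_1[OF assms(2)])
  have bound: "\<bar>ln (opnorm (B ** C)) - ln (opnorm B)\<bar> \<le> ln (opnorm C)" for B
  proof (cases "opnorm B = 0")
    case True
    then have "opnorm (B ** C) = 0" using le(1)[of B] opnorm_nonneg[of "B ** C"] by simp
    then show ?thesis using True C1 by simp
  next
    case False
    then have B: "0 < opnorm B" using opnorm_nonneg[of B] by simp
    then have BC: "0 < opnorm (B ** C)"
      using le(2)[of B] opnorm_nonneg[of "B ** C"] by (cases "opnorm (B ** C) = 0") auto
    have "ln (opnorm (B ** C)) \<le> ln (opnorm B * opnorm C)" "ln (opnorm B) \<le> ln (opnorm (B ** C) * opnorm C)"
      using le[of B] B BC C1 by auto
    then show ?thesis using B BC C1 by (simp add: ln_mult)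
  qed
  have adm: "mat.admissible (\<lambda>B. ln (opnorm (B ** C)))"
  proof (rule mat.admissibleI)
    have "(\<lambda>B :: real^2^2. B ** C) \<in> borel \<rightarrow>\<^sub>M borel"
      by (intro matrix_matrix_measurable) auto
    then show "(\<lambda>B. ln (opnorm (B ** C))) \<in> borel_measurable borel"
      by measurable
    show "\<exists>K. \<forall>B. \<bar>ln (opnorm B)\<bar> \<le> r \<longrightarrow> \<bar>ln (opnorm (B ** C))\<bar> \<le> K" for r
      using bound by (intro exI[of _ "r + ln (opnorm C)"]) (smt (verit))
  qed
  have "exp_log_opnorm N G n (A ** C) = (mat.P ^^ n) (\<lambda>B. ln (opnorm (B ** C))) A"
    unfolding exp_log_opnorm_def
    by (rule trans_op_semiconj[symmetric]) (simp add: matrix_mul_assoc)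
  also have "\<dots> \<le> (mat.P ^^ n) (\<lambda>B. 1 * ln (opnorm B) + ln (opnorm C)) A"
    using bound
    by (intro mat.funpow_mono_inv[where S = UNIV] adm mat.admissible_add mat.admissible_cmult admissible_ln_opnorm mat.admissible_const)
      (auto simp: abs_le_iff algebra_simps)
  also have "\<dots> = exp_log_opnorm N G n A + ln (opnorm C)"
    unfolding exp_log_opnorm_def by (simp add: mat.funpow_affine[OF admissible_ln_opnorm, of n 1, simplified])
  finally show ?thesis .
qed

text \<open>Average \<open>opnorm A \<le> opnorm B * opnorm (B ** A)\<close> over the random product
  \<open>B\<close>. If the expected log-norms from the identity are bounded, those from
  \<open>A\<close> go to infinity with the norm of \<open>A\<close>, which is the properness needed
  below.\<close>

lemma exp_log_opnorm_ge:
  assumes "det A = 1"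
  shows "ln (opnorm A) - exp_log_opnorm N G n (mat 1) \<le> exp_log_opnorm N G n A"
proof -
  obtain A' where A': "A ** A' = mat 1" "det A' = 1" "opnorm A' = opnorm A"
    using SL2_inverse[OF assms] by metis
  \<comment> \<open>The value 0 away from determinant 1 keeps the function admissible on all
    matrices, since the bounds are derived for unimodular ones.\<close>
  let ?f = "\<lambda>B. if det B = 1 then ln (opnorm (B ** A)) else 0"
  have fb: "\<bar>ln (opnorm (B ** A))\<bar> \<le> \<bar>ln (opnorm B)\<bar> + ln (opnorm A)" 
    and fl: "ln (opnorm A) - ln (opnorm B) \<le> ln (opnorm (B ** A))" if "det B = 1" for B
  proof -
    have d: "det (B ** A) = 1" using that assms by (simp add: det_mul)
    have 1: "1 \<le> opnorm B" "1 \<le> opnorm A" "1 \<le> opnorm (B ** A)"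
      using opnorm_ge_1 that assms d by auto
    have "ln (opnorm (B ** A)) \<le> ln (opnorm B * opnorm A)"
      using opnorm_mult[of B A] 1 by simp
    then show "\<bar>ln (opnorm (B ** A))\<bar> \<le> \<bar>ln (opnorm B)\<bar> + ln (opnorm A)"
      using 1 by (simp add: ln_mult)
    have "ln (opnorm A) \<le> ln (opnorm B * opnorm (B ** A))"
      using opnorm_le_mult[OF that, of A] 1 by simp
    then show "ln (opnorm A) - ln (opnorm B) \<le> ln (opnorm (B ** A))"
      using 1 by (simp add: ln_mult)
  qed
  have adm: "mat.admissible ?f"
  proof (rule mat.admissibleI)
    note [measurable] = det_measurable
    have [measurable]: "(\<lambda>B :: real^2^2. B ** A) \<in> borel \<rightarrow>\<^sub>M borel"
      by (intro matrix_matrix_measurable) auto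
    show "?f \<in> borel_measurable borel" by measurable
    show "\<exists>K. \<forall>B. \<bar>ln (opnorm B)\<bar> \<le> r \<longrightarrow> \<bar>?f B\<bar> \<le> K" for r
      using fb opnorm_ge_1[OF assms]
      by (intro exI[of _ "\<bar>r\<bar> + ln (opnorm A)"]) (smt (verit) ln_ge_zero)
  qed
  have "(mat.P ^^ n) (\<lambda>B. (-1) * ln (opnorm B) + ln (opnorm A)) (mat 1) \<le> (mat.P ^^ n) ?f (mat 1)"
    using fl
    by (intro mat.funpow_mono_inv[where S = "{B. det B = 1}"] adm mat.admissible_add mat.admissible_cmult
        admissible_ln_opnorm mat.admissible_const) (auto simp: det_step)
  also have "(mat.P ^^ n) ?f (mat 1) = exp_log_opnorm N G n (mat 1 ** A)"
    unfolding exp_log_opnorm_def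
    by (rule trans_op_semiconj_on[where S = "{B. det B = 1}" and \<phi> = "\<lambda>B. B ** A"])
      (auto simp: det_step matrix_mul_assoc)
  also have "(mat.P ^^ n) (\<lambda>B. (-1) * ln (opnorm B) + ln (opnorm A)) (mat 1)
      = (-1) * exp_log_opnorm N G n (mat 1) + ln (opnorm A)"
    unfolding exp_log_opnorm_def by (rule mat.funpow_affine[OF admissible_ln_opnorm])
  finally show ?thesis by simp
qed

end

text \<open>The lower limit of the expected log-norms. If the expected log-norms are bounded, this is a proper
  continuous function on \<open>SL2\<close>, superharmonic by Fatou's lemma, so the points where it is minimal form a
  nonempty compact set that is invariant under the support of the walk.\<close>

definition lower_growth :: "'w measure \<Rightarrow> ('w \<Rightarrow> real^2^2) \<Rightarrow> real^2^2 \<Rightarrow> ennreal" where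
  "lower_growth N G A = liminf (\<lambda>n. ennreal (exp_log_opnorm N G n A))"

context sl2_walk
begin

lemma lower_growth_measurable: "lower_growth N G \<in> borel_measurable borel"
proof -
  have "exp_log_opnorm N G n \<in> borel_measurable borel" for n
    by (rule mat.admissible_measurable[OF admissible_exp_log_opnorm])
  then show ?thesis
    unfolding lower_growth_def[abs_def] by measurable
qed

lemma lower_growth_superharmonic:
  assumes "det A = 1"
  shows "(\<integral>\<^sup>+\<omega>. lower_growth N G (G \<omega> ** A) \<partial>N) \<le> lower_growth N G A"
proof -
  let ?a = "\<lambda>n. exp_log_opnorm N G n"
  have int: "integrable N (\<lambda>\<omega>. ?a n (G \<omega> ** A))" for n
    by (rule mat.integrable_step[OF admissible_exp_log_opnorm])
  have "(\<integral>\<^sup>+\<omega>. lower_growth N G (G \<omega> ** A) \<partial>N) \<le> liminf (\<lambda>n. \<integral>\<^sup>+\<omega>. ennreal (?a n (G \<omega> ** A)) \<partial>N)"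
    unfolding lower_growth_def using int by (intro nn_integral_liminf) simp
  also have "(\<lambda>n. \<integral>\<^sup>+\<omega>. ennreal (?a n (G \<omega> ** A)) \<partial>N) = (\<lambda>n. ennreal (?a (n + 1) A))"
  proof
    fix n
    have "(\<integral>\<^sup>+\<omega>. ennreal (?a n (G \<omega> ** A)) \<partial>N) = ennreal (\<integral>\<omega>. ?a n (G \<omega> ** A) \<partial>N)"
      using int assms by (intro nn_integral_eq_integral AE_I2 exp_log_opnorm_nonneg det_step)
    also have "(\<integral>\<omega>. ?a n (G \<omega> ** A) \<partial>N) = ?a (n + 1) A"
      unfolding exp_log_opnorm_def Suc_eq_plus1[symmetric] by (rule funpow_trans_op_Suc[symmetric])
    finally show "(\<integral>\<^sup>+\<omega>. ennreal (?a n (G \<omega> ** A)) \<partial>N) = ennreal (?a (n + 1) A)" .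
  qed
  also have "liminf \<dots> = lower_growth N G A"
    unfolding lower_growth_def by (rule liminf_shift)
  finally show ?thesis .
qed

lemma lower_growth_dist:
  assumes "det A = 1" "det B = 1"
  shows "lower_growth N G B \<le> lower_growth N G A + ennreal (opnorm A * opnorm (B - A))"
proof -
  obtain A' where A': "A ** A' = mat 1" "det A' = 1"
    using SL2_inverse[OF assms(1)] by metis
  let ?C = "A' ** B"
  have C: "A ** ?C = B" "det ?C = 1"
    using A' assms by (simp_all add: matrix_mul_assoc det_mul)
  have "exp_log_opnorm N G n B \<le> exp_log_opnorm N G n A + opnorm A * opnorm (B - A)" for n
    using exp_log_opnorm_mult_right[OF assms(1) C(2), of n] ln_opnorm_le_dist[OF assms(1) C(2)] C(1) by simp
  then have "lower_growth N G B \<le> liminf (\<lambda>n. ennreal (exp_log_opnorm N G n A) + ennreal (opnorm A * opnorm (B - A)))"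
    unfolding lower_growth_def using assms(1)
    by (intro Liminf_mono always_eventually allI)
      (simp add: ennreal_plus[symmetric] exp_log_opnorm_nonneg opnorm_nonneg ennreal_leI del: ennreal_plus)
  also have "\<dots> = lower_growth N G A + ennreal (opnorm A * opnorm (B - A))"
    unfolding lower_growth_def by (rule Liminf_add_const) simp
  finally show ?thesis .
qed

lemma lower_growth_bounds:
  assumes "\<And>n. exp_log_opnorm N G n (mat 1) \<le> R" "det A = 1"
  shows "lower_growth N G (mat 1) \<le> ennreal R" "ennreal (ln (opnorm A) - R) \<le> lower_growth N G A"
    "lower_growth N G A < \<top>"
proof -
  show 1: "lower_growth N G (mat 1) \<le> ennreal R"
    unfolding lower_growth_def using assms(1)
    by (intro Liminf_le always_eventually allI ennreal_leI) simp_all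
  show "ennreal (ln (opnorm A) - R) \<le> lower_growth N G A"
    unfolding lower_growth_def
  proof (intro Liminf_bounded always_eventually allI ennreal_leI)
    show "ln (opnorm A) - R \<le> exp_log_opnorm N G n A" for n
      using exp_log_opnorm_ge[OF assms(2), of n] assms(1)[of n] by linarith
  qed
  have "lower_growth N G A \<le> ennreal R + ennreal (opnorm (mat 1) * opnorm (A - mat 1))"
    using lower_growth_dist[of "mat 1" A] 1 assms(2) by (meson add_right_mono det_I order_trans)
  also have "\<dots> < \<top>" by simp
  finally show "lower_growth N G A < \<top>" .
qed

end

lemma opnorm_transfer_matrix_diff: "opnorm (transfer_matrix E s - transfer_matrix E t) \<le> \<bar>s - t\<bar>"
proof (rule opnorm_le)
  fix x :: "real^2"
  have "(transfer_matrix E s - transfer_matrix E t) *v x = axis 1 ((s - t) * x $ 1)"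
    by (simp add: vec_eq_iff forall_2 matrix_vector_2 transfer_matrix_def axis_def algebra_simps)
  then have "norm ((transfer_matrix E s - transfer_matrix E t) *v x) = \<bar>s - t\<bar> * \<bar>x $ 1\<bar>"
    by (simp add: norm_vec_def L2_set_def sum_2 axis_def abs_mult)
  also have "\<dots> \<le> \<bar>s - t\<bar> * norm x"
    by (intro mult_left_mono component_le_norm_cart) simp
  finally show "norm ((transfer_matrix E s - transfer_matrix E t) *v x) \<le> \<bar>s - t\<bar> * norm x" .
qed

lemma compact_SL2_ball: "compact {A :: real^2^2. det A = 1 \<and> opnorm A \<le> r}"
proof (rule compact_eq_bounded_closed[THEN iffD2], rule conjI)
  show "bounded {A :: real^2^2. det A = 1 \<and> opnorm A \<le> r}"
    by (rule boundedI[where B = "4 * r"]) (use norm_le_opnorm_mat in \<open>fastforce intro: order_trans\<close>)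
  have "continuous_on UNIV (\<lambda>B :: real^2^2. det B)"
    unfolding det_2 by (intro continuous_intros continuous_on_component)
  then show "closed {A :: real^2^2. det A = 1 \<and> opnorm A \<le> r}"
    by (intro closed_Collect_conj closed_Collect_eq closed_Collect_le continuous_on_opnorm continuous_on_const)
qed

text \<open>\<open>v\<close> reads the potential from a letter, and the last assumption says that
  \<open>a\<close> and \<open>b\<close> are two support points of its law.\<close>

locale schrodinger_walk = sl2_walk N G M
  for N :: "'w measure" and G :: "'w \<Rightarrow> real^2^2" and M :: real +
  fixes v :: "'w \<Rightarrow> real" and E a b :: real
  assumes v_measurable: "v \<in> borel_measurable N"
    and G_eq: "G \<omega> = transfer_matrix E (v \<omega>)"
    and a_less_b: "a < b"
    and supp: "s \<in> {a, b} \<Longrightarrow> 0 < \<eta> \<Longrightarrow> 0 < prob {\<omega> \<in> space N. \<bar>v \<omega> - s\<bar> < \<eta>}"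
begin

lemma near_sets: "{\<omega> \<in> space N. \<bar>v \<omega> - s\<bar> < \<eta>} \<in> sets N"
  using v_measurable by measurable

lemma AE_near:
  assumes "AE \<omega> in N. Q \<omega>" "s \<in> {a, b}" "0 < \<eta>"
  shows "\<exists>\<omega>. \<bar>v \<omega> - s\<bar> < \<eta> \<and> Q \<omega>"
proof (rule ccontr)
  assume "\<not> ?thesis"
  with assms(1) have "AE \<omega> in N. \<not> \<bar>v \<omega> - s\<bar> < \<eta>"
    by (auto elim: eventually_mono)
  then have "prob {\<omega> \<in> space N. \<bar>v \<omega> - s\<bar> < \<eta>} = 0"
    using near_sets[of s \<eta>] by (subst prob_eq_0) auto
  then show False using supp[OF assms(2,3)] by simp
qed

lemma exp_log_opnorm_unbounded: "\<exists>n. R < exp_log_opnorm N G n (mat 1)"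
proof (rule ccontr)
  assume "\<not> ?thesis"
  then have R: "exp_log_opnorm N G n (mat 1) \<le> R" for n by (simp add: not_less)
  have R0: "0 \<le> R"
    using R[of 0] by (simp add: exp_log_opnorm_def)
  define h where "h A = enn2real (lower_growth N G A)" for A
  have H: "lower_growth N G A = ennreal (h A)" if "det A = 1" for A
    using lower_growth_bounds(3)[OF R that] by (simp add: h_def)
  have h0: "0 \<le> h A" for A by (simp add: h_def)
  have h_dist: "h B \<le> h A + opnorm A * opnorm (B - A)" if "det A = 1" "det B = 1" for A B
    using lower_growth_dist[OF that] h0 opnorm_nonneg unfolding H[OF that(1)] H[OF that(2)]
    by (simp add: ennreal_plus[symmetric] del: ennreal_plus)
  have h1: "h (mat 1) \<le> R"
    using lower_growth_bounds(1)[OF R det_I] R0 unfolding H[OF det_I] by (simp add: ennreal_le_iff)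
  have h_ge: "ln (opnorm A) - R \<le> h A" if "det A = 1" for A
    using lower_growth_bounds(2)[OF R that] H[OF that] h0 by (simp add: ennreal_le_iff)
  \<comment> \<open>Outside this ball \<open>h\<close> exceeds \<open>2 * R + 1 - R > R\<close>,
    while at the identity it is at most \<open>R\<close>; so the minimum over the ball is
    global.\<close>
  define r where "r = exp (2 * R + 1)"
  define Kc where "Kc = {A :: real^2^2. det A = 1 \<and> opnorm A \<le> r}"
  have r0: "0 < r" by (simp add: r_def)
  have mem1: "mat 1 \<in> Kc"
    using R0 by (simp add: Kc_def r_def)
  have cont: "continuous_on Kc h"
  proof (rule continuous_onI)
    fix A and e :: real assume A: "A \<in> Kc" and e: "0 < e"
    have le: "dist (h B) (h A) \<le> r * (4 * dist B A)" if "B \<in> Kc" for B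
    proof -
      have "opnorm A * opnorm (B - A) \<le> r * (4 * dist B A)" "opnorm B * opnorm (A - B) \<le> r * (4 * dist B A)"
        using A that opnorm_le_norm[of "B - A"] opnorm_le_norm[of "A - B"] r0
        by (auto intro!: mult_mono simp: Kc_def dist_norm norm_minus_commute opnorm_nonneg)
      then show ?thesis
        using h_dist[of A B] h_dist[of B A] A that by (auto simp: Kc_def dist_real_def abs_le_iff)
    qed
    show "\<exists>d>0. \<forall>B\<in>Kc. dist B A < d \<longrightarrow> dist (h B) (h A) \<le> e"
    proof (intro exI[of _ "e / (4 * r)"] conjI ballI impI)
      fix B assume "B \<in> Kc" "dist B A < e / (4 * r)"
      then have "r * (4 * dist B A) \<le> e" using r0 by (simp add: field_simps)
      then show "dist (h B) (h A) \<le> e" using le[OF \<open>B \<in> Kc\<close>] by simp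
    qed (use e r0 in simp)
  qed
  have "compact Kc" unfolding Kc_def by (rule compact_SL2_ball)
  then obtain A0 where A0: "A0 \<in> Kc" "\<And>B. B \<in> Kc \<Longrightarrow> h A0 \<le> h B"
    using continuous_attains_inf[OF _ _ cont] mem1 by blast
  define m where "m = h A0"
  have m_le: "m \<le> R" using A0(2)[OF mem1] h1 by (simp add: m_def)
  have outside: "R < h B" if "det B = 1" "B \<notin> Kc" for B
  proof -
    have "r < opnorm B" using that by (simp add: Kc_def)
    then have "ln r < ln (opnorm B)" using r0 by simp
    then show ?thesis using h_ge[OF that(1)] by (simp add: r_def)
  qed
  have min: "m \<le> h B" if "det B = 1" for B
    using A0(2)[of B] outside[OF that] m_le by (cases "B \<in> Kc") (auto simp: m_def)
  define X where "X = {B :: real^2^2. det B = 1 \<and> h B = m}"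
  have X_Kc: "det B = 1" "opnorm B \<le> r" if "B \<in> X" for B
    using that outside[of B] m_le by (auto simp: X_def Kc_def)
  have XI: "B \<in> X" if "det B = 1" "\<And>e. 0 < e \<Longrightarrow> h B \<le> m + e" for B
    using min[OF that(1)] field_le_epsilon[OF that(2)] that(1) by (auto simp: X_def)
  \<comment> \<open>The average of \<open>h\<close> over the images of a minimum point is at most
    the minimum, so almost every image is again a minimum point.\<close>
  have AE_X: "AE \<omega> in N. G \<omega> ** B \<in> X" if "B \<in> X" for B
  proof -
    have d: "det B = 1" using that by (simp add: X_def)
    let ?g = "\<lambda>\<omega>. h (G \<omega> ** B)"
    have meas: "?g \<in> borel_measurable N"
      unfolding h_def using measurable_compose[OF mat.T_measurable2 lower_growth_measurable] by measurable
    have le: "(\<integral>\<^sup>+\<omega>. ennreal (?g \<omega>) \<partial>N) \<le> ennreal m"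
      using lower_growth_superharmonic[OF d] that unfolding H[OF det_step[OF d]] H[OF d] by (simp add: X_def)
    then have int: "integrable N ?g"
      using meas h0 by (intro integrableI_nonneg) (auto simp: top_unique intro: le_less_trans)
    have "(\<integral>\<omega>. ?g \<omega> \<partial>N) \<le> m"
      using le nn_integral_eq_integral[OF int] h0 by (simp add: m_def)
    moreover have "0 \<le> (\<integral>\<omega>. ?g \<omega> - m \<partial>N)"
      using min[OF det_step[OF d]] by (intro integral_nonneg_AE) simp
    ultimately have "(\<integral>\<omega>. ?g \<omega> - m \<partial>N) = 0"
      using int by (simp add: prob_space)
    then have "AE \<omega> in N. ?g \<omega> - m = 0"
      using int min[OF det_step[OF d]] by (subst (asm) integral_nonneg_eq_0_iff_AE) auto
    then show ?thesis
      by eventually_elim (simp add: X_def det_step d)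
  qed
  \<comment> \<open>Letters with potential arbitrarily near \<open>s\<close> map \<open>B\<close>
    into \<open>X\<close>, and the Lipschitz bound for \<open>h\<close> carries minimality over to
    \<open>s\<close> itself.\<close>
  have step: "transfer_matrix E s ** B \<in> X" if BX: "B \<in> X" and s: "s \<in> {a, b}" for s B
  proof (rule XI)
    have dT: "det (transfer_matrix E s) = 1"
      using transfer_matrix_in_SL2 by (simp add: SL2_def)
    then show d: "det (transfer_matrix E s ** B) = 1"
      using X_Kc[OF BX] by (simp add: det_mul)
    fix e :: real assume e: "0 < e"
    obtain \<omega> where \<omega>: "\<bar>v \<omega> - s\<bar> < e / (r * r)" "G \<omega> ** B \<in> X"
      using AE_near[OF AE_X[OF BX] s, of "e / (r * r)"] e r0 by auto
    have "h (transfer_matrix E s ** B) \<le> h (G \<omega> ** B) + opnorm (G \<omega> ** B) * opnorm (transfer_matrix E s ** B - G \<omega> ** B)"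
      using X_Kc[OF \<omega>(2)] d by (intro h_dist)
    also have "h (G \<omega> ** B) = m" using \<omega> by (simp add: X_def)
    also have "opnorm (transfer_matrix E s ** B - G \<omega> ** B) \<le> opnorm (transfer_matrix E s - G \<omega>) * opnorm B"
      unfolding matrix_diff_rdistrib[symmetric] by (rule opnorm_mult)
    also have "\<dots> \<le> \<bar>s - v \<omega>\<bar> * r"
      unfolding G_eq using X_Kc[OF BX]
      by (intro mult_mono opnorm_transfer_matrix_diff) (auto simp: opnorm_nonneg)
    finally have "h (transfer_matrix E s ** B) \<le> m + opnorm (G \<omega> ** B) * (\<bar>s - v \<omega>\<bar> * r)"
      by (simp add: mult_left_mono opnorm_nonneg)
    also have "\<dots> \<le> m + r * (\<bar>s - v \<omega>\<bar> * r)"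
      using X_Kc[OF \<omega>(2)] r0 by (intro add_left_mono mult_right_mono) auto
    also have "\<dots> \<le> m + e"
      using \<omega>(1) r0 by (simp add: field_simps abs_minus_commute)
    finally show "h (transfer_matrix E s ** B) \<le> m + e" .
  qed
  let ?S = "transfer_matrix E b"
  have dS: "det ?S = 1"
    using transfer_matrix_in_SL2 by (simp add: SL2_def)
  obtain T where T: "?S ** T = mat 1" "T ** ?S = mat 1" "det T = 1"
    using SL2_inverse[OF dS] by metis
  \<comment> \<open>The points \<open>W k ** B\<close> stay in a compact set, so two of them are
    close. Cancelling the earlier power, which is bounded, shows that \<open>W (Suc i) ** B\<close>
    is close to \<open>B\<close>, so the minimum point \<open>W i ** B\<close> is close to
    \<open>T ** B\<close>.\<close>
  have inverse_step: "T ** B \<in> X" if B: "B \<in> X" for B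
  proof (rule XI)
    have dB: "det B = 1" using X_Kc[OF B] by simp
    then show dTB: "det (T ** B) = 1" using T by (simp add: det_mul)
    fix e :: real assume e: "0 < e"
    define W where "W k = ((\<lambda>A. ?S ** A) ^^ k) (mat 1)" for k
    have W_Suc: "W (Suc k) = ?S ** W k" and W0: "W 0 = mat 1" for k
      by (simp_all add: W_def)
    have W_add: "W (j + i) = W j ** W i" for i j
      by (induction j) (simp_all add: W_Suc W0 matrix_mul_assoc)
    have W_X: "W k ** B \<in> X" for k
      by (induction k) (use B step in \<open>auto simp: W0 W_Suc matrix_mul_assoc[symmetric]\<close>)
    have dW: "det (W k) = 1" for k
      by (induction k) (simp_all add: W0 W_Suc det_mul dS)
    obtain B' where B': "B ** B' = mat 1" "opnorm B' = opnorm B"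
      using SL2_inverse[OF dB] by metis
    have W_le: "opnorm (W k) \<le> r * r" for k
    proof -
      have "W k = (W k ** B) ** B'"
        by (simp add: matrix_mul_assoc[symmetric] B')
      then have "opnorm (W k) \<le> opnorm (W k ** B) * opnorm B'"
        by (metis opnorm_mult)
      also have "\<dots> \<le> r * r"
        using X_Kc[OF W_X[of k]] X_Kc[OF B] B' r0 by (intro mult_mono) (auto simp: opnorm_nonneg)
      finally show ?thesis .
    qed
    \<comment> \<open>Cancels the losses: \<open>4\<close> from the Frobenius norm,
      \<open>r * r\<close> from the earlier power, \<open>opnorm T\<close> from the inverse and
      \<open>r\<close> from the Lipschitz constant of \<open>h\<close>.\<close>
    define \<delta> where "\<delta> = e / (4 * r * opnorm T * (r * r))"
    have T0: "0 < opnorm T" using opnorm_ge_1[OF T(3)] by simp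
    have \<delta>: "0 < \<delta>" using e r0 T0 by (simp add: \<delta>_def)
    have "\<forall>k. W k ** B \<in> Kc"
      using X_Kc[OF W_X] by (simp add: Kc_def)
    then obtain l q where q: "strict_mono q" "((\<lambda>k. W k ** B) \<circ> q) \<longlonglongrightarrow> l"
      using \<open>compact Kc\<close> unfolding compact_def by metis
    then have "Cauchy ((\<lambda>k. W k ** B) \<circ> q)"
      by (metis LIMSEQ_imp_Cauchy)
    then obtain k0 where "\<forall>j\<ge>k0. \<forall>k\<ge>k0. dist (W (q j) ** B) (W (q k) ** B) < \<delta>"
      using \<delta> by (auto simp: Cauchy_def)
    then have close: "dist (W (q (Suc k0)) ** B) (W (q k0) ** B) < \<delta>" by simp
    have "q k0 < q (Suc k0)" using q(1) by (simp add: strict_mono_def)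
    then obtain i where i: "q (Suc k0) = q k0 + Suc i"
      using less_imp_Suc_add by auto
    let ?Y = "W (Suc i) ** B - B"
    have "W (q k0) ** ?Y = W (q (Suc k0)) ** B - W (q k0) ** B"
      by (simp add: i W_add matrix_diff_ldistrib matrix_mul_assoc del: add_Suc_right)
    then have "opnorm (W (q k0) ** ?Y) \<le> 4 * \<delta>"
      using opnorm_le_norm[of "W (q (Suc k0)) ** B - W (q k0) ** B"] close by (simp add: dist_norm)
    then have Y: "opnorm ?Y \<le> (r * r) * (4 * \<delta>)"
      using opnorm_le_mult[OF dW, of ?Y "q k0"] W_le[of "q k0"] r0 opnorm_nonneg
      by (meson mult_mono order_trans zero_le_square)
    have TW: "T ** (W (Suc i) ** B) = W i ** B"
      by (simp add: W_Suc matrix_mul_assoc T)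
    have "h (T ** B) \<le> h (W i ** B) + opnorm (W i ** B) * opnorm (T ** B - W i ** B)"
      using X_Kc[OF W_X[of i]] dTB by (intro h_dist)
    also have "h (W i ** B) = m" using W_X[of i] by (simp add: X_def)
    also have "T ** B - W i ** B = T ** (B - W (Suc i) ** B)"
      unfolding TW[symmetric] by (simp add: matrix_diff_ldistrib)
    also have "opnorm (W i ** B) * opnorm (T ** (B - W (Suc i) ** B)) \<le> r * (opnorm T * ((r * r) * (4 * \<delta>)))"
    proof (intro mult_mono)
      have "opnorm (T ** (B - W (Suc i) ** B)) \<le> opnorm T * opnorm ?Y"
        using opnorm_mult[of T "B - W (Suc i) ** B"] by (simp add: opnorm_minus)
      also have "\<dots> \<le> opnorm T * ((r * r) * (4 * \<delta>))"
        by (intro mult_left_mono Y opnorm_nonneg)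
      finally show "opnorm (T ** (B - W (Suc i) ** B)) \<le> opnorm T * ((r * r) * (4 * \<delta>))" .
    qed (use X_Kc[OF W_X[of i]] r0 in \<open>auto simp: opnorm_nonneg\<close>)
    also have "r * (opnorm T * ((r * r) * (4 * \<delta>))) = e"
      using r0 T0 by (simp add: \<delta>_def field_simps)
    finally show "h (T ** B) \<le> m + e" by simp
  qed
  \<comment> \<open>The quotient of the two transfer matrices, a shear that is nontrivial since
    \<open>a < b\<close>.\<close>
  define U :: "real^2^2" where "U = vector [vector [1, a - b], vector [0, 1]]"
  have "U ** ?S = transfer_matrix E a"
    by (simp add: vec_eq_iff forall_2 matrix_matrix_mult_def sum_2 U_def transfer_matrix_def)
  then have US: "transfer_matrix E a ** T = U"
    by (metis T(1) matrix_mul_assoc matrix_mul_rid)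
  have U_X: "U ** B \<in> X" if "B \<in> X" for B
    using step[OF inverse_step[OF that], of a] by (simp add: matrix_mul_assoc US)
  have U_entry: "(U ** B) $ 1 $ j = B $ 1 $ j + (a - b) * B $ 2 $ j" "(U ** B) $ 2 $ j = B $ 2 $ j" for B :: "real^2^2" and j
    by (simp_all add: matrix_matrix_mult_def sum_2 U_def)
  have A0X: "A0 \<in> X" using A0(1) by (simp add: X_def Kc_def m_def)
  have pow: "((\<lambda>B. U ** B) ^^ n) A0 \<in> X \<and> (((\<lambda>B. U ** B) ^^ n) A0) $ 1 $ j = A0 $ 1 $ j + real n * (a - b) * A0 $ 2 $ j
      \<and> (((\<lambda>B. U ** B) ^^ n) A0) $ 2 $ j = A0 $ 2 $ j" for n j
  proof (induction n)
    case (Suc n)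
    then show ?case
      using U_X by (simp add: U_entry algebra_simps)
  qed (use A0X in simp)
  \<comment> \<open>Powers of the shear add multiples of the second row of \<open>A0\<close> to its
    first row, linearly in \<open>n\<close>; in the bounded set \<open>X\<close> this forces the
    second row to vanish.\<close>
  have zero: "A0 $ 2 $ j = 0" for j
  proof (rule ccontr)
    assume nz: "A0 $ 2 $ j \<noteq> 0"
    let ?t = "\<bar>(a - b) * A0 $ 2 $ j\<bar>"
    have t: "0 < ?t" using nz a_less_b by simp
    obtain n :: nat where n: "2 * r / ?t < real n"
      using reals_Archimedean2 by blast
    have entry: "\<bar>B $ 1 $ j\<bar> \<le> r" if "B \<in> X" for B
      using X_Kc[OF that] matrix_component_le_onorm[of B 1 j] by (simp add: opnorm_def)
    have "real n * ?t = \<bar>real n * (a - b) * A0 $ 2 $ j\<bar>"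
      by (simp add: abs_mult)
    also have "\<dots> \<le> 2 * r"
      using entry[OF A0X] entry[of "((\<lambda>B. U ** B) ^^ n) A0"] pow[of n j] by linarith
    finally show False using n t by (simp add: field_simps)
  qed
  have "det A0 = 0" by (simp add: det_2 zero)
  then show False using X_Kc[OF A0X] by simp
qed

end

section \<open>Transversal directions and a uniform lower bound for the expansion\<close>

lemma Cramer_2: "wedge z w *\<^sub>R u = wedge u w *\<^sub>R z + wedge z u *\<^sub>R (w :: real^2)"
  by (simp add: vec_eq_iff forall_2 wedge_def algebra_simps)

text \<open>By Cramer's rule every vector is a combination of \<open>z\<close> and \<open>w\<close>
  with coefficients controlled by the area they span, so a matrix that is small at both is small
  everywhere.\<close>

lemma opnorm_le_two_directions:
  assumes "norm z \<le> R" "norm w \<le> R" "\<epsilon> \<le> \<bar>wedge z w\<bar>" "0 < \<epsilon>"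
  shows "\<epsilon> / (2 * R) * opnorm A \<le> max (norm (A *v z)) (norm (A *v w))"
proof -
  let ?m = "max (norm (A *v z)) (norm (A *v w))"
  have "0 < norm z" using assms by (cases "z = 0") auto
  then have R: "0 < R" using assms(1) by linarith
  have "norm (A *v u) \<le> (2 * R / \<epsilon> * ?m) * norm u" for u
  proof -
    have "\<epsilon> * norm (A *v u) \<le> \<bar>wedge z w\<bar> * norm (A *v u)"
      by (intro mult_right_mono assms) simp
    also have "\<dots> = norm (A *v (wedge z w *\<^sub>R u))"
      by (simp add: matrix_vector_mult_scaleR)
    also have "\<dots> = norm (wedge u w *\<^sub>R (A *v z) + wedge z u *\<^sub>R (A *v w))"
      by (subst Cramer_2) (simp add: matrix_vector_mult_scaleR matrix_vector_right_distrib)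
    also have "\<dots> \<le> \<bar>wedge u w\<bar> * norm (A *v z) + \<bar>wedge z u\<bar> * norm (A *v w)"
      by (rule order_trans[OF norm_triangle_ineq]) simp
    also have "\<dots> \<le> (norm u * R) * ?m + (R * norm u) * ?m"
      using R assms by (intro add_mono mult_mono order_trans[OF abs_wedge_le]) auto
    finally show ?thesis
      using assms(4) by (simp add: field_simps)
  qed
  then have "opnorm A \<le> 2 * R / \<epsilon> * ?m"
    by (rule opnorm_le)
  then show ?thesis
    using assms(4) R by (simp add: field_simps)
qed

text \<open>A large unimodular matrix contracts at most one of three transversal directions, and contracts it at most
  as much as it expands each of the other two.\<close>

lemma sum_ln_norm_ge:
  assumes det: "det A = 1" and R: "norm z1 \<le> R" "norm z2 \<le> R" "norm z3 \<le> R"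
    and \<epsilon>: "0 < \<epsilon>" "\<epsilon> \<le> \<bar>wedge z1 z2\<bar>" "\<epsilon> \<le> \<bar>wedge z2 z3\<bar>" "\<epsilon> \<le> \<bar>wedge z1 z3\<bar>"
  shows "ln (opnorm A) + 3 * ln (\<epsilon> / (2 * R)) \<le> ln (norm (A *v z1)) + ln (norm (A *v z2)) + ln (norm (A *v z3))"
proof -
  let ?q = "\<epsilon> / (2 * R)" and ?n = "opnorm A"
  have n1: "1 \<le> ?n" by (rule opnorm_ge_1[OF det])
  have z0: "z1 \<noteq> 0" "z2 \<noteq> 0" "z3 \<noteq> 0" using \<epsilon> by auto
  then have R0: "0 < R" using R(1) norm_le_zero_iff[of z1] by linarith
  have q0: "0 < ?q" using R0 \<epsilon> by simp
  have pos: "0 < norm (A *v z)" if "z \<noteq> 0" for z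
    using matrix_vector_nonzero[OF det that] by simp
  have low: "ln ?q - ln ?n \<le> ln (norm (A *v z))" if "norm w \<le> R" "\<epsilon> \<le> \<bar>wedge z w\<bar>" "z \<noteq> 0" for z w
  proof -
    have "\<epsilon> \<le> norm z * R"
      using that abs_wedge_le[of z w] by (meson mult_left_mono norm_ge_zero order_trans)
    then have "?q \<le> norm z" using R0 \<epsilon>(1) by (simp add: field_simps)
    also have "\<dots> \<le> ?n * norm (A *v z)" by (rule norm_le_opnorm_inverse[OF det])
    finally have "ln ?q \<le> ln (?n * norm (A *v z))"
      using q0 n1 pos[OF that(3)] by (subst ln_le_cancel_iff) auto
    then show ?thesis
      using n1 pos[OF that(3)] by (simp add: ln_mult)
  qed
  have big: "ln ?q + ln ?n \<le> ln (norm (A *v z)) \<or> ln ?q + ln ?n \<le> ln (norm (A *v w))"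
    if "norm z \<le> R" "norm w \<le> R" "\<epsilon> \<le> \<bar>wedge z w\<bar>" for z w
  proof -
    have nz: "z \<noteq> 0" "w \<noteq> 0" using that \<epsilon> by auto
    have "?q * ?n \<le> norm (A *v z) \<or> ?q * ?n \<le> norm (A *v w)"
      using opnorm_le_two_directions[OF that \<epsilon>(1), of A] by (auto simp: le_max_iff_disj)
    moreover have "ln ?q + ln ?n = ln (?q * ?n)"
      by (subst ln_mult) (use q0 n1 in auto)
    moreover have "0 < ?q * ?n" using q0 n1 by (intro mult_pos_pos) auto
    ultimately show ?thesis
      using pos[OF nz(1)] pos[OF nz(2)] ln_le_cancel_iff by metis
  qed
  have w: "\<epsilon> \<le> \<bar>wedge z2 z1\<bar>" "\<epsilon> \<le> \<bar>wedge z3 z1\<bar>"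
    using \<epsilon> wedge_commute[of z2 z1] wedge_commute[of z3 z1] by auto
  \<comment> \<open>One vector of each pair is expanded, hence at least two of the three. Their
    gains of \<open>ln ?n\<close> outweigh the possible loss of \<open>ln ?n\<close> at the third,
    leaving one gain.\<close>
  show ?thesis
    using low[OF R(2) \<epsilon>(2) z0(1)] low[OF R(1) w(1) z0(2)] low[OF R(1) w(2) z0(3)]
      big[OF R(1,2) \<epsilon>(2)] big[OF R(2,3) \<epsilon>(3)] big[OF R(1,3) \<epsilon>(4)] by linarith
qed

text \<open>Markov's inequality: values above \<open>2 * k / p\<close> on all of \<open>B\<close>
  would give a mean of at least \<open>2 * k\<close>. Thus a small mean is inherited, up to a
  factor, by some letter in any prescribed set of positive probability.\<close>

lemma (in markov_chain) exists_le_of_trans_op_le: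
  assumes "admissible f" "\<And>\<omega>. 0 \<le> f (T \<omega> x)" "B \<in> sets N" "0 < p" "p \<le> prob B" "P f x \<le> k" "0 < k"
  shows "\<exists>\<omega>\<in>B. f (T \<omega> x) \<le> 2 * k / p"
proof (rule ccontr)
  assume "\<not> ?thesis"
  then have gt: "2 * k / p < f (T \<omega> x)" if "\<omega> \<in> B" for \<omega>
    using that by force
  have "2 * k \<le> 2 * k / p * prob B"
    using assms by (simp add: field_simps)
  also have "\<dots> = (\<integral>\<omega>. 2 * k / p * indicator B \<omega> \<partial>N)"
    using assms(3) by simp
  also have "\<dots> \<le> (\<integral>\<omega>. f (T \<omega> x) \<partial>N)"
  proof (rule integral_mono)
    show "integrable N (\<lambda>\<omega>. 2 * k / p * indicator B \<omega>)"
      using assms(3) by (intro integrable_mult_right integrable_real_indicator) (auto simp: emeasure_eq_measure)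
    show "integrable N (\<lambda>\<omega>. f (T \<omega> x))" by (rule integrable_step[OF assms(1)])
    show "2 * k / p * indicator B \<omega> \<le> f (T \<omega> x)" for \<omega>
      using gt[of \<omega>] assms(2)[of \<omega>] by (cases "\<omega> \<in> B") auto
  qed
  also have "\<dots> \<le> k"
    using assms(6) by (simp add: trans_op_def)
  finally show False using assms(7) by simp
qed

context sl2_walk
begin

lemma expansion_scale:
  assumes "c \<noteq> 0" "x \<noteq> 0"
  shows "expansion N G n (c *\<^sub>R x) = expansion N G n x"
proof -
  have "exp_log N G n (c *\<^sub>R x) = (vec.P ^^ n) (\<lambda>x. 1 * ln (norm x) + ln \<bar>c\<bar>) x"
    unfolding exp_log_def using assms
    by (intro trans_op_semiconj_on[where S = "{x. x \<noteq> 0}" and \<phi> = "\<lambda>x. c *\<^sub>R x", symmetric])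
      (auto simp: step_nonzero matrix_vector_mult_scaleR ln_mult)
  also have "\<dots> = 1 * exp_log N G n x + ln \<bar>c\<bar>"
    unfolding exp_log_def by (rule vec.funpow_affine[OF admissible_ln_norm])
  finally show ?thesis
    using assms by (simp add: expansion_def ln_mult)
qed

text \<open>The deterministic bound for three transversal vectors, averaged over the random product
  started at the identity.\<close>

lemma exp_log_sum_ge:
  assumes R: "norm z1 \<le> R" "norm z2 \<le> R" "norm z3 \<le> R"
    and \<epsilon>: "0 < \<epsilon>" "\<epsilon> \<le> \<bar>wedge z1 z2\<bar>" "\<epsilon> \<le> \<bar>wedge z2 z3\<bar>" "\<epsilon> \<le> \<bar>wedge z1 z3\<bar>"
  shows "exp_log_opnorm N G n (mat 1) + 3 * ln (\<epsilon> / (2 * R))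
    \<le> exp_log N G n z1 + exp_log N G n z2 + exp_log N G n z3"
proof -
  define g where "g z A = (if det A = 1 then ln (norm (A *v z)) else 0)" for z :: "real^2" and A :: "real^2^2"
  have z0: "z1 \<noteq> 0" "z2 \<noteq> 0" "z3 \<noteq> 0" using \<epsilon> by auto
  have g_adm: "mat.admissible (g z)" if "z \<noteq> 0" for z
  proof (rule mat.admissibleI)
    note [measurable] = det_measurable
    have [measurable]: "(\<lambda>B :: real^2^2. B *v z) \<in> borel \<rightarrow>\<^sub>M borel"
      by (intro matrix_vector_measurable) auto
    show "g z \<in> borel_measurable borel"
      unfolding g_def[abs_def] by measurable
    have "\<bar>g z A\<bar> \<le> \<bar>ln (opnorm A)\<bar> + \<bar>ln (norm z)\<bar>" for A
    proof (cases "det A = 1")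
      case True
      have 1: "1 \<le> opnorm A" by (rule opnorm_ge_1[OF True])
      have pos: "0 < norm z" "0 < norm (A *v z)"
        using that matrix_vector_nonzero[OF True that] by auto
      have "ln (norm (A *v z)) \<le> ln (opnorm A * norm z)" "ln (norm z) \<le> ln (opnorm A * norm (A *v z))"
        using norm_le_opnorm[of A z] norm_le_opnorm_inverse[OF True, of z] pos 1 by auto
      then show ?thesis
        using pos 1 True by (simp add: g_def ln_mult)
    qed (simp add: g_def)
    then show "\<exists>B. \<forall>A. \<bar>ln (opnorm A)\<bar> \<le> r \<longrightarrow> \<bar>g z A\<bar> \<le> B" for r
      by (meson add_right_mono order_trans)
  qed
  have adm12: "mat.admissible (\<lambda>A. 1 * g z1 A + 1 * g z2 A + 0)"
    by (intro mat.admissible_add mat.admissible_cmult mat.admissible_const g_adm z0)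
  have adm123: "mat.admissible (\<lambda>A. 1 * (1 * g z1 A + 1 * g z2 A + 0) + 1 * g z3 A + 0)"
    by (intro mat.admissible_add mat.admissible_cmult mat.admissible_const g_adm z0)
  have adm0: "mat.admissible (\<lambda>A. 1 * ln (opnorm A) + 3 * ln (\<epsilon> / (2 * R)))"
    by (intro mat.admissible_add mat.admissible_cmult mat.admissible_const admissible_ln_opnorm)
  have g_exp: "(mat.P ^^ n) (g z) (mat 1) = exp_log N G n z" for z
    unfolding exp_log_def
    by (subst trans_op_semiconj_on[where S = "{A. det A = 1}" and \<phi> = "\<lambda>A. A *v z" and f = "\<lambda>x. ln (norm x)"
          and T' = "\<lambda>\<omega> x. G \<omega> *v x"])
      (auto simp: det_step g_def matrix_vector_mul_assoc)
  have "(mat.P ^^ n) (\<lambda>A. 1 * ln (opnorm A) + 3 * ln (\<epsilon> / (2 * R))) (mat 1)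
      \<le> (mat.P ^^ n) (\<lambda>A. 1 * (1 * g z1 A + 1 * g z2 A + 0) + 1 * g z3 A + 0) (mat 1)"
  proof (rule mat.funpow_mono_inv[OF adm0 adm123, where S = "{A. det A = 1}"])
    fix A :: "real^2^2" assume "A \<in> {A. det A = 1}"
    then show "1 * ln (opnorm A) + 3 * ln (\<epsilon> / (2 * R)) \<le> 1 * (1 * g z1 A + 1 * g z2 A + 0) + 1 * g z3 A + 0"
      using sum_ln_norm_ge[OF _ assms, of A] by (simp add: g_def)
  qed (use det_step in auto)
  also have "\<dots> = 1 * (mat.P ^^ n) (\<lambda>A. 1 * g z1 A + 1 * g z2 A + 0) (mat 1) + 1 * (mat.P ^^ n) (g z3) (mat 1) + 0"
    by (rule mat.funpow_lincomb[OF adm12 g_adm[OF z0(3)]])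
  also have "(mat.P ^^ n) (\<lambda>A. 1 * g z1 A + 1 * g z2 A + 0) (mat 1)
      = 1 * (mat.P ^^ n) (g z1) (mat 1) + 1 * (mat.P ^^ n) (g z2) (mat 1) + 0"
    by (rule mat.funpow_lincomb[OF g_adm[OF z0(1)] g_adm[OF z0(2)]])
  also have "(mat.P ^^ n) (\<lambda>A. 1 * ln (opnorm A) + 3 * ln (\<epsilon> / (2 * R))) (mat 1)
      = 1 * exp_log_opnorm N G n (mat 1) + 3 * ln (\<epsilon> / (2 * R))"
    unfolding exp_log_opnorm_def by (rule mat.funpow_affine[OF admissible_ln_opnorm])
  finally show ?thesis by (simp add: g_exp)
qed

end

lemma transfer_matrix_vec:
  "(transfer_matrix E s *v x) $ 1 = (s - E) * x $ 1 - x $ 2" "(transfer_matrix E s *v x) $ 2 = x $ 1"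
  by (simp_all add: matrix_vector_2 transfer_matrix_def)

lemma wedge_transfer_1:
  "wedge (transfer_matrix E s *v x) (transfer_matrix E t *v x) = (s - t) * (x $ 1)\<^sup>2"
  by (simp add: wedge_def transfer_matrix_vec power2_eq_square algebra_simps)

lemma wedge_transfer_2:
  "wedge (transfer_matrix E d *v (transfer_matrix E c *v x)) (transfer_matrix E d' *v (transfer_matrix E c' *v x))
    = (d - d') * ((transfer_matrix E c *v x) $ 1 * (transfer_matrix E c' *v x) $ 1) + (c - c') * (x $ 1)\<^sup>2"
  by (simp add: wedge_def transfer_matrix_vec power2_eq_square algebra_simps)


text \<open>Letters of a word are drawn from two small disjoint intervals. Of the four images of \<open>y\<close> under words of
  length two, three are pairwise transversal; which three depends on the sign of the product of the
  first coordinates of the two images under a single letter.\<close>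

lemma transversal_triple:
  fixes y1 p q :: real
  assumes \<tau>: "0 < \<tau>" "\<rho> \<le> \<bar>y1\<bar>" "0 < \<rho>" "\<bar>p\<bar> \<le> Q" "\<bar>q\<bar> \<le> Q" "2 * \<eta> * (Q * Q) \<le> \<tau> * \<rho>\<^sup>2 / 2"
    and pq: "q - p = (cb - ca) * y1" and cd: "\<tau> \<le> cb - ca" "\<tau> \<le> dab - daa" "\<tau> \<le> dbb - dba" "\<tau> \<le> dab - dba" "\<tau> \<le> dbb - daa"
    and near: "\<bar>daa - dba\<bar> \<le> 2 * \<eta>" "\<bar>dab - dbb\<bar> \<le> 2 * \<eta>"
  defines "\<epsilon> \<equiv> min (\<tau> * (\<tau> * \<rho> / 2)\<^sup>2) (\<tau> * \<rho>\<^sup>2 / 2)"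
  shows "0 < \<epsilon>"
    and "\<epsilon> \<le> \<bar>(daa - dab) * p\<^sup>2\<bar> \<or> \<epsilon> \<le> \<bar>(dba - dbb) * q\<^sup>2\<bar>"
    and "\<epsilon> \<le> \<bar>(daa - dba) * (p * q) + (ca - cb) * y1\<^sup>2\<bar>"
    and "\<epsilon> \<le> \<bar>(dab - dbb) * (p * q) + (ca - cb) * y1\<^sup>2\<bar>"
    and "\<epsilon> \<le> \<bar>(dab - dba) * (p * q) + (ca - cb) * y1\<^sup>2\<bar> \<or> \<epsilon> \<le> \<bar>(daa - dbb) * (p * q) + (ca - cb) * y1\<^sup>2\<bar>"
proof -
  show "0 < \<epsilon>" using \<tau> by (simp add: \<epsilon>_def)
  have e1: "\<epsilon> \<le> \<tau> * (\<tau> * \<rho> / 2)\<^sup>2" and e2: "\<epsilon> \<le> \<tau> * \<rho>\<^sup>2 / 2"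
    by (simp_all add: \<epsilon>_def)
  have y2: "\<rho>\<^sup>2 \<le> y1\<^sup>2"
    using power_mono[OF \<tau>(2), of 2] \<tau> by simp
  have c: "\<tau> * \<rho>\<^sup>2 \<le> (cb - ca) * y1\<^sup>2"
    using \<tau> cd y2 by (intro mult_mono) auto
  \<comment> \<open>The first coordinates \<open>p\<close> and \<open>q\<close> cannot both be
    small; the larger one separates the two images with that first letter.\<close>
  have "\<tau> * \<rho> \<le> \<bar>q - p\<bar>"
    unfolding pq abs_mult using \<tau> cd by (intro mult_mono) auto
  then have "\<tau> * \<rho> / 2 \<le> \<bar>p\<bar> \<or> \<tau> * \<rho> / 2 \<le> \<bar>q\<bar>" by linarith
  moreover have "\<epsilon> \<le> \<bar>(d - d') * t\<^sup>2\<bar>" if "\<tau> * \<rho> / 2 \<le> \<bar>t\<bar>" "\<tau> \<le> d' - d" for t d d' :: real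
  proof -
    have "(\<tau> * \<rho> / 2)\<^sup>2 \<le> t\<^sup>2"
      using power_mono[OF that(1), of 2] \<tau> by simp
    then have "\<tau> * (\<tau> * \<rho> / 2)\<^sup>2 \<le> (d' - d) * t\<^sup>2"
      using \<tau> that by (intro mult_mono) auto
    also have "\<dots> \<le> \<bar>(d - d') * t\<^sup>2\<bar>"
      using that \<tau> by (simp add: abs_mult)
    finally show ?thesis using e1 by simp
  qed
  ultimately show "\<epsilon> \<le> \<bar>(daa - dab) * p\<^sup>2\<bar> \<or> \<epsilon> \<le> \<bar>(dba - dbb) * q\<^sup>2\<bar>"
    using cd by blast
  \<comment> \<open>For last letters from the same interval the first summand is too small to cancel
    the second.\<close>
  have near_le: "\<epsilon> \<le> \<bar>d * (p * q) + (ca - cb) * y1\<^sup>2\<bar>" if "\<bar>d\<bar> \<le> 2 * \<eta>" for d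
  proof -
    have "\<bar>d * (p * q)\<bar> \<le> 2 * \<eta> * (Q * Q)"
      unfolding abs_mult using that \<tau> by (intro mult_mono) auto
    then have "\<bar>d * (p * q)\<bar> \<le> \<tau> * \<rho>\<^sup>2 / 2" using \<tau> by linarith
    moreover have "(ca - cb) * y1\<^sup>2 = - ((cb - ca) * y1\<^sup>2)" by (simp add: algebra_simps)
    ultimately show ?thesis using c e2 by linarith
  qed
  show "\<epsilon> \<le> \<bar>(daa - dba) * (p * q) + (ca - cb) * y1\<^sup>2\<bar>" "\<epsilon> \<le> \<bar>(dab - dbb) * (p * q) + (ca - cb) * y1\<^sup>2\<bar>"
    using near near_le by auto
  \<comment> \<open>Here both summands are nonpositive, so nothing cancels.\<close>
  have far: "\<epsilon> \<le> \<bar>d * (p * q) + (ca - cb) * y1\<^sup>2\<bar>" if "d * (p * q) \<le> 0" for d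
  proof -
    have "(ca - cb) * y1\<^sup>2 = - ((cb - ca) * y1\<^sup>2)" by (simp add: algebra_simps)
    moreover have "0 \<le> \<tau> * \<rho>\<^sup>2" using \<tau> by simp
    ultimately show ?thesis using that c e2 by linarith
  qed
  show "\<epsilon> \<le> \<bar>(dab - dba) * (p * q) + (ca - cb) * y1\<^sup>2\<bar> \<or> \<epsilon> \<le> \<bar>(daa - dbb) * (p * q) + (ca - cb) * y1\<^sup>2\<bar>"
  proof (cases "p * q \<le> 0")
    case True
    then show ?thesis using far[of "dab - dba"] cd \<tau> by (simp add: mult_nonneg_nonpos)
  next
    case False
    then show ?thesis using far[of "daa - dbb"] cd \<tau> by (simp add: mult_nonpos_nonneg)
  qed
qed

context schrodinger_walk
begin

lemma abs_potential_le: "\<bar>v \<omega> - E\<bar> \<le> M"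
proof -
  have "\<bar>v \<omega> - E\<bar> = \<bar>(G \<omega> *v axis 1 1) $ 1\<bar>"
    unfolding G_eq transfer_matrix_vec by (simp add: axis_def)
  also have "\<dots> \<le> norm (G \<omega> *v axis 1 1)" by (rule component_le_norm_cart)
  also have "\<dots> \<le> M" using norm_step_le[of \<omega> "axis 1 1"] by simp
  finally show ?thesis .
qed

text \<open>The image has first coordinate \<open>(v \<omega> - E) * x $ 1 - x $ 2\<close>. If
  \<open>x $ 1\<close> is small, the other coordinate makes this large for any letter; otherwise two
  separated potentials give well separated values. The transversality bounds need such a lower
  bound, since their main term contains the squared first coordinate.\<close>

lemma exists_large_first_coordinate:
  assumes "norm x = 1" "0 < \<tau>" "\<tau> \<le> v \<omega>' - v \<omega>"
  shows "min (1 / 2) (\<tau> / (4 * (M + 1))) \<le> \<bar>(G \<omega> *v x) $ 1\<bar> \<or> min (1 / 2) (\<tau> / (4 * (M + 1))) \<le> \<bar>(G \<omega>' *v x) $ 1\<bar>"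
proof (cases "\<bar>x $ 1\<bar> < 1 / (2 * (M + 1))")
  case True
  have M: "1 \<le> M" by (rule M_ge_1)
  have "1 \<le> \<bar>x $ 1\<bar> + \<bar>x $ 2\<bar>"
    using norm_le_l1_cart[of x] assms(1) by (simp add: sum_2)
  moreover have "\<bar>(v \<omega> - E) * x $ 1\<bar> \<le> M * \<bar>x $ 1\<bar>"
    unfolding abs_mult by (intro mult_right_mono abs_potential_le) simp
  moreover have "(M + 1) * \<bar>x $ 1\<bar> \<le> 1 / 2"
    using True M by (simp add: field_simps)
  ultimately have "1 / 2 \<le> \<bar>(G \<omega> *v x) $ 1\<bar>"
    unfolding G_eq transfer_matrix_vec distrib_right by linarith
  then show ?thesis by linarith
next
  case False
  have M: "1 \<le> M" by (rule M_ge_1)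
  have "\<tau> * (1 / (2 * (M + 1))) \<le> (v \<omega>' - v \<omega>) * \<bar>x $ 1\<bar>"
    using False assms M by (intro mult_mono) auto
  also have "\<dots> = \<bar>(v \<omega>' - v \<omega>) * x $ 1\<bar>"
    using assms by (simp add: abs_mult)
  also have "(v \<omega>' - v \<omega>) * x $ 1 = (G \<omega>' *v x) $ 1 - (G \<omega> *v x) $ 1"
    unfolding G_eq transfer_matrix_vec by (simp add: algebra_simps)
  finally have "\<tau> * (1 / (2 * (M + 1))) \<le> \<bar>(G \<omega>' *v x) $ 1 - (G \<omega> *v x) $ 1\<bar>" .
  moreover have "\<tau> * (1 / (2 * (M + 1))) = 2 * (\<tau> / (4 * (M + 1)))"
    using M by (simp add: divide_simps)
  ultimately have "2 * (\<tau> / (4 * (M + 1))) \<le> \<bar>(G \<omega>' *v x) $ 1 - (G \<omega> *v x) $ 1\<bar>"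
    by simp
  then have "\<tau> / (4 * (M + 1)) \<le> \<bar>(G \<omega> *v x) $ 1\<bar> \<or> \<tau> / (4 * (M + 1)) \<le> \<bar>(G \<omega>' *v x) $ 1\<bar>"
    by linarith
  then show ?thesis by linarith
qed

text \<open>At a near-minimum of the expansion, the expansion after three letters is close to its infimum along every
  word of non-negligible probability, in particular at three transversal vectors, so the infimum is at least
  about a third of the expected log-norm.\<close>

lemma expansion_positive: "\<exists>n c. 0 < c \<and> (\<forall>x. x \<noteq> 0 \<longrightarrow> c \<le> expansion N G n x)"
proof -
  have M: "1 \<le> M" by (rule M_ge_1)
  have lnM: "0 \<le> ln M" using M by simp
  define \<tau> where "\<tau> = (b - a) / 2"
  have \<tau>: "0 < \<tau>" using a_less_b by (simp add: \<tau>_def)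
  define \<rho> where "\<rho> = min (1 / 2) (\<tau> / (4 * (M + 1)))"
  have \<rho>: "0 < \<rho>" using \<tau> M by (simp add: \<rho>_def)
  define Q where "Q = M * M"
  have Q: "1 \<le> Q" using M mult_mono[of 1 M 1 M] by (simp add: Q_def)
  \<comment> \<open>The first bound keeps the intervals around \<open>a\<close> and \<open>b\<close>
    at distance \<tau>, the second makes letters from one interval interchangeable in the area
    formulas.\<close>
  define \<eta> where "\<eta> = min (\<tau> / 2) (\<tau> * \<rho>\<^sup>2 / (4 * (Q * Q)))"
  have \<eta>: "0 < \<eta>" "\<eta> \<le> \<tau> / 2" using \<tau> \<rho> Q by (simp_all add: \<eta>_def)
  have "2 * \<eta> * (Q * Q) \<le> 2 * (\<tau> * \<rho>\<^sup>2 / (4 * (Q * Q))) * (Q * Q)"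
    using Q by (intro mult_right_mono mult_left_mono) (auto simp: \<eta>_def)
  also have "\<dots> = \<tau> * \<rho>\<^sup>2 / 2" using Q by (simp add: field_simps)
  finally have \<eta>Q: "2 * \<eta> * (Q * Q) \<le> \<tau> * \<rho>\<^sup>2 / 2" .
  define \<epsilon> where "\<epsilon> = min (\<tau> * (\<tau> * \<rho> / 2)\<^sup>2) (\<tau> * \<rho>\<^sup>2 / 2)"
  define R where "R = M * Q"
  have R: "0 < R" using M Q by (simp add: R_def)
  define A where "A s = {\<omega> \<in> space N. \<bar>v \<omega> - s\<bar> < \<eta>}" for s
  define p where "p = min (prob (A a)) (prob (A b))"
  have p: "0 < p" "p \<le> prob (A a)" "p \<le> prob (A b)"
    using supp[of a \<eta>] supp[of b \<eta>] \<eta> by (auto simp: p_def A_def)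
  have A: "A s \<in> sets N" for s
    unfolding A_def by (rule near_sets)
  have A_far: "\<tau> \<le> v \<omega>' - v \<omega>" if "\<omega> \<in> A a" "\<omega>' \<in> A b" for \<omega> \<omega>'
    using that \<eta>(2) by (auto simp: A_def \<tau>_def)
  have A_near: "\<bar>v \<omega> - v \<omega>'\<bar> \<le> 2 * \<eta>" if "\<omega> \<in> A s" "\<omega>' \<in> A s" for \<omega> \<omega>' s
    using that by (auto simp: A_def)
  \<comment> \<open>In \<open>k0\<close>, the 1 allows for a near-minimum, \<open>3 * ln M\<close>
    for the expansion of three letters and another \<open>3 * ln M\<close> for the longer time. Each
    chosen letter then costs a factor \<open>2 / p\<close>.\<close>
  define k0 where "k0 = 1 + 6 * ln M"
  define k1 where "k1 = 2 * k0 / p"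
  define k2 where "k2 = 2 * k1 / p"
  define k3 where "k3 = 2 * k2 / p"
  have k: "0 < k0" "0 < k1" "0 < k2" using lnM p by (simp_all add: k0_def k1_def k2_def)
  \<comment> \<open>All constants so far are independent of \<open>n\<close>, so the log-norm can
    now be made to dominate them.\<close>
  obtain n where n: "3 * k3 + 3 * ln R - 3 * ln (\<epsilon> / (2 * R)) < exp_log_opnorm N G n (mat 1)"
    using exp_log_opnorm_unbounded by blast
  define l where "l = Inf (expansion N G n ` {x. x \<noteq> 0})"
  have bdd: "bdd_below (expansion N G n ` {x. x \<noteq> 0})"
  proof (rule bdd_belowI2)
    show "- (real n * ln M) \<le> expansion N G n x" for x
      using abs_expansion_le[of n x] by linarith
  qed
  have l_le: "l \<le> expansion N G n x" if "x \<noteq> 0" for x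
    unfolding l_def using that bdd by (intro cInf_lower) auto
  have "{x :: real^2. x \<noteq> 0} \<noteq> {}"
    using axis_eq_0_iff[of "1 :: 2" "1 :: real"] by blast
  then have "\<exists>x. x \<noteq> 0 \<and> expansion N G n x < l + 1"
    using cInf_lessD[of "expansion N G n ` {x. x \<noteq> 0}" "l + 1"] by (auto simp: l_def)
  then obtain x0 where x0: "x0 \<noteq> 0" "expansion N G n x0 < l + 1" by blast
  define x where "x = (1 / norm x0) *\<^sub>R x0"
  have x: "norm x = 1" "expansion N G n x < l + 1"
    using x0 by (simp_all add: x_def expansion_scale)
  have xn: "x \<noteq> 0" using x by auto
  \<comment> \<open>The mean excess of the expansion over its infimum after \<open>j\<close>
    letters; it is nonnegative, so Markov's inequality applies at every letter.\<close>
  define F where "F j = (vec.P ^^ j) (\<lambda>y. 1 * expansion N G n y + (- l))" for j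
  have F_adm: "vec.admissible (F j)" for j
    unfolding F_def
    by (intro vec.admissible_funpow vec.admissible_add vec.admissible_cmult vec.admissible_const admissible_expansion)
  have F_Suc: "F (Suc j) = vec.P (F j)" for j by (simp add: F_def)
  have F0: "F 0 y = expansion N G n y - l" for y by (simp add: F_def)
  have F_nonneg: "0 \<le> F j y" if "y \<noteq> 0" for j y
  proof -
    have "(vec.P ^^ j) (\<lambda>_. 0) y \<le> F j y"
      unfolding F_def
      by (rule vec.funpow_mono_inv[where S = "{x. x \<noteq> 0}"])
        (use that l_le F_adm[of 0] in \<open>auto simp: F_def step_nonzero\<close>)
    then show ?thesis by (simp add: vec.funpow_const)
  qed
  have "F 3 x \<le> k0"
  proof -
    have "F 3 x = 1 * (vec.P ^^ 3) (expansion N G n) x + (- l)"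
      unfolding F_def by (rule vec.funpow_affine[OF admissible_expansion])
    moreover have "expansion N G (3 + n) x = (vec.P ^^ 3) (expansion N G n) x + expansion N G 3 x"
      by (rule expansion_add)
    moreover have "\<bar>expansion N G 3 x\<bar> \<le> 3 * ln M"
      using abs_expansion_le[of 3 x] by simp
    moreover have "expansion N G (3 + n) x \<le> expansion N G n x + 3 * ln M"
      using exp_log_time_le[of n 3 x] by (simp add: expansion_def add.commute abs_le_iff)
    ultimately show ?thesis using x(2) by (simp add: k0_def)
  qed
  then have F3: "vec.P (F 2) x \<le> k0" by (simp add: numeral_3_eq_3 numeral_2_eq_2 F_Suc)
  have letter: "\<exists>\<omega>\<in>A s. F j (G \<omega> *v y) \<le> 2 * k / p"
    if "y \<noteq> 0" "F (Suc j) y \<le> k" "0 < k" "s \<in> {a, b}" for j y k s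
    using that p F_nonneg step_nonzero unfolding F_Suc
    by (intro vec.exists_le_of_trans_op_le[OF F_adm] A) auto
  have F3': "F (Suc (Suc (Suc 0))) x \<le> k0" using F3 by (simp add: numeral_2_eq_2 F_Suc)
  obtain \<omega>1 \<omega>2 where "\<omega>1 \<in> A a" "F (Suc (Suc 0)) (G \<omega>1 *v x) \<le> k1" "\<omega>2 \<in> A b" "F (Suc (Suc 0)) (G \<omega>2 *v x) \<le> k1"
    using letter[OF xn F3' k(1), of a] letter[OF xn F3' k(1), of b] unfolding k1_def by blast
  \<comment> \<open>The first of the three letters only serves to obtain a large first coordinate;
    the other two create the four images.\<close>
  then obtain \<omega>0 where \<omega>0: "F (Suc (Suc 0)) (G \<omega>0 *v x) \<le> k1" "\<rho> \<le> \<bar>(G \<omega>0 *v x) $ 1\<bar>"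
    using exists_large_first_coordinate[OF x(1) \<tau> A_far[of \<omega>1 \<omega>2]] unfolding \<rho>_def by blast
  define y where "y = G \<omega>0 *v x"
  have y: "y \<noteq> 0" "norm y \<le> M" "F (Suc (Suc 0)) y \<le> k1" "\<rho> \<le> \<bar>y $ 1\<bar>"
    using \<omega>0 step_nonzero[OF xn] norm_step_le[of \<omega>0 x] x(1) by (simp_all add: y_def)
  obtain \<alpha> \<beta> where \<alpha>: "\<alpha> \<in> A a" "F (Suc 0) (G \<alpha> *v y) \<le> k2" and \<beta>: "\<beta> \<in> A b" "F (Suc 0) (G \<beta> *v y) \<le> k2"
    using letter[OF y(1,3) k(2), of a] letter[OF y(1,3) k(2), of b] unfolding k2_def by blast
  define ya where "ya = G \<alpha> *v y"
  define yb where "yb = G \<beta> *v y"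
  have step_le: "norm (G \<omega> *v y) \<le> Q" for \<omega>
    using norm_step_le[of \<omega> y] mult_left_mono[OF y(2), of M] M unfolding Q_def by linarith
  have ya: "ya \<noteq> 0" "norm ya \<le> Q" "F (Suc 0) ya \<le> k2" and yb: "yb \<noteq> 0" "norm yb \<le> Q" "F (Suc 0) yb \<le> k2"
    using \<alpha> \<beta> y(1) step_le by (simp_all add: ya_def yb_def step_nonzero)
  obtain \<alpha>\<alpha> \<alpha>\<beta> where aa: "\<alpha>\<alpha> \<in> A a" "F 0 (G \<alpha>\<alpha> *v ya) \<le> k3" and ab: "\<alpha>\<beta> \<in> A b" "F 0 (G \<alpha>\<beta> *v ya) \<le> k3"
    using letter[OF ya(1,3) k(3), of a] letter[OF ya(1,3) k(3), of b] unfolding k3_def by blast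
  obtain \<beta>\<alpha> \<beta>\<beta> where ba: "\<beta>\<alpha> \<in> A a" "F 0 (G \<beta>\<alpha> *v yb) \<le> k3" and bb: "\<beta>\<beta> \<in> A b" "F 0 (G \<beta>\<beta> *v yb) \<le> k3"
    using letter[OF yb(1,3) k(3), of a] letter[OF yb(1,3) k(3), of b] unfolding k3_def by blast
  define good where "good z \<longleftrightarrow> z \<noteq> 0 \<and> norm z \<le> R \<and> expansion N G n z \<le> l + k3" for z
  have good: "good (G \<omega> *v z)" if "z \<noteq> 0" "norm z \<le> Q" "F 0 (G \<omega> *v z) \<le> k3" for \<omega> z
  proof -
    have "norm (G \<omega> *v z) \<le> R"
      using norm_step_le[of \<omega> z] M mult_left_mono[OF that(2), of M] unfolding R_def by linarith
    then show ?thesis using that step_nonzero by (simp add: good_def F0)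
  qed
  let ?zaa = "G \<alpha>\<alpha> *v ya" and ?zab = "G \<alpha>\<beta> *v ya" and ?zba = "G \<beta>\<alpha> *v yb" and ?zbb = "G \<beta>\<beta> *v yb"
  have good_z: "good ?zaa" "good ?zab" "good ?zba" "good ?zbb"
    using good[OF ya(1,2) aa(2)] good[OF ya(1,2) ab(2)] good[OF yb(1,2) ba(2)] good[OF yb(1,2) bb(2)] by auto
  have p_le: "\<bar>ya $ 1\<bar> \<le> Q" "\<bar>yb $ 1\<bar> \<le> Q"
    using ya(2) yb(2) component_le_norm_cart[of ya 1] component_le_norm_cart[of yb 1] by linarith+
  have pq: "yb $ 1 - ya $ 1 = (v \<beta> - v \<alpha>) * y $ 1"
    unfolding ya_def yb_def G_eq transfer_matrix_vec by (simp add: algebra_simps)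
  have wedges:
    "wedge ?zaa ?zab = (v \<alpha>\<alpha> - v \<alpha>\<beta>) * (ya $ 1)\<^sup>2"
    "wedge ?zba ?zbb = (v \<beta>\<alpha> - v \<beta>\<beta>) * (yb $ 1)\<^sup>2"
    "wedge ?zaa ?zba = (v \<alpha>\<alpha> - v \<beta>\<alpha>) * (ya $ 1 * yb $ 1) + (v \<alpha> - v \<beta>) * (y $ 1)\<^sup>2"
    "wedge ?zab ?zbb = (v \<alpha>\<beta> - v \<beta>\<beta>) * (ya $ 1 * yb $ 1) + (v \<alpha> - v \<beta>) * (y $ 1)\<^sup>2"
    "wedge ?zab ?zba = (v \<alpha>\<beta> - v \<beta>\<alpha>) * (ya $ 1 * yb $ 1) + (v \<alpha> - v \<beta>) * (y $ 1)\<^sup>2"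
    "wedge ?zaa ?zbb = (v \<alpha>\<alpha> - v \<beta>\<beta>) * (ya $ 1 * yb $ 1) + (v \<alpha> - v \<beta>) * (y $ 1)\<^sup>2"
    unfolding ya_def yb_def G_eq wedge_transfer_1 wedge_transfer_2 by simp_all
  note trans = transversal_triple[OF \<tau> y(4) \<rho> p_le \<eta>Q pq A_far[OF \<alpha>(1) \<beta>(1)] A_far[OF aa(1) ab(1)]
      A_far[OF ba(1) bb(1)] A_far[OF ba(1) ab(1)] A_far[OF aa(1) bb(1)] A_near[OF aa(1) ba(1)] A_near[OF ab(1) bb(1)],
      folded \<epsilon>_def wedges]
  \<comment> \<open>The three log-norms exceed \<open>3 * l\<close> by at most the constants
    absorbed in the choice of \<open>n\<close>, while their sum is bounded below by the
    log-norm.\<close>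
  have conclude: "0 < l" if "good z1" "good z2" "good z3" "\<epsilon> \<le> \<bar>wedge z1 z2\<bar>" "\<epsilon> \<le> \<bar>wedge z2 z3\<bar>" "\<epsilon> \<le> \<bar>wedge z1 z3\<bar>" for z1 z2 z3
  proof -
    have "exp_log_opnorm N G n (mat 1) + 3 * ln (\<epsilon> / (2 * R)) \<le> exp_log N G n z1 + exp_log N G n z2 + exp_log N G n z3"
      by (rule exp_log_sum_ge) (use that trans(1) in \<open>auto simp: good_def\<close>)
    moreover have "exp_log N G n z \<le> l + k3 + ln R" if "good z" for z
    proof -
      have "ln (norm z) \<le> ln R" using that R by (subst ln_le_cancel_iff) (auto simp: good_def)
      then show ?thesis using that by (simp add: good_def expansion_def)
    qed
    ultimately show ?thesis using that(1-3) n by (smt (verit))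
  qed
  have "0 < l"
    using trans(2)
  proof
    assume 1: "\<epsilon> \<le> \<bar>wedge ?zaa ?zab\<bar>"
    from trans(5) show ?thesis
    proof
      assume "\<epsilon> \<le> \<bar>wedge ?zab ?zba\<bar>"
      then show ?thesis using conclude[of ?zaa ?zab ?zba] good_z 1 trans(3) by blast
    next
      assume "\<epsilon> \<le> \<bar>wedge ?zaa ?zbb\<bar>"
      then show ?thesis using conclude[of ?zaa ?zab ?zbb] good_z 1 trans(4) by blast
    qed
  next
    assume 1: "\<epsilon> \<le> \<bar>wedge ?zba ?zbb\<bar>"
    from trans(5) show ?thesis
    proof
      assume "\<epsilon> \<le> \<bar>wedge ?zab ?zba\<bar>"
      then show ?thesis using conclude[of ?zab ?zba ?zbb] good_z 1 trans(4) by blast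
    next
      assume "\<epsilon> \<le> \<bar>wedge ?zaa ?zbb\<bar>"
      then show ?thesis using conclude[of ?zaa ?zba ?zbb] good_z 1 trans(3) by blast
    qed
  qed
  then show ?thesis using l_le by blast
qed

end

section \<open>Measures with compact support and couplings\<close>

text \<open>Every point outside the support lies in a basic open set of measure 0, and a countable
  basis has only countably many of them.\<close>

lemma AE_msupport:
  fixes N :: "'a::second_countable_topology measure"
  assumes sets: "\<And>U. open U \<Longrightarrow> U \<inter> space N \<in> sets N"
  shows "AE x in N. x \<in> msupport N"
proof -
  obtain B :: "'a set set" where B: "countable B" "topological_basis B"
    using ex_countable_basis by blast
  define B0 where "B0 = {U \<in> B. emeasure N (U \<inter> space N) = 0}"
  have op: "open U" if "U \<in> B" for U
    using B(2) that by (rule topological_basis_open)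
  have "(\<Union>U\<in>B0. U \<inter> space N) \<in> null_sets N"
    using B(1) sets op by (intro null_sets_UN') (auto simp: B0_def)
  then have "AE x in N. x \<notin> (\<Union>U\<in>B0. U \<inter> space N)"
    by (rule AE_not_in)
  moreover have "x \<in> msupport N" if x: "x \<in> space N" "x \<notin> (\<Union>U\<in>B0. U \<inter> space N)" for x
  proof (rule ccontr)
    assume "x \<notin> msupport N"
    then obtain U where U: "open U" "x \<in> U" "emeasure N (U \<inter> space N) = 0"
      using x(1) by (auto simp: msupport_def)
    obtain W where W: "W \<in> B" "x \<in> W" "W \<subseteq> U"
      using topological_basisE[OF B(2) U(1,2)] by blast
    have "emeasure N (W \<inter> space N) \<le> emeasure N (U \<inter> space N)"
      using W sets[OF U(1)] by (intro emeasure_mono) auto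
    then show False
      using U(3) W x by (auto simp: B0_def)
  qed
  moreover have "AE x in N. x \<in> space N" by (rule AE_space)
  ultimately show ?thesis by (auto elim: eventually_elim2)
qed

lemma borel_prob_SL2_AE:
  assumes "borel_prob_SL2 \<nu>" "msupport \<nu> \<subseteq> K"
  shows "AE g in \<nu>. g \<in> K"
proof -
  have s: "sets \<nu> = sets SL2_borel" using assms by (simp add: borel_prob_SL2_def)
  have "U \<inter> space \<nu> \<in> sets \<nu>" if "open U" for U
    using that unfolding s sets_eq_imp_space_eq[OF s] by (auto simp: sets_restrict_space space_restrict_space)
  then have "AE g in \<nu>. g \<in> msupport \<nu>" by (rule AE_msupport)
  then show ?thesis using assms(2) by (auto elim: eventually_mono)
qed

text \<open>The expected growth depends only on the law of the matrices; this identifies the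
  marginals of a coupled walk with the original walks.\<close>

lemma exp_log_distr:
  assumes "sl2_walk N' G M" "p \<in> N \<rightarrow>\<^sub>M N'" "distr N N' p = N'"
  shows "exp_log N (\<lambda>\<omega>. G (p \<omega>)) n = exp_log N' G n"
proof (induction n)
  case (Suc n)
  interpret sl2_walk N' G M by fact
  show ?case
  proof
    fix x
    have "exp_log N (\<lambda>\<omega>. G (p \<omega>)) (Suc n) x = (\<integral>\<omega>. exp_log N' G n (G (p \<omega>) *v x) \<partial>N)"
      by (simp add: exp_log_Suc trans_op_def Suc)
    also have "\<dots> = (\<integral>\<omega>. exp_log N' G n (G \<omega> *v x) \<partial>distr N N' p)"
      using measurable_compose[OF vec.T_measurable2 vec.admissible_measurable[OF admissible_exp_log]]
      by (intro integral_distr[symmetric] assms)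
    also have "\<dots> = exp_log N' G (Suc n) x"
      by (simp add: assms(3) exp_log_Suc trans_op_def)
    finally show "exp_log N (\<lambda>\<omega>. G (p \<omega>)) (Suc n) x = exp_log N' G (Suc n) x" .
  qed
qed (simp add: exp_log_def)

lemma sl2_coupling_commute:
  assumes "sl2_coupling N G H M w"
  shows "sl2_coupling N H G M w"
proof -
  interpret sl2_coupling N G H M w by fact
  show ?thesis
    by unfold_locales (use w_pos cost_le opnorm_minus in simp_all)
qed

section \<open>Walks whose law is carried by a compact set\<close>

locale compact_SL2 =
  fixes K :: "(real^2^2) set" and g0 :: "real^2^2" and M :: real
  assumes K_SL2: "K \<subseteq> SL2" and K_compact: "compact K" and g0_mem: "g0 \<in> K"
    and K_bound: "\<And>g. g \<in> K \<Longrightarrow> opnorm g \<le> M"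
begin

text \<open>Changes nothing almost surely for a law carried by \<open>K\<close>, but gives
  determinant 1 and the norm bound at every matrix.\<close>

definition retract :: "real^2^2 \<Rightarrow> real^2^2" where
  "retract g = (if g \<in> K then g else g0)"

lemma retract_mem: "retract g \<in> K"
  using g0_mem by (simp add: retract_def)

lemma retract_measurable: "retract \<in> borel \<rightarrow>\<^sub>M borel"
proof -
  have [measurable]: "K \<in> sets borel"
    using K_compact by (intro borel_closed compact_imp_closed)
  show ?thesis unfolding retract_def[abs_def] by measurable
qed

lemma sl2_walkI:
  assumes "prob_space N" "p \<in> N \<rightarrow>\<^sub>M borel"
  shows "sl2_walk N (\<lambda>\<omega>. retract (p \<omega>)) M"
proof -
  interpret prob_space N by fact
  show ?thesis
  proof
    show "(\<lambda>\<omega>. retract (p \<omega>)) \<in> N \<rightarrow>\<^sub>M borel"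
      using assms(2) retract_measurable by (rule measurable_compose)
    show "det (retract (p \<omega>)) = 1" "opnorm (retract (p \<omega>)) \<le> M" for \<omega>
      using retract_mem[of "p \<omega>"] K_SL2 K_bound by (auto simp: SL2_def)
  qed
qed

definition supported :: "(real^2^2) measure \<Rightarrow> bool" where
  "supported \<nu> \<longleftrightarrow> borel_prob_SL2 \<nu> \<and> (AE g in \<nu>. g \<in> K)"

lemma supported_measurable:
  assumes "supported \<nu>" "f \<in> borel \<rightarrow>\<^sub>M R"
  shows "f \<in> \<nu> \<rightarrow>\<^sub>M R"
proof -
  have "sets \<nu> = sets SL2_borel" using assms by (simp add: supported_def borel_prob_SL2_def)
  then show ?thesis
    using measurable_restrict_space1[OF assms(2), of SL2] measurable_cong_sets[OF _ refl] by blast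
qed

lemma supported_prob: "supported \<nu> \<Longrightarrow> prob_space \<nu>"
  by (simp add: supported_def borel_prob_SL2_def)

lemma supported_walk: "supported \<nu> \<Longrightarrow> sl2_walk \<nu> retract M"
  using sl2_walkI[OF supported_prob supported_measurable[OF _ measurable_ident], of \<nu>] by simp

lemma couplings_props:
  assumes "supported \<nu>1" "supported \<nu>2" "\<pi> \<in> couplings \<nu>1 \<nu>2"
  shows "prob_space \<pi>" "fst \<in> \<pi> \<rightarrow>\<^sub>M \<nu>1" "snd \<in> \<pi> \<rightarrow>\<^sub>M \<nu>2" "distr \<pi> \<nu>1 fst = \<nu>1" "distr \<pi> \<nu>2 snd = \<nu>2"
    "AE p in \<pi>. fst p \<in> K \<and> snd p \<in> K"
proof -
  have s: "sets \<pi> = sets (\<nu>1 \<Otimes>\<^sub>M \<nu>2)" and d: "distr \<pi> \<nu>1 fst = \<nu>1" "distr \<pi> \<nu>2 snd = \<nu>2"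
    using assms(3) by (auto simp: couplings_def)
  show "prob_space \<pi>" "distr \<pi> \<nu>1 fst = \<nu>1" "distr \<pi> \<nu>2 snd = \<nu>2"
    using assms(3) by (auto simp: couplings_def)
  show f: "fst \<in> \<pi> \<rightarrow>\<^sub>M \<nu>1" "snd \<in> \<pi> \<rightarrow>\<^sub>M \<nu>2"
    using measurable_cong_sets[OF s refl] measurable_fst measurable_snd by blast+
  have "AE g in distr \<pi> \<nu>1 fst. g \<in> K" "AE g in distr \<pi> \<nu>2 snd. g \<in> K"
    unfolding d using assms(1,2) by (simp_all add: supported_def)
  then have "AE p in \<pi>. fst p \<in> K" "AE p in \<pi>. snd p \<in> K"
    using AE_distrD[OF f(1)] AE_distrD[OF f(2)] by blast+
  then show "AE p in \<pi>. fst p \<in> K \<and> snd p \<in> K" by eventually_elim simp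
qed

text \<open>The strict inequality allows some coupling to beat \<open>w\<close>, without an optimal
  coupling. Both laws become walks on one probability space.\<close>

lemma exists_sl2_coupling:
  assumes "supported \<nu>1" "supported \<nu>2" "wasserstein1 \<nu>1 \<nu>2 < ennreal w"
  shows "\<exists>\<pi>. sl2_coupling \<pi> (\<lambda>p. retract (fst p)) (\<lambda>p. retract (snd p)) M w
    \<and> (\<forall>n. exp_log \<pi> (\<lambda>p. retract (fst p)) n = exp_log \<nu>1 retract n)
    \<and> (\<forall>n. exp_log \<pi> (\<lambda>p. retract (snd p)) n = exp_log \<nu>2 retract n)"
proof -
  obtain \<pi> where \<pi>: "\<pi> \<in> couplings \<nu>1 \<nu>2" and lt: "(\<integral>\<^sup>+ (g, h). ennreal (opnorm (g - h)) \<partial>\<pi>) < ennreal w"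
    using assms(3) unfolding wasserstein1_def INF_less_iff by blast
  note pi = couplings_props[OF assms(1,2) \<pi>]
  have w: "0 < w" using lt by (cases "0 < w") (auto simp: ennreal_neg)
  have m: "fst \<in> \<pi> \<rightarrow>\<^sub>M borel" "snd \<in> \<pi> \<rightarrow>\<^sub>M borel"
    using measurable_compose[OF pi(2) supported_measurable[OF assms(1) measurable_ident]]
      measurable_compose[OF pi(3) supported_measurable[OF assms(2) measurable_ident]] by simp_all
  interpret G: sl2_walk \<pi> "\<lambda>p. retract (fst p)" M by (rule sl2_walkI[OF pi(1) m(1)])
  interpret H: sl2_walk \<pi> "\<lambda>p. retract (snd p)" M by (rule sl2_walkI[OF pi(1) m(2)])
  have "(\<integral>\<^sup>+p. ennreal (opnorm (retract (fst p) - retract (snd p))) \<partial>\<pi>) = (\<integral>\<^sup>+ (g, h). ennreal (opnorm (g - h)) \<partial>\<pi>)"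
    by (rule nn_integral_cong_AE) (use pi(6) in eventually_elim, auto simp: retract_def case_prod_unfold)
  then have le: "(\<integral>\<^sup>+p. ennreal (opnorm (retract (fst p) - retract (snd p))) \<partial>\<pi>) \<le> ennreal w"
    using lt by simp
  have "(\<integral>p. opnorm (retract (fst p) - retract (snd p)) \<partial>\<pi>)
      = enn2real (\<integral>\<^sup>+p. ennreal (opnorm (retract (fst p) - retract (snd p))) \<partial>\<pi>)"
    using G.G_measurable H.G_measurable by (intro integral_eq_nn_integral) (auto simp: opnorm_nonneg)
  also have "\<dots> \<le> enn2real (ennreal w)"
    using le by (intro enn2real_mono) auto
  finally have "sl2_coupling \<pi> (\<lambda>p. retract (fst p)) (\<lambda>p. retract (snd p)) M w"
    using w by unfold_locales auto
  moreover have "exp_log \<pi> (\<lambda>p. retract (fst p)) n = exp_log \<nu>1 retract n" for n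
    by (rule exp_log_distr[OF supported_walk[OF assms(1)] pi(2,4)])
  moreover have "exp_log \<pi> (\<lambda>p. retract (snd p)) n = exp_log \<nu>2 retract n" for n
    by (rule exp_log_distr[OF supported_walk[OF assms(2)] pi(3,5)])
  ultimately show ?thesis by blast
qed

text \<open>The product measure is a coupling of bounded cost. Finiteness makes
  \<open>enn2real\<close> faithful in the final estimate.\<close>

lemma wasserstein1_finite:
  assumes "supported \<nu>1" "supported \<nu>2"
  shows "wasserstein1 \<nu>1 \<nu>2 < \<top>"
proof -
  interpret N1: prob_space \<nu>1 by (rule supported_prob[OF assms(1)])
  interpret N2: prob_space \<nu>2 by (rule supported_prob[OF assms(2)])
  interpret pair_prob_space \<nu>1 \<nu>2 ..
  have snd: "distr (\<nu>1 \<Otimes>\<^sub>M \<nu>2) \<nu>2 snd = \<nu>2"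
  proof (rule measure_eqI)
    fix A assume "A \<in> sets (distr (\<nu>1 \<Otimes>\<^sub>M \<nu>2) \<nu>2 snd)"
    then have A: "A \<in> sets \<nu>2" by simp
    have "snd -` A \<inter> space (\<nu>1 \<Otimes>\<^sub>M \<nu>2) = space \<nu>1 \<times> A"
      using sets.sets_into_space[OF A] by (auto simp: space_pair_measure)
    then show "emeasure (distr (\<nu>1 \<Otimes>\<^sub>M \<nu>2) \<nu>2 snd) A = emeasure \<nu>2 A"
      using A by (simp add: emeasure_distr N2.emeasure_pair_measure_Times N1.emeasure_space_1)
  qed simp
  have \<pi>: "\<nu>1 \<Otimes>\<^sub>M \<nu>2 \<in> couplings \<nu>1 \<nu>2"
    unfolding couplings_def using prob_space_axioms N2.distr_pair_fst[of \<nu>1] snd by simp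
  have "wasserstein1 \<nu>1 \<nu>2 \<le> (\<integral>\<^sup>+ (g, h). ennreal (opnorm (g - h)) \<partial>(\<nu>1 \<Otimes>\<^sub>M \<nu>2))"
    unfolding wasserstein1_def by (rule INF_lower[OF \<pi>])
  also have "\<dots> \<le> (\<integral>\<^sup>+ p. ennreal (2 * M) \<partial>(\<nu>1 \<Otimes>\<^sub>M \<nu>2))"
  proof (rule nn_integral_mono_AE)
    show "AE p in \<nu>1 \<Otimes>\<^sub>M \<nu>2. (case p of (g, h) \<Rightarrow> ennreal (opnorm (g - h))) \<le> ennreal (2 * M)"
      using couplings_props(6)[OF assms \<pi>]
    proof eventually_elim
      case (elim p)
      then have "opnorm (fst p - snd p) \<le> 2 * M"
        using opnorm_add[of "fst p" "- snd p"] opnorm_minus[of 0 "snd p"] K_bound[of "fst p"] K_bound[of "snd p"] by simp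
      then show ?case by (simp add: case_prod_unfold ennreal_leI)
    qed
  qed
  also have "\<dots> = ennreal (2 * M)" by (simp add: emeasure_space_1)
  finally show ?thesis by (simp add: le_less_trans)
qed

text \<open>Almost surely all letters lie in \<open>K\<close>, where the retraction is the identity.
  Two almost sure limits agree at some point of the probability space, so the definite description
  is justified.\<close>

lemma lyapunov1_eq:
  assumes "supported \<nu>" and lim: "\<And>n x. x \<noteq> 0 \<Longrightarrow> \<bar>expansion \<nu> retract n x - real n * L\<bar> \<le> C"
  shows "lyapunov1 \<nu> = L"
proof -
  interpret sl2_walk \<nu> retract M by (rule supported_walk[OF assms(1)])
  let ?U = "PiM (UNIV :: int set) (\<lambda>_. \<nu>)"
  interpret U: prob_space ?U
    by (intro prob_space_PiM prob_space_axioms)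
  let ?Q = "\<lambda>L g. (\<lambda>n. ln (opnorm (cocycle g n)) / real n) \<longlonglongrightarrow> L"
  have "AE w in ?U. w i \<in> K" for i
    using assms(1) by (intro AE_PiM_component) (auto simp: supported_def prob_space_axioms)
  then have "AE w in ?U. \<forall>i. w i \<in> K"
    by (simp add: AE_all_countable)
  moreover have "AE w in ?U. ?Q L (\<lambda>i. retract (w i))"
    by (rule AE_ln_opnorm_limit) (rule lim)
  ultimately have AE: "AE w in ?U. ?Q L w"
    by eventually_elim (simp add: retract_def)
  show ?thesis
    unfolding lyapunov1_def
  proof (rule the_equality)
    show "AE w in ?U. ?Q L w" by (rule AE)
    fix L' assume "AE w in ?U. ?Q L' w"
    with AE have "AE w in ?U. L' = L"
      by eventually_elim (rule LIMSEQ_unique)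
    then show "L' = L" by simp
  qed
qed

end

section \<open>Hoelder continuity\<close>

text \<open>The support carries the whole mass; were it a single point, the measure would be a Dirac
  mass.\<close>

lemma exists_two_support_points:
  fixes \<rho> :: "real measure"
  assumes "prob_space \<rho>" "sets \<rho> = sets borel" "\<nexists>a. \<rho> = return borel a"
  shows "\<exists>a\<in>msupport \<rho>. \<exists>b\<in>msupport \<rho>. a < b"
proof (rule ccontr)
  assume neg: "\<not> ?thesis"
  interpret prob_space \<rho> by fact
  have supp: "AE x in \<rho>. x \<in> msupport \<rho>"
    by (rule AE_msupport) (simp add: assms(2) sets_eq_imp_space_eq[OF assms(2)])
  then have "msupport \<rho> \<noteq> {}" by auto
  then obtain a where a: "a \<in> msupport \<rho>" by blast
  have "x = a" if "x \<in> msupport \<rho>" for x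
    using neg a that by (metis linorder_neqE_linordered_idom)
  with supp have AE: "AE x in \<rho>. x = a"
    by (auto elim: eventually_mono)
  have "\<rho> = return borel a"
  proof (rule measure_eqI)
    fix A assume A: "A \<in> sets \<rho>"
    show "emeasure \<rho> A = emeasure (return borel a) A"
    proof (cases "a \<in> A")
      case True
      then have "AE x in \<rho>. x \<in> A" using AE by (auto elim: eventually_mono)
      then have "emeasure \<rho> A = 1" by (rule emeasure_eq_1_AE[OF A])
      then show ?thesis using True A assms(2) by simp
    next
      case False
      then have "AE x in \<rho>. x \<notin> A" using AE by (auto elim: eventually_mono)
      then have "emeasure \<rho> A = 0"
        using A by (subst (asm) AE_iff_measurable[where N = A]) (auto dest: sets.sets_into_space)
      then show ?thesis using False A assms(2) by simp
    qed
  qed (simp add: assms(2))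
  then show False using assms(3) by blast
qed

text \<open>At order -2\<theta> the linear term gains \<open>2 * \<theta> * c\<close>, and the
  exponent is so small that the quadratic term loses at most \<open>\<theta> * c\<close>.\<close>

lemma (in sl2_walk) negative_moment_contraction:
  fixes c :: real and n :: nat
  assumes c: "0 < c" "\<And>x. x \<noteq> 0 \<Longrightarrow> c \<le> expansion N G n x" and "x \<noteq> 0"
  defines "\<theta> \<equiv> small_exponent M n c"
  shows "(vec.P ^^ n) (\<lambda>y. norm y powr (- (2 * \<theta>))) x \<le> (1 - \<theta> * c) * norm x powr (- (2 * \<theta>))"
proof -
  let ?T = "real n * ln M"
  note h = small_exponent[OF M_ge_1 c(1), of n, folded \<theta>_def]
  have "(vec.P ^^ n) (\<lambda>y. norm y powr (- (2 * \<theta>))) x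
      \<le> norm x powr (- (2 * \<theta>)) * (1 + - (2 * \<theta>) * expansion N G n x + (- (2 * \<theta>) * ?T)\<^sup>2)"
    using h by (intro funpow_norm_powr_le assms) (simp add: mult.assoc)
  also have "\<dots> \<le> norm x powr (- (2 * \<theta>)) * (1 - \<theta> * c)"
  proof (intro mult_left_mono)
    have "2 * \<theta> * c \<le> 2 * \<theta> * expansion N G n x"
      using h c(2)[OF assms(3)] by (intro mult_left_mono) auto
    moreover have "(- (2 * \<theta>) * ?T)\<^sup>2 = \<theta> * (4 * \<theta> * ?T\<^sup>2)"
      by (simp add: power2_eq_square)
    moreover have "\<theta> * (4 * \<theta> * ?T\<^sup>2) \<le> \<theta> * c"
      using h by (intro mult_left_mono) auto
    moreover have "- (2 * \<theta>) * expansion N G n x = - (2 * \<theta> * expansion N G n x)" "2 * \<theta> * c = 2 * (\<theta> * c)"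
      by simp_all
    ultimately show "1 + - (2 * \<theta>) * expansion N G n x + (- (2 * \<theta>) * ?T)\<^sup>2 \<le> 1 - \<theta> * c"
      by linarith
  qed simp
  finally show ?thesis by (simp add: mult.commute)
qed

lemma le_of_linear_growth:
  fixes d A B :: real
  assumes "\<And>k::nat. real k * d \<le> A + real k * B"
  shows "d \<le> B"
proof (rule ccontr)
  assume "\<not> d \<le> B"
  then obtain k :: nat where "A / (d - B) < real k" "0 < d - B"
    using reals_Archimedean2 by auto
  then show False using assms[of k] by (simp add: field_simps)
qed

context compact_SL2
begin

lemma transfer_expansion_positive:
  assumes \<rho>: "prob_space \<rho>" "sets \<rho> = sets borel" "\<nexists>a. \<rho> = return borel a"
    and supp: "supported (transfer_law \<rho> E)" and g0: "g0 = transfer_matrix E \<omega>0"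
  shows "\<exists>n c. 0 < c \<and> (\<forall>x. x \<noteq> 0 \<longrightarrow> c \<le> expansion (transfer_law \<rho> E) retract n x)"
proof -
  interpret prob_space \<rho> by fact
  let ?p = "transfer_matrix E" and ?\<mu> = "transfer_law \<rho> E"
  \<comment> \<open>The default point \<open>g0\<close> is itself a transfer matrix, so the
    retracted matrix is the transfer matrix of the modified potential for every \<omega>, not just
    almost every one.\<close>
  define v where "v \<omega> = (if ?p \<omega> \<in> K then \<omega> else \<omega>0)" for \<omega>
  have p: "?p \<in> \<rho> \<rightarrow>\<^sub>M SL2_borel"
    using transfer_matrix_measurable \<rho>(2) measurable_cong_sets by blast
  have p': "?p \<in> \<rho> \<rightarrow>\<^sub>M borel"
    using measurable_compose[OF p measurable_restrict_space1[OF measurable_ident]] by simp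
  have s\<mu>: "sets ?\<mu> = sets SL2_borel" by (simp add: transfer_law_def)
  have p\<mu>: "?p \<in> \<rho> \<rightarrow>\<^sub>M ?\<mu>" using p measurable_cong_sets[OF refl s\<mu>] by blast
  have d\<mu>: "distr \<rho> ?\<mu> ?p = ?\<mu>"
    unfolding transfer_law_def by (rule distr_cong) (simp_all add: s\<mu>)
  have AE: "AE \<omega> in \<rho>. v \<omega> = \<omega>"
  proof -
    have "AE g in distr \<rho> ?\<mu> ?p. g \<in> K" using supp unfolding d\<mu> by (simp add: supported_def)
    then have "AE \<omega> in \<rho>. ?p \<omega> \<in> K" by (rule AE_distrD[OF p\<mu>])
    then show ?thesis by eventually_elim (simp add: v_def)
  qed
  have K: "K \<in> sets borel" using K_compact by (intro borel_closed compact_imp_closed)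
  have id: "(\<lambda>\<omega>. \<omega>) \<in> borel_measurable \<rho>"
    by (rule measurable_ident_sets[OF \<rho>(2)])
  have vm: "v \<in> borel_measurable \<rho>"
    unfolding v_def using p' K id by measurable
  obtain a b where ab: "a \<in> msupport \<rho>" "b \<in> msupport \<rho>" "a < b"
    using exists_two_support_points[OF \<rho>] by blast
  interpret W: sl2_walk \<rho> "\<lambda>\<omega>. retract (?p \<omega>)" M
    by (rule sl2_walkI[OF \<rho>(1) p'])
  interpret S: schrodinger_walk \<rho> "\<lambda>\<omega>. retract (?p \<omega>)" M v E a b
  proof
    show "retract (?p \<omega>) = ?p (v \<omega>)" for \<omega>
      by (simp add: retract_def v_def flip: g0)
    fix s \<eta> :: real assume s: "s \<in> {a, b}" "0 < \<eta>"
    let ?B = "{x. \<bar>x - s\<bar> < \<eta>}"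
    have ball: "?B = ball s \<eta>" by (auto simp: dist_real_def)
    have sB: "?B \<inter> space \<rho> \<in> sets \<rho>"
      unfolding ball by (simp add: \<rho>(2) sets_eq_imp_space_eq[OF \<rho>(2)])
    have "0 < emeasure \<rho> (?B \<inter> space \<rho>)"
      using s ab unfolding ball by (auto simp: msupport_def)
    then have "0 < prob (?B \<inter> space \<rho>)"
      by (simp add: emeasure_eq_measure)
    also have "prob (?B \<inter> space \<rho>) = prob {\<omega> \<in> space \<rho>. \<bar>v \<omega> - s\<bar> < \<eta>}"
    proof (rule finite_measure_eq_AE)
      show "AE x in \<rho>. (x \<in> ?B \<inter> space \<rho>) = (x \<in> {\<omega> \<in> space \<rho>. \<bar>v \<omega> - s\<bar> < \<eta>})"
        using AE by eventually_elim auto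
      show "{\<omega> \<in> space \<rho>. \<bar>v \<omega> - s\<bar> < \<eta>} \<in> sets \<rho>"
        using vm by measurable
    qed (rule sB)
    finally show "0 < prob {\<omega> \<in> space \<rho>. \<bar>v \<omega> - s\<bar> < \<eta>}" .
  qed (use ab vm in auto)
  have "exp_log \<rho> (\<lambda>\<omega>. retract (?p \<omega>)) n = exp_log ?\<mu> retract n" for n
    by (rule exp_log_distr[OF supported_walk[OF supp] p\<mu> d\<mu>])
  then show ?thesis
    using S.expansion_positive by (simp add: expansion_def)
qed

lemma expansion_perturb:
  assumes "supported \<mu>" "supported \<nu>" and pos: "\<And>x. x \<noteq> 0 \<Longrightarrow> c \<le> expansion \<mu> retract n x"
    and W: "wasserstein1 \<nu> \<mu> < ennreal w" and w: "real n * M ^ (2 * n) * w \<le> c / 2" and "x \<noteq> 0"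
  shows "c / 2 \<le> expansion \<nu> retract n x"
proof -
  obtain \<pi> where \<pi>: "sl2_coupling \<pi> (\<lambda>p. retract (fst p)) (\<lambda>p. retract (snd p)) M w"
    "exp_log \<pi> (\<lambda>p. retract (fst p)) n = exp_log \<nu> retract n"
    "exp_log \<pi> (\<lambda>p. retract (snd p)) n = exp_log \<mu> retract n"
    using exists_sl2_coupling[OF assms(2,1) W] by blast
  interpret sl2_coupling \<pi> "\<lambda>p. retract (snd p)" "\<lambda>p. retract (fst p)" M w
    by (rule sl2_coupling_commute[OF \<pi>(1)])
  have "exp_log \<mu> retract n x - exp_log \<nu> retract n x \<le> real n * M ^ (2 * n) * w"
    using exp_log_coupling_le[OF assms(6), of n] by (simp add: \<pi>)
  then show ?thesis
    using w pos[OF assms(6)] by (simp add: expansion_def)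
qed

text \<open>The difference of the expansions at time \<open>k\<close> is \<open>k\<close> times the
  difference of the exponents up to a constant, and dividing by \<open>k\<close> removes every
  bounded term. Only the linear part of the coupling error survives.\<close>

lemma lyapunov1_holder:
  fixes c :: real and n :: nat
  assumes c: "0 < c" and \<nu>: "supported \<nu>1" "supported \<nu>2"
    and pos: "\<And>x. x \<noteq> 0 \<Longrightarrow> c \<le> expansion \<nu>1 retract n x" "\<And>x. x \<noteq> 0 \<Longrightarrow> c \<le> expansion \<nu>2 retract n x"
  defines "\<theta> \<equiv> small_exponent M n c"
  shows "\<bar>lyapunov1 \<nu>1 - lyapunov1 \<nu>2\<bar> \<le> coupling_const M (1 - \<theta> * c) n * enn2real (wasserstein1 \<nu>1 \<nu>2) powr \<theta>"
proof -
  interpret N1: sl2_walk \<nu>1 retract M by (rule supported_walk[OF \<nu>(1)])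
  interpret N2: sl2_walk \<nu>2 retract M by (rule supported_walk[OF \<nu>(2)])
  let ?\<kappa> = "1 - \<theta> * c"
  let ?C = "coupling_const M ?\<kappa> n"
  note h = small_exponent[OF N1.M_ge_1 c, of n, folded \<theta>_def]
  have \<kappa>: "?\<kappa> < 1" using h c by simp
  obtain L1 where L1: "\<And>k x. x \<noteq> 0 \<Longrightarrow> \<bar>expansion \<nu>1 retract k x - real k * L1\<bar> \<le> 4 * ?C"
    using N1.expansion_limit[OF h(1,2) \<kappa> N1.negative_moment_contraction[OF c pos(1), folded \<theta>_def]] by blast
  obtain L2 where L2: "\<And>k x. x \<noteq> 0 \<Longrightarrow> \<bar>expansion \<nu>2 retract k x - real k * L2\<bar> \<le> 4 * ?C"
    using N2.expansion_limit[OF h(1,2) \<kappa> N2.negative_moment_contraction[OF c pos(2), folded \<theta>_def]] by blast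
  have lyap: "lyapunov1 \<nu>1 = L1" "lyapunov1 \<nu>2 = L2"
    by (rule lyapunov1_eq[OF \<nu>(1) L1], assumption) (rule lyapunov1_eq[OF \<nu>(2) L2], assumption)
  let ?W = "enn2real (wasserstein1 \<nu>1 \<nu>2)"
  have bound: "\<bar>L1 - L2\<bar> \<le> ?C * w powr \<theta>" if w: "?W < w" for w
  proof -
    have "wasserstein1 \<nu>1 \<nu>2 = ennreal ?W"
      using wasserstein1_finite[OF \<nu>] by simp
    also have "\<dots> < ennreal w"
      using w by (intro ennreal_lessI) (auto intro: le_less_trans[OF enn2real_nonneg])
    finally obtain \<pi> where \<pi>: "sl2_coupling \<pi> (\<lambda>p. retract (fst p)) (\<lambda>p. retract (snd p)) M w"
      "\<And>k. exp_log \<pi> (\<lambda>p. retract (fst p)) k = exp_log \<nu>1 retract k"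
      "\<And>k. exp_log \<pi> (\<lambda>p. retract (snd p)) k = exp_log \<nu>2 retract k"
      using exists_sl2_coupling[OF \<nu>] by blast
    interpret sl2_coupling \<pi> "\<lambda>p. retract (fst p)" "\<lambda>p. retract (snd p)" M w
      by (rule \<pi>(1))
    have pos': "c \<le> expansion \<pi> (\<lambda>p. retract (fst p)) n x" if "x \<noteq> 0" for x
      using pos(1)[OF that] by (simp add: expansion_def \<pi>(2))
    let ?e = "axis 1 1 :: real^2"
    have e: "?e \<noteq> 0" by (simp add: axis_eq_0_iff)
    have "\<bar>expansion \<nu>1 retract k ?e - expansion \<nu>2 retract k ?e\<bar> \<le> ?C * (1 + real k * w powr \<theta>)" for k
      using expansion_coupling[OF e e h(1,2) \<kappa> G.negative_moment_contraction[OF c pos', folded \<theta>_def], of k]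
      by (simp add: expansion_def \<pi>(2,3))
    \<comment> \<open>Each limit contributes \<open>4 * ?C\<close> and the coupling one more
      \<open>?C\<close>.\<close>
    then have "real k * \<bar>L1 - L2\<bar> \<le> 9 * ?C + real k * (?C * w powr \<theta>)" for k
    proof -
      have "real k * \<bar>L1 - L2\<bar> = \<bar>real k * L1 - real k * L2\<bar>"
        by (simp add: abs_mult right_diff_distrib[symmetric])
      also have "\<dots> \<le> 9 * ?C + ?C * (real k * w powr \<theta>)"
        using L1[OF e, of k] L2[OF e, of k] \<open>\<And>k. \<bar>expansion \<nu>1 retract k ?e - expansion \<nu>2 retract k ?e\<bar> \<le> ?C * (1 + real k * w powr \<theta>)\<close>[of k]
        unfolding distrib_left by linarith
      finally show ?thesis by (simp add: ac_simps)
    qed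
    then show ?thesis by (rule le_of_linear_growth)
  qed
  \<comment> \<open>The bound holds for \<open>w\<close> strictly above the distance, which may be
    0, so it is passed to the limit from the right; the positive exponent gives continuity at
    0.\<close>
  have "\<forall>\<^sub>F w in at_right ?W. 0 \<le> w"
    using eventually_at_right_less[of ?W] by (rule eventually_mono) (meson enn2real_nonneg less_imp_le order_trans)
  then have "((\<lambda>w. ?C * w powr \<theta>) \<longlongrightarrow> ?C * ?W powr \<theta>) (at_right ?W)"
    using h(1) by (intro tendsto_mult_left tendsto_powr' tendsto_ident_at tendsto_const) auto
  moreover have "\<forall>\<^sub>F w in at_right ?W. \<bar>L1 - L2\<bar> \<le> ?C * w powr \<theta>"
    using bound by (intro eventually_at_rightI[of ?W "?W + 1"]) auto
  ultimately have "\<bar>L1 - L2\<bar> \<le> ?C * ?W powr \<theta>"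
    by (rule tendsto_lowerbound) simp
  then show ?thesis by (simp add: lyap)
qed

end

theorem corollary1p1:
  fixes \<rho> :: "real measure" and E :: real and K :: "(real^2^2) set"
  assumes "prob_space \<rho>" and "sets \<rho> = sets borel"
    and "compact (msupport \<rho>)"
    and "\<nexists>a. \<rho> = return borel a"
    and "K \<subseteq> SL2" and "compact K"
    and "msupport (transfer_law \<rho> E) \<subseteq> K"
  shows "\<exists>\<delta>>0. \<exists>C::real. \<exists>\<theta>>0. \<forall>\<nu>1 \<nu>2.
    borel_prob_SL2 \<nu>1 \<longrightarrow> borel_prob_SL2 \<nu>2 \<longrightarrow>
    msupport \<nu>1 \<subseteq> K \<longrightarrow> msupport \<nu>2 \<subseteq> K \<longrightarrow>
    wasserstein1 \<nu>1 (transfer_law \<rho> E) < ennreal \<delta> \<longrightarrow>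
    wasserstein1 \<nu>2 (transfer_law \<rho> E) < ennreal \<delta> \<longrightarrow>
    \<bar>lyapunov1 \<nu>1 - lyapunov1 \<nu>2\<bar> \<le> C * enn2real (wasserstein1 \<nu>1 \<nu>2) powr \<theta>"
proof -
  let ?\<mu> = "transfer_law \<rho> E"
  interpret prob_space \<rho> by fact
  have \<mu>: "borel_prob_SL2 ?\<mu>" by (rule borel_prob_transfer_law[OF assms(1,2)])
  have AE: "AE g in ?\<mu>. g \<in> K" by (rule borel_prob_SL2_AE[OF \<mu> assms(7)])
  have p: "transfer_matrix E \<in> \<rho> \<rightarrow>\<^sub>M SL2_borel"
    using transfer_matrix_measurable assms(2) measurable_cong_sets by blast
  have "AE \<omega> in \<rho>. transfer_matrix E \<omega> \<in> K"
    using AE unfolding transfer_law_def by (rule AE_distrD[OF p])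
  then have "\<exists>\<omega>. transfer_matrix E \<omega> \<in> K"
    by (rule contrapos_pp) simp
  then obtain \<omega>0 where \<omega>0: "transfer_matrix E \<omega>0 \<in> K" by blast
  have "compact (opnorm ` K)"
    by (rule compact_continuous_image[OF continuous_on_opnorm assms(6)])
  then have "bdd_above (opnorm ` K)"
    by (intro bounded_imp_bdd_above compact_imp_bounded)
  then obtain M where M: "\<And>g. g \<in> K \<Longrightarrow> opnorm g \<le> M"
    by (auto simp: bdd_above_def)
  interpret compact_SL2 K "transfer_matrix E \<omega>0" M
    by unfold_locales (use assms \<omega>0 M in auto)
  have sup: "supported \<nu>" if "borel_prob_SL2 \<nu>" "msupport \<nu> \<subseteq> K" for \<nu>
    using that borel_prob_SL2_AE by (simp add: supported_def)
  have sup\<mu>: "supported ?\<mu>" by (rule sup[OF \<mu> assms(7)])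
  interpret N: sl2_walk ?\<mu> retract M by (rule supported_walk[OF sup\<mu>])
  obtain n c where c: "0 < c" "\<And>x. x \<noteq> 0 \<Longrightarrow> c \<le> expansion ?\<mu> retract n x"
    using transfer_expansion_positive[OF assms(1,2,4) sup\<mu> refl] by blast
  define k where "k = real n * M ^ (2 * n)"
  have k: "0 \<le> k" using N.M_ge_1 by (simp add: k_def)
  \<comment> \<open>So small that passing from the transfer law to a nearby law costs at most half
    of the expansion over \<open>n\<close> steps.\<close>
  define \<delta> where "\<delta> = c / (2 * (k + 1))"
  have \<delta>: "0 < \<delta>" using c k by (simp add: \<delta>_def)
  have "k * \<delta> \<le> (k + 1) * \<delta>" using \<delta> by simp
  also have "(k + 1) * \<delta> = c / 2" using k by (simp add: \<delta>_def field_simps)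
  finally have k\<delta>: "real n * M ^ (2 * n) * \<delta> \<le> c / 2" by (simp add: k_def)
  let ?\<theta> = "small_exponent M n (c / 2)"
  have c2: "0 < c / 2" using c by simp
  have near: "c / 2 \<le> expansion \<nu> retract n x"
    if "borel_prob_SL2 \<nu>" "msupport \<nu> \<subseteq> K" "wasserstein1 \<nu> ?\<mu> < ennreal \<delta>" "x \<noteq> 0" for \<nu> x
    by (rule expansion_perturb[OF sup\<mu> sup[OF that(1,2)] c(2) that(3) k\<delta> that(4)])
  show ?thesis
  proof (intro exI conjI allI impI)
    show "0 < \<delta>" by (rule \<delta>)
    show "0 < ?\<theta>" by (rule small_exponent(1)[OF N.M_ge_1 c2])
    fix \<nu>1 \<nu>2 :: "(real^2^2) measure"
    assume "borel_prob_SL2 \<nu>1" "borel_prob_SL2 \<nu>2" "msupport \<nu>1 \<subseteq> K" "msupport \<nu>2 \<subseteq> K"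
      "wasserstein1 \<nu>1 ?\<mu> < ennreal \<delta>" "wasserstein1 \<nu>2 ?\<mu> < ennreal \<delta>"
    then show "\<bar>lyapunov1 \<nu>1 - lyapunov1 \<nu>2\<bar>
        \<le> coupling_const M (1 - ?\<theta> * (c / 2)) n * enn2real (wasserstein1 \<nu>1 \<nu>2) powr ?\<theta>"
      by (intro lyapunov1_holder[OF c2] sup near)
  qed
qed

end
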